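(* Let $m,N\in\mathbf N$, $1<p<N/m$, and let $(u_n)$ be a bounded sequence in $\dot W^{m,p}(\mathbf R^N)$. Assume that on a subsequence, still denoted by $n$, $(u_n)$ has a profile decomposition (in the sense defined in the context) with profile elements $(w^l,y_{l,n},j_{l,n},\Lambda)\in\dot W^{m,p}(\mathbf R^N)\times\mathbf R^N\times\mathbf Z\times(\mathbf N\cup\{0,\infty\})$ ($l\in\mathbf Z_{\ge0}^{<\Lambda+1}$, $n\in\mathbf Z_{\ge l}$). Let $\alpha\in(\mathbf Z_{\ge0})^N$ be a multi-index with $|\alpha|<m$, write $q=p^*_{m-|\alpha|}$, let $f_\alpha\in C(\mathbf R)$ satisfy $|f_\alpha(s)|\le C|s|^{q-1}$ for all $s\in\mathbf R$ with some $C>0$, and let $F_\alpha(s):=\int_0^sf_\alpha(t)\,dt$, $s\in\mathbf R$. Assume that the following limits exist: $$a^{\pm}:=\lim_{s\to0^\pm}|s|^{-q}F_\alpha(s),\qquad A^{\pm}:=\lim_{s\to\pm\infty}|s|^{-q}F_\alpha(s).$$ Define $$F_{\alpha,0}(s):=\begin{cases} a^+|s|^{q} & s\ge0, \\ a^-|s|^{q} & s<0, \end{cases}\qquad F_{\alpha,\infty}(s):=\begin{cases} A^+|s|^{q} & s\ge0, \\ A^-|s|^{q} & s<0. \end{cases}$$ Then, on a further subsequence if necessary, still denoted by $n$, there are sets $\mathcal N_1,\mathcal N_2,\mathcal N_3$ with $\mathcal N_1\cup\mathcal N_2\cup\mathcal N_3=\mathbf Z_{\ge0}^{<\Lambda+1}$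 such that $j_{l,n}\to j^l$ for some $j^l\in\mathbf Z$ if $l\in\mathcal N_1$, $j_{l,n}\to+\infty$ if $l\in\mathcal N_2$, $j_{l,n}\to-\infty$ if $l\in\mathcal N_3$ (as $n\to\infty$), and $$\lim_{n\to\infty}\int_{\mathbf R^N}F_\alpha(\partial^\alpha u_n(x))\,dx=\sum_{l\in\mathcal N_1}\int_{\mathbf R^N}F_\alpha\Bigl(\partial^\alpha\bigl[2^{j^lN/p^*_m}w^l(2^{j^l}x)\bigr]\Bigr)dx+\sum_{l\in\mathcal N_2}\int_{\mathbf R^N}F_{\alpha,\infty}(\partial^\alpha w^l(x))\,dx+\sum_{l\in\mathcal N_3}\int_{\mathbf R^N}F_{\alpha,0}(\partial^\alpha w^l(x))\,dx.$$
   Context: For $1\le p<N/m$, $\dot W^{m,p}(\mathbf R^N)$ is the completion (closure) of $C_c^\infty(\mathbf R^N)$ in the norm $\|u\|_{\dot W^{m,p}(\mathbf R^N)}=\bigl(\sum_{|\alpha|=m}\|\partial^\alpha u\|^p_{L^p(\mathbf R^N)}\bigr)^{1/p}$; for an open set $\Omega$, $\|u\|_{\dot W^{m,p}(\Omega)}=\bigl(\sum_{|\alpha|=m}\|\partial^\alpha u\|_{L^p(\Omega)}^p\bigr)^{1/p}$ (for $m=0$ this is the $L^p$ norm). The critical exponents are $p^*_s=pN/(N-sp)$ for integers $1\le s\le m$. $B(x,r)$ is the closed ball in $\mathbf R^N$. $\mathbf Z_{\ge a}$ is the set of integers $\ge a$. For $\Lambda\in\mathbf N\cup\{0,+\infty\}$,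 $\mathbf Z_{\ge0}^{<\Lambda+1}=\{0,\dots,\Lambda\}$ if $\Lambda<\infty$ and $\mathbf Z_{\ge0}$ if $\Lambda=\infty$. If $\Lambda<\infty$, $\lim_{L\to\Lambda}a_L$ and $\limsup_{L\to\Lambda}a_L$ mean $a_\Lambda$; if $\Lambda=\infty$ they are the usual limits as $L\to\infty$, and $\sum_{l=0}^\Lambda$ is the infinite series. Profile decomposition. A (sub)sequence $(u_n)$, bounded in $\dot W^{m,p}(\mathbf R^N)$, has a profile decomposition with profile elements $(w^l,y_{l,n},j_{l,n},\Lambda)$ if, with residual terms $r^L_n\in\dot W^{m,p}(\mathbf R^N)$ defined by $$u_n=\sum_{l=0}^L2^{j_{l,n}N/p^*_m}w^l(2^{j_{l,n}}(\cdot-y_{l,n}))+r^L_n,\quad L\in\mathbf Z_{\ge0}^{<\Lambda+1},\ n\in\mathbf Z_{\ge L},$$ the following hold: (1) $y_{0,n}=0$, $j_{0,n}=0$ for all $n$, and $w^l\ne0$ for $1\le l\in\mathbf Z_{\ge0}^{<\Lambda+1}$; (2) for $l\ne k$, $|j_{l,n}-j_{k,n}|+2^{j_{k,n}}|y_{l,n}-y_{k,n}|\to\infty$ as $n\to\infty$; moreover $j_{l,n}-j_{k,n}$ either tends to $+\infty$, or tends to $-\infty$, or converges, and either $2^{j_{k,n}}|y_{l,n}-y_{k,n}|\to\infty$ or $2^{j_{k,n}}(y_{l,n}-y_{k,n})$ converges; (3) $2^{-j_{l,n}N/p^*_m}u_n(2^{-j_{l,n}}\cdot+y_{l,n})\to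 w^l$ weakly in $\dot W^{m,p}(\mathbf R^N)$ and a.e. on $\mathbf R^N$ as $n\to\infty$, for each $l$; (4) $2^{-j_{k,n}N/p^*_m}r^L_n(2^{-j_{k,n}}\cdot+y_{k,n})$ converges, weakly in $\dot W^{m,p}(\mathbf R^N)$ and a.e., to $0$ if $k\le L$ and to $w^k$ if $k\ge L+1$, as $n\to\infty$; (5) $\limsup_n\|u_n\|^p_{\dot W^{m,p}(\mathbf R^N)}\ge\sum_{l=0}^\Lambda\|w^l\|^p_{\dot W^{m,p}(\mathbf R^N)}+\limsup_{L\to\Lambda}\limsup_{R\to\infty}\limsup_{n\to\infty}\|r^L_n\|^p_{\dot W^{m,p}(\mathbf R^N\setminus\mathcal B_{n,R,L})}$, where $\mathcal B_{n,R,L}=\bigcup_{l=0}^LB(y_{l,n},2^{-j_{l,n}}R)$; (6) $\lim_{L\to\Lambda}\sup_{\phi\in U}\limsup_{n\to\infty}\sup_{y\in\mathbf R^N,j\in\mathbf Z}|\langle\phi,2^{-jN/p^*_m}r^L_n(2^{-j}\cdot+y)\rangle|=0$, where $U$ is the closed unit ball of $[\dot W^{m,p}(\mathbf R^N)]^*$; (7) $\limsup_{L\to\Lambda}\limsup_{n\to\infty}\|r^L_n\|_{\dot W^{m,p}(\mathbf R^N)}\le2\limsup_{n\to\infty}\|u_n\|_{\dot W^{m,p}(\mathbf R^N)}<\infty$; (8) $\lim_{L\to\Lambda}\limsup_{n\to\infty}\|r^L_n\|_{L^{p^*_m}(\mathbf R^N)}=0$ and $\lim_{L\to\Lambda}\limsup_{n\to\infty}\|r^L_n\|_{\dot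 W^{k,p^*_{m-k}}(\mathbf R^N)}=0$ for all integers $0\le k<m$. *)

theory Defs
  imports "HOL-Analysis.Analysis" "HOL-Library.Extended_Nat"
begin

text \<open>A multi-index in $(\mathbf{Z}_{\ge 0})^N$ is a vector of type \<^typ>\<open>nat ^ 'n\<close>, where
  $N$ is the cardinality of the index type.\<close>

definition mi_order :: "nat ^ 'n \<Rightarrow> nat" where
  "mi_order \<alpha> = (\<Sum>i\<in>UNIV. \<alpha> $ i)"

definition pd :: "'n \<Rightarrow> (real ^ 'n \<Rightarrow> real) \<Rightarrow> real ^ 'n \<Rightarrow> real" where
  "pd i f x = deriv (\<lambda>t. f (x + t *\<^sub>R axis i 1)) 0"

definition smooth :: "(real ^ 'n \<Rightarrow> real) \<Rightarrow> bool" where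
  "smooth f \<longleftrightarrow> (\<forall>is x. foldr pd is f differentiable (at x))"

definition test_functions :: "(real ^ 'n \<Rightarrow> real) set" where
  "test_functions = {\<phi>. smooth \<phi> \<and> compact (closure {x. \<phi> x \<noteq> 0})}"

text \<open>The index type carries no order, so the order in which the partial derivatives are taken is
  left to a choice; it is used for smooth functions only, where that order is irrelevant.\<close>

definition mi_pd :: "nat ^ 'n \<Rightarrow> (real ^ 'n \<Rightarrow> real) \<Rightarrow> real ^ 'n \<Rightarrow> real" where
  "mi_pd \<alpha> f = foldr pd (SOME is. \<forall>i. count_list is i = \<alpha> $ i) f"

definition locally_integrable :: "(real ^ 'n \<Rightarrow> real) \<Rightarrow> bool" where
  "locally_integrable u \<longleftrightarrow> (\<forall>K. compact K \<longrightarrow> set_integrable lebesgue K u)"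

definition is_weak_deriv ::
  "nat ^ 'n \<Rightarrow> (real ^ 'n \<Rightarrow> real) \<Rightarrow> (real ^ 'n \<Rightarrow> real) \<Rightarrow> bool" where
  "is_weak_deriv \<alpha> u v \<longleftrightarrow> locally_integrable u \<and> locally_integrable v \<and>
     (\<forall>\<phi>\<in>test_functions.
        (LINT x|lebesgue. u x * mi_pd \<alpha> \<phi> x) = (- 1) ^ mi_order \<alpha> * (LINT x|lebesgue. v x * \<phi> x))"

text \<open>A representative of the distributional derivative, unique up to null sets if it exists as a
  locally integrable function.\<close>

definition wderiv :: "nat ^ 'n \<Rightarrow> (real ^ 'n \<Rightarrow> real) \<Rightarrow> real ^ 'n \<Rightarrow> real" where
  "wderiv \<alpha> u = (SOME v. is_weak_deriv \<alpha> u v)"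

definition epow :: "ennreal \<Rightarrow> real \<Rightarrow> ennreal" where
  "epow a r = (if a = \<infinity> then \<infinity> else ennreal (enn2real a powr r))"

definition Lp_norm :: "real \<Rightarrow> (real ^ 'n) set \<Rightarrow> (real ^ 'n \<Rightarrow> real) \<Rightarrow> ennreal" where
  "Lp_norm p \<Omega> f = epow (\<integral>\<^sup>+x\<in>\<Omega>. ennreal (\<bar>f x\<bar> powr p) \<partial>lebesgue) (1 / p)"

definition W_norm :: "nat \<Rightarrow> real \<Rightarrow> (real ^ 'n) set \<Rightarrow> (real ^ 'n \<Rightarrow> real) \<Rightarrow> ennreal" where
  "W_norm m p \<Omega> u =
     epow (\<Sum>\<alpha>\<in>{\<alpha>. mi_order \<alpha> = m}. epow (Lp_norm p \<Omega> (wderiv \<alpha> u)) p) (1 / p)"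

text \<open>The critical exponent $p^*_s = pN/(N - sp)$.\<close>

definition crit :: "'n::finite itself \<Rightarrow> real \<Rightarrow> nat \<Rightarrow> real" where
  "crit _ p s = p * real CARD('n) / (real CARD('n) - real s * p)"

text \<open>The completion of the test functions in the homogeneous norm, for $1 \le p < N/m$. By the
  Sobolev inequality a Cauchy sequence for this norm converges in $L^{p^*_m}$, and elements of the
  completion are identified with the resulting limits. Elements are functions, not classes modulo
  null sets.\<close>

definition Wdot :: "nat \<Rightarrow> real \<Rightarrow> (real ^ 'n \<Rightarrow> real) set" where
  "Wdot m p = {u. u \<in> borel_measurable lebesgue \<and>
     (\<exists>\<phi>. (\<forall>i. \<phi> i \<in> test_functions) \<and>
        (\<forall>\<epsilon>>0. \<exists>K. \<forall>i\<ge>K. \<forall>k\<ge>K. W_norm m p UNIV (\<lambda>x. \<phi> i x - \<phi> k x) < \<epsilon>) \<and>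
        (\<lambda>i. Lp_norm (crit TYPE('n) p m) UNIV (\<lambda>x. \<phi> i x - u x)) \<longlonglongrightarrow> 0)}"

text \<open>Bounded linear functionals of norm at most \<open>C\<close>; their values outside the space are
  irrelevant. The bound makes them invariant under changes on null sets.\<close>

definition functionals :: "nat \<Rightarrow> real \<Rightarrow> real \<Rightarrow> ((real ^ 'n \<Rightarrow> real) \<Rightarrow> real) set" where
  "functionals m p C = {\<phi>.
     (\<forall>u\<in>Wdot m p. \<forall>v\<in>Wdot m p. \<phi> (\<lambda>x. u x + v x) = \<phi> u + \<phi> v) \<and>
     (\<forall>c. \<forall>u\<in>Wdot m p. \<phi> (\<lambda>x. c * u x) = c * \<phi> u) \<and>
     (\<forall>u\<in>Wdot m p. ennreal \<bar>\<phi> u\<bar> \<le> ennreal C * W_norm m p UNIV u)}"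

definition dual_ball :: "nat \<Rightarrow> real \<Rightarrow> ((real ^ 'n \<Rightarrow> real) \<Rightarrow> real) set" where
  "dual_ball m p = functionals m p 1"

definition W_dual :: "nat \<Rightarrow> real \<Rightarrow> ((real ^ 'n \<Rightarrow> real) \<Rightarrow> real) set" where
  "W_dual m p = (\<Union>C\<in>{0..}. functionals m p C)"

definition weak_ae_conv ::
  "nat \<Rightarrow> real \<Rightarrow> (nat \<Rightarrow> real ^ 'n \<Rightarrow> real) \<Rightarrow> (real ^ 'n \<Rightarrow> real) \<Rightarrow> bool" where
  "weak_ae_conv m p v u \<longleftrightarrow>
     (\<forall>\<phi>\<in>W_dual m p. (\<lambda>n. \<phi> (v n)) \<longlonglongrightarrow> \<phi> u) \<and>
     (AE x in lebesgue. (\<lambda>n. v n x) \<longlonglongrightarrow> u x)"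

definition bubble ::
  "nat \<Rightarrow> real \<Rightarrow> (real ^ 'n \<Rightarrow> real) \<Rightarrow> real ^ 'n \<Rightarrow> int \<Rightarrow> real ^ 'n \<Rightarrow> real" where
  "bubble m p w y j x =
     2 powr (real_of_int j * real CARD('n) / crit TYPE('n) p m) * w (2 powr real_of_int j *\<^sub>R (x - y))"

definition blowup ::
  "nat \<Rightarrow> real \<Rightarrow> (real ^ 'n \<Rightarrow> real) \<Rightarrow> real ^ 'n \<Rightarrow> int \<Rightarrow> real ^ 'n \<Rightarrow> real" where
  "blowup m p u y j x =
     2 powr (- real_of_int j * real CARD('n) / crit TYPE('n) p m) * u (2 powr (- real_of_int j) *\<^sub>R x + y)"

text \<open>The filter of $L \to \Lambda$: a limit (superior) along it is the value at $\Lambda$ if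
  $\Lambda < \infty$.\<close>

definition toward :: "enat \<Rightarrow> nat filter" where
  "toward \<Lambda> = (case \<Lambda> of enat k \<Rightarrow> principal {k} | \<infinity> \<Rightarrow> sequentially)"

definition residual ::
  "nat \<Rightarrow> real \<Rightarrow> (nat \<Rightarrow> real ^ 'n \<Rightarrow> real) \<Rightarrow> (nat \<Rightarrow> real ^ 'n \<Rightarrow> real) \<Rightarrow>
   (nat \<Rightarrow> nat \<Rightarrow> real ^ 'n) \<Rightarrow> (nat \<Rightarrow> nat \<Rightarrow> int) \<Rightarrow> nat \<Rightarrow> nat \<Rightarrow> real ^ 'n \<Rightarrow> real" where
  "residual m p u w y j L n x = u n x - (\<Sum>l\<le>L. bubble m p (w l) (y l n) (j l n) x)"

text \<open>\<open>w l\<close> is meaningful for \<open>l \<le> \<Lambda>\<close> only, and \<open>y l n\<close>, \<open>j l n\<close> only for \<open>l \<le> \<Lambda>\<close> and \<open>n \<ge> l\<close>;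
  the other values do not matter.\<close>

definition profile_decomposition ::
  "nat \<Rightarrow> real \<Rightarrow> (nat \<Rightarrow> real ^ 'n \<Rightarrow> real) \<Rightarrow> (nat \<Rightarrow> real ^ 'n \<Rightarrow> real) \<Rightarrow>
   (nat \<Rightarrow> nat \<Rightarrow> real ^ 'n) \<Rightarrow> (nat \<Rightarrow> nat \<Rightarrow> int) \<Rightarrow> enat \<Rightarrow> bool" where
  "profile_decomposition m p u w y j \<Lambda> \<longleftrightarrow>
    (let I = {l. enat l \<le> \<Lambda>};
         r = residual m p u w y j;
         q = crit TYPE('n) p
     in
      (\<forall>l\<in>I. w l \<in> Wdot m p) \<and>
      (\<forall>L\<in>I. \<forall>n\<ge>L. r L n \<in> Wdot m p) \<and>
      (\<forall>n. y 0 n = 0 \<and> j 0 n = 0) \<and>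
      (\<forall>l\<in>I. 1 \<le> l \<longrightarrow> \<not> (AE x in lebesgue. w l x = 0)) \<and>
      (\<forall>l\<in>I. \<forall>k\<in>I. l \<noteq> k \<longrightarrow>
        filterlim (\<lambda>n. \<bar>real_of_int (j l n) - real_of_int (j k n)\<bar>
                       + 2 powr real_of_int (j k n) * norm (y l n - y k n)) at_top sequentially \<and>
        (filterlim (\<lambda>n. real_of_int (j l n) - real_of_int (j k n)) at_top sequentially \<or>
         filterlim (\<lambda>n. real_of_int (j l n) - real_of_int (j k n)) at_bot sequentially \<or>
         convergent (\<lambda>n. real_of_int (j l n) - real_of_int (j k n))) \<and>
        (filterlim (\<lambda>n. 2 powr real_of_int (j k n) * norm (y l n - y k n)) at_top sequentially \<or>
         convergent (\<lambda>n. 2 powr real_of_int (j k n) *\<^sub>R (y l n - y k n)))) \<and>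
      (\<forall>l\<in>I. weak_ae_conv m p (\<lambda>n. blowup m p (u n) (y l n) (j l n)) (w l)) \<and>
      (\<forall>L\<in>I. \<forall>k\<in>I. weak_ae_conv m p (\<lambda>n. blowup m p (r L n) (y k n) (j k n))
                     (if k \<le> L then (\<lambda>x. 0) else w k)) \<and>
      (\<Sum>l. if l \<in> I then epow (W_norm m p UNIV (w l)) p else 0)
        + Limsup (toward \<Lambda>) (\<lambda>L. Limsup at_top (\<lambda>R::real. limsup (\<lambda>n.
            epow (W_norm m p (- (\<Union>l\<le>L. cball (y l n) (2 powr (- real_of_int (j l n)) * R))) (r L n)) p)))
        \<le> limsup (\<lambda>n. epow (W_norm m p UNIV (u n)) p) \<and>
      ((\<lambda>L. SUP \<phi>\<in>dual_ball m p. limsup (\<lambda>n. SUP z. SUP i.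
            ennreal \<bar>\<phi> (blowup m p (r L n) z i)\<bar>)) \<longlongrightarrow> 0) (toward \<Lambda>) \<and>
      Limsup (toward \<Lambda>) (\<lambda>L. limsup (\<lambda>n. W_norm m p UNIV (r L n)))
        \<le> 2 * limsup (\<lambda>n. W_norm m p UNIV (u n)) \<and>
      limsup (\<lambda>n. W_norm m p UNIV (u n)) < \<infinity> \<and>
      ((\<lambda>L. limsup (\<lambda>n. Lp_norm (q m) UNIV (r L n))) \<longlongrightarrow> 0) (toward \<Lambda>) \<and>
      (\<forall>k<m. ((\<lambda>L. limsup (\<lambda>n. W_norm k (q (m - k)) UNIV (r L n))) \<longlongrightarrow> 0) (toward \<Lambda>)))"

text \<open>$\int_0^s f(t)\,dt$, with the usual sign convention for $s < 0$.\<close>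

definition primitive :: "(real \<Rightarrow> real) \<Rightarrow> real \<Rightarrow> real" where
  "primitive f s = (LBINT t=ereal 0..ereal s. f t)"

definition homogeneous :: "real \<Rightarrow> real \<Rightarrow> real \<Rightarrow> real \<Rightarrow> real" where
  "homogeneous q cp cm s = (if s \<ge> 0 then cp * \<bar>s\<bar> powr q else cm * \<bar>s\<bar> powr q)"

end

theory Submission
  imports Defs "HOL-Library.Multiset"
begin

text \<open>With $q = p^*_{m-|\alpha|}$, the derivative $\partial^\alpha$ maps the completion into $L^q$ (Sobolev
  inequality, iterated), and it turns the rescaled profiles into $L^q$-isometric dilations
  $T_{l,n}$ of $W^l = \partial^\alpha w^l$, up to a residual that is small in $L^q$ by (8). The growth of $f_\alpha$ gives
  $|F(a+b) - F(a)| \le \varepsilon |a|^q + K_\varepsilon |b|^q$; this bound removes the residual and, because by (2)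
  $\min(|T_{l,n} W^l|, |T_{k,n} W^k|) \to 0$ in $L^q$ for $l \ne k$, it also splits the integral of
  $F(\sum_{l \le L} T_{l,n} W^l)$ into the integrals of $F(T_{l,n} W^l)$. Each of these equals the
  integral of $2^{-jN} F(2^{jN/q} W^l)$ with $j = j_{l,n}$ and converges by dominated convergence. No further
  subsequence is needed: since $j_{0,n} = 0$, (2) with $k = 0$ says how $j_{l,n}$ behaves.\<close>

subsection \<open>The Loomis--Whitney and Sobolev inequalities\<close>

text \<open>An element of the completion is only an L^{p^*_m} limit, so its derivative of order
  \<alpha> is not given with it. It has to be built as the L^q limit of the derivatives of the
  approximating test functions, which is why Sobolev's inequality is proved for test functions and
  then iterated one order at a time. Since \<open>wderiv\<close> picks an arbitrary representative,
  derivatives can be compared only up to null sets. This makes uniqueness of weak derivatives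
  essential, and with it a supply of explicit bump functions. The decomposition is given for the
  functions and not for their derivatives; weak differentiability of each bubble and of the residual
  carries it over. From there on only integrals of q-th powers occur: the triangle inequality up to
  a factor 2^q is enough, because every use of it is at a fixed number of profiles or has a fixed
  bound on the right. With infinitely many profiles the limits in n and L must be exchanged; what
  permits this is a bound on the sum of the profile contributions that does not depend on L.\<close>

lemma epow_ennreal: "0 \<le> x \<Longrightarrow> epow (ennreal x) r = ennreal (x powr r)"
  by (simp add: epow_def)

lemma epow_0 [simp]: "epow 0 r = 0"
  by (simp add: epow_def)

lemma epow_top [simp]: "epow top r = top"
  by (simp add: epow_def)

text \<open>Holds for every exponent, r = 0 included, because \<open>0 powr r\<close> is 0 in
  HOL.\<close>

lemma epow_eq_0_iff: "epow a r = 0 \<longleftrightarrow> a = 0"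
  by (cases a) (auto simp: epow_def ennreal_eq_0_iff powr_def)

lemma epow_mono: "0 \<le> r \<Longrightarrow> a \<le> b \<Longrightarrow> epow a r \<le> epow b r"
  by (cases a; cases b) (auto simp: epow_def top_unique intro!: ennreal_leI powr_mono2)

lemma measurable_epow [measurable]: "(\<lambda>a. epow a r) \<in> borel_measurable borel"
  unfolding epow_def by measurable

text \<open>Hoelder's inequality for n functions with all exponents equal to n. After each function
  is divided by its integral, the inequality of arithmetic and geometric means holds pointwise and
  integrates to 1.\<close>

lemma nn_integral_prod_root_le:
  fixes h :: "'i \<Rightarrow> 'a \<Rightarrow> ennreal"
  assumes I: "finite I" "I \<noteq> {}"
    and [measurable]: "\<And>i. i \<in> I \<Longrightarrow> h i \<in> borel_measurable M"
  shows "(\<integral>\<^sup>+x. (\<Prod>i\<in>I. epow (h i x) (1 / card I)) \<partial>M)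
    \<le> (\<Prod>i\<in>I. epow (\<integral>\<^sup>+x. h i x \<partial>M) (1 / card I))"
proof -
  let ?c = "1 / real (card I)"
  have n: "card I > 0" using I by (simp add: card_gt_0_iff)
  \<comment> \<open>Normalisation needs positive finite integrals. If one of them is 0, the left
    side is 0; if none is 0 and one is infinite, the right side is infinite.\<close>
  consider i where "i \<in> I" "(\<integral>\<^sup>+x. h i x \<partial>M) = 0"
    | i where "i \<in> I" "(\<integral>\<^sup>+x. h i x \<partial>M) = top" "\<forall>i\<in>I. (\<integral>\<^sup>+x. h i x \<partial>M) \<noteq> 0"
    | "\<forall>i\<in>I. (\<integral>\<^sup>+x. h i x \<partial>M) \<noteq> 0 \<and> (\<integral>\<^sup>+x. h i x \<partial>M) \<noteq> top" by blast
  then show ?thesis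
  proof cases
    case 1
    then have "AE x in M. h i x = 0" by (simp add: nn_integral_0_iff_AE)
    then have "AE x in M. (\<Prod>i\<in>I. epow (h i x) ?c) = 0"
      by eventually_elim (use 1 I in \<open>auto simp: prod_zero_iff epow_eq_0_iff\<close>)
    then have "(\<integral>\<^sup>+x. (\<Prod>i\<in>I. epow (h i x) ?c) \<partial>M) = 0"
      by (subst nn_integral_0_iff_AE) auto
    then show ?thesis by simp
  next
    case 2
    then have "(\<Prod>i\<in>I. epow (\<integral>\<^sup>+x. h i x \<partial>M) ?c) = top"
      using I 2 by (subst ennreal_prod_eq_top) (auto simp: epow_eq_0_iff intro!: bexI[of _ i])
    then show ?thesis by simp
  next
    case 3
    define H where "H i = enn2real (\<integral>\<^sup>+x. h i x \<partial>M)" for i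
    have H: "(\<integral>\<^sup>+x. h i x \<partial>M) = ennreal (H i)" "H i > 0" if "i \<in> I" for i
      using 3 that by (auto simp: H_def ennreal_enn2real_if enn2real_positive_iff less_top zero_less_iff_neq_zero)
    \<comment> \<open>\<open>P\<close> is the right side of the claim. Factoring it out of the
      integrand leaves the geometric mean of the normalised functions.\<close>
    define P where "P = (\<Prod>i\<in>I. H i powr ?c)"
    have P: "P > 0" unfolding P_def using H(2) by (intro prod_pos) (metis less_irrefl powr_gt_zero)
    have pw: "(\<Prod>i\<in>I. epow (h i x) ?c) \<le> ennreal P * (\<Sum>i\<in>I. ennreal (?c / H i) * h i x)" for x
    proof (cases "\<exists>i\<in>I. h i x = top")
      case True
      then obtain i where i: "i \<in> I" "h i x = top" by blast
      have "top = ennreal (?c / H i) * h i x"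
        using i H[OF i(1)] n by (simp add: ennreal_mult_top ennreal_eq_0_iff not_le)
      also have "\<dots> \<le> (\<Sum>i\<in>I. ennreal (?c / H i) * h i x)"
        using i I by (intro member_le_sum) auto
      finally have "(\<Sum>i\<in>I. ennreal (?c / H i) * h i x) = top" by (simp add: top_unique)
      then show ?thesis using P by (simp add: ennreal_mult_top ennreal_eq_0_iff)
    next
      case False
      define a where "a i = enn2real (h i x)" for i
      have a: "h i x = ennreal (a i)" "a i \<ge> 0" if "i \<in> I" for i
        using False that by (auto simp: a_def ennreal_enn2real_if)
      have "(\<Prod>i\<in>I. a i powr ?c) = P * (\<Prod>i\<in>I. (a i / H i) powr ?c)"
        unfolding P_def prod.distrib[symmetric]
      proof (rule prod.cong)
        fix i assume "i \<in> I"
        then show "a i powr ?c = H i powr ?c * (a i / H i) powr ?c"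
          using H[of i] a[of i] by (subst powr_mult[symmetric]) auto
      qed simp
      also have "(\<Prod>i\<in>I. (a i / H i) powr ?c) = (\<Prod>i\<in>I. a i / H i) powr ?c"
        by (rule prod_powr_distrib[symmetric])
      also have "\<dots> \<le> (\<Sum>i\<in>I. (a i / H i) / card I)"
        by (rule arith_geom_mean) (use I a H in \<open>auto simp: less_imp_le\<close>)
      also have "\<dots> = (\<Sum>i\<in>I. (?c / H i) * a i)"
        by (intro sum.cong) auto
      finally have "(\<Prod>i\<in>I. a i powr ?c) \<le> P * (\<Sum>i\<in>I. (?c / H i) * a i)"
        using P by simp
      moreover have "(\<Prod>i\<in>I. epow (h i x) ?c) = ennreal (\<Prod>i\<in>I. a i powr ?c)"
        using a by (simp add: epow_ennreal prod_ennreal[symmetric] cong: prod.cong)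
      moreover have "(\<Sum>i\<in>I. ennreal (?c / H i) * h i x) = (\<Sum>i\<in>I. ennreal ((?c / H i) * a i))"
        using a H n by (intro sum.cong) (auto simp: ennreal_mult[symmetric] less_imp_le)
      moreover have "\<dots> = ennreal (\<Sum>i\<in>I. (?c / H i) * a i)"
        using a H n by (intro sum_ennreal) (auto simp: less_imp_le)
      ultimately show ?thesis
        using P a H n by (simp add: ennreal_mult[symmetric] sum_nonneg less_imp_le ennreal_leI)
    qed
    have "(\<integral>\<^sup>+x. (\<Prod>i\<in>I. epow (h i x) ?c) \<partial>M) \<le>
        (\<integral>\<^sup>+x. ennreal P * (\<Sum>i\<in>I. ennreal (?c / H i) * h i x) \<partial>M)"
      by (intro nn_integral_mono pw)
    also have "\<dots> = ennreal P * (\<Sum>i\<in>I. ennreal (?c / H i) * ennreal (H i))"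
      by (subst nn_integral_cmult, simp, subst nn_integral_sum)
        (auto simp: nn_integral_cmult H)
    also have "(\<Sum>i\<in>I. ennreal (?c / H i) * ennreal (H i)) = (\<Sum>i\<in>I. ennreal ?c)"
      using H n by (intro sum.cong refl, subst ennreal_mult[symmetric]) (auto simp: less_imp_le H(2) dest: H(2))
    also have "\<dots> = 1"
      using n by (simp add: ennreal_of_nat_eq_real_of_nat ennreal_mult[symmetric])
    also have "ennreal P * 1 = (\<Prod>i\<in>I. epow (\<integral>\<^sup>+x. h i x \<partial>M) ?c)"
      using H by (simp add: P_def epow_ennreal prod_ennreal[symmetric] less_imp_le cong: prod.cong)
    finally show ?thesis .
  qed
qed

text \<open>The line integral stays a function on the whole space, constant in direction
  \<open>b\<close>, so that no projections onto hyperplanes are needed and integrations in several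
  directions can be iterated by \<open>foldr\<close>.\<close>

definition line_int :: "'a::euclidean_space \<Rightarrow> ('a \<Rightarrow> ennreal) \<Rightarrow> 'a \<Rightarrow> ennreal" where
  "line_int b g x = (\<integral>\<^sup>+t. g (x + t *\<^sub>R b) \<partial>lborel)"

lemma measurable_line_int [measurable]:
  assumes [measurable]: "g \<in> borel_measurable borel"
  shows "line_int b g \<in> borel_measurable borel"
  unfolding line_int_def[abs_def] by measurable

lemma measurable_foldr_line_int [measurable]:
  "g \<in> borel_measurable borel \<Longrightarrow> foldr line_int bs g \<in> borel_measurable borel"
  by (induction bs) auto

lemma line_int_shift: "line_int b g (x + s *\<^sub>R b) = line_int b g x"
  if [measurable]: "g \<in> borel_measurable borel"
proof -
  have "(\<integral>\<^sup>+t. g (x + t *\<^sub>R b) \<partial>lborel) = (\<integral>\<^sup>+t. g (x + (s + t) *\<^sub>R b) \<partial>lborel)"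
    using nn_integral_real_affine[of "\<lambda>t. g (x + t *\<^sub>R b)" 1 s] by simp
  then show ?thesis by (simp add: line_int_def algebra_simps)
qed

text \<open>Translations commute with integration along lines, so invariance in one direction
  survives integration in the others.\<close>

lemma foldr_line_int_shift:
  "(\<And>x. h (x + v) = h x) \<Longrightarrow> foldr line_int bs h (x + v) = foldr line_int bs h x"
proof (induction bs arbitrary: x)
  case (Cons b bs)
  have "foldr line_int bs h (x + v + t *\<^sub>R b) = foldr line_int bs h (x + t *\<^sub>R b)" for t
    using Cons.IH[OF Cons.prems, of "x + t *\<^sub>R b"] by (simp add: algebra_simps)
  then show ?case by (simp add: line_int_def[of b])
qed simp

lemma foldr_line_int_eq_PiM:
  assumes [measurable]: "g \<in> borel_measurable borel" and "distinct bs"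
  shows "foldr line_int bs g x =
    (\<integral>\<^sup>+f. g (x + (\<Sum>b\<in>set bs. f b *\<^sub>R b)) \<partial>(\<Pi>\<^sub>M b\<in>set bs. lborel))"
  using \<open>distinct bs\<close>
proof (induction bs arbitrary: x)
  case Nil
  then show ?case by (simp add: nn_integral_empty PiM_empty)
next
  case (Cons b bs)
  interpret product_sigma_finite "\<lambda>_::'a. lborel :: real measure" by standard
  have "(\<integral>\<^sup>+f. g (x + (\<Sum>b\<in>set (b # bs). f b *\<^sub>R b)) \<partial>(\<Pi>\<^sub>M b\<in>set (b # bs). lborel)) =
      (\<integral>\<^sup>+t. \<integral>\<^sup>+f. g (x + (\<Sum>c\<in>insert b (set bs). (f(b := t)) c *\<^sub>R c)) \<partial>(\<Pi>\<^sub>M b\<in>set bs. lborel) \<partial>lborel)"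
    using Cons.prems by (simp, subst product_nn_integral_insert_rev) auto
  also have "(\<lambda>t f. \<Sum>c\<in>insert b (set bs). (f(b := t)) c *\<^sub>R c) = (\<lambda>t f. t *\<^sub>R b + (\<Sum>c\<in>set bs. f c *\<^sub>R c))"
    using Cons.prems by (intro ext, subst sum.insert) (auto intro!: sum.cong arg_cong2[where f="(+)"])
  also have "(\<integral>\<^sup>+t. \<integral>\<^sup>+f. g (x + (t *\<^sub>R b + (\<Sum>c\<in>set bs. f c *\<^sub>R c))) \<partial>(\<Pi>\<^sub>M b\<in>set bs. lborel) \<partial>lborel)
      = foldr line_int (b # bs) g x"
    using Cons by (simp add: line_int_def[of b] add.assoc)
  finally show ?case by simp
qed

lemma foldr_line_int_Basis:
  fixes g :: "'a::euclidean_space \<Rightarrow> ennreal"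
  assumes [measurable]: "g \<in> borel_measurable borel" and "distinct bs" "set bs = Basis"
  shows "foldr line_int bs g x = (\<integral>\<^sup>+z. g z \<partial>lborel)"
proof -
  have "(\<integral>\<^sup>+z. g z \<partial>lborel) = (\<integral>\<^sup>+z. g (x + z) \<partial>lborel)"
    by (subst lborel_distr_plus[of x, symmetric], subst nn_integral_distr) auto
  also have "\<dots> = (\<integral>\<^sup>+f. g (x + (\<Sum>b\<in>Basis. f b *\<^sub>R b)) \<partial>(\<Pi>\<^sub>M b\<in>Basis. lborel))"
    by (subst lborel_eq, subst nn_integral_distr) auto
  finally show ?thesis using assms by (simp add: foldr_line_int_eq_PiM)
qed

text \<open>The coordinate directions are integrated out one at a time. In direction a the factor
  with index a is constant and leaves the integral; the remaining N - 1 factors, each with exponent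
  1 / (N - 1), fall under Hoelder's inequality.\<close>

lemma loomis_whitney:
  fixes g :: "'a::euclidean_space \<Rightarrow> 'a \<Rightarrow> ennreal"
  assumes [measurable]: "\<And>b. b \<in> Basis \<Longrightarrow> g b \<in> borel_measurable borel" and N: "DIM('a) \<ge> 2"
  defines "c \<equiv> 1 / real (DIM('a) - 1)"
  shows "(\<integral>\<^sup>+x. (\<Prod>b\<in>Basis. epow (line_int b (g b) x) c) \<partial>lborel) \<le> (\<Prod>b\<in>Basis. epow (\<integral>\<^sup>+x. g b x \<partial>lborel) c)"
proof -
  have c: "c \<ge> 0" by (simp add: c_def)
  \<comment> \<open>Invariant of the iteration: factor b has absorbed all directions of
    \<open>bs\<close> except b, in which \<open>line_int b\<close> had already integrated it. Hence
    \<open>removeAll\<close>.\<close>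
  have step: "foldr line_int bs (\<lambda>x. \<Prod>b\<in>Basis. epow (line_int b (g b) x) c) x \<le>
      (\<Prod>b\<in>Basis. epow (foldr line_int (removeAll b bs) (line_int b (g b)) x) c)"
    if "distinct bs" "set bs \<subseteq> Basis" for bs x
    using that
  proof (induction bs arbitrary: x)
    case (Cons a bs)
    define h where "h b = foldr line_int (removeAll b bs) (line_int b (g b))" for b
    have a: "a \<in> Basis" "removeAll a bs = bs" using Cons.prems by auto
    have [measurable]: "h b \<in> borel_measurable borel" if "b \<in> Basis" for b
      using that unfolding h_def by measurable
    have ha: "h a (x + t *\<^sub>R a) = h a x" for t
      unfolding h_def by (rule foldr_line_int_shift) (use a in \<open>simp add: line_int_shift\<close>)
    have "foldr line_int (a # bs) (\<lambda>x. \<Prod>b\<in>Basis. epow (line_int b (g b) x) c) x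
        \<le> (\<integral>\<^sup>+t. (\<Prod>b\<in>Basis. epow (h b (x + t *\<^sub>R a)) c) \<partial>lborel)"
      using Cons by (auto simp: line_int_def[of a] h_def intro!: nn_integral_mono)
    also have "\<dots> = (\<integral>\<^sup>+t. epow (h a x) c * (\<Prod>b\<in>Basis - {a}. epow (h b (x + t *\<^sub>R a)) c) \<partial>lborel)"
      using a ha by (subst prod.remove[of _ a]) auto
    also have "\<dots> = epow (h a x) c * (\<integral>\<^sup>+t. (\<Prod>b\<in>Basis - {a}. epow (h b (x + t *\<^sub>R a)) c) \<partial>lborel)"
      by (intro nn_integral_cmult) measurable
    also have "\<dots> \<le> epow (h a x) c * (\<Prod>b\<in>Basis - {a}. epow (\<integral>\<^sup>+t. h b (x + t *\<^sub>R a) \<partial>lborel) c)"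
    proof (intro mult_left_mono)
      have card: "card (Basis - {a}) = DIM('a) - 1" using a by simp
      then have "Basis - {a} \<noteq> {}" using N by (metis card.empty diff_is_0_eq not_less_eq_eq numeral_2_eq_2 One_nat_def)
      then show "(\<integral>\<^sup>+t. (\<Prod>b\<in>Basis - {a}. epow (h b (x + t *\<^sub>R a)) c) \<partial>lborel)
          \<le> (\<Prod>b\<in>Basis - {a}. epow (\<integral>\<^sup>+t. h b (x + t *\<^sub>R a) \<partial>lborel) c)"
        unfolding c_def card[symmetric] by (intro nn_integral_prod_root_le) auto
    qed simp
    also have "\<dots> = (\<Prod>b\<in>Basis. epow (foldr line_int (removeAll b (a # bs)) (line_int b (g b)) x) c)"
      using a by (subst (2) prod.remove[of _ a])
        (auto simp: h_def line_int_def[of a "foldr _ _ _"] intro!: arg_cong2[where f="(*)"] prod.cong)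
    finally show ?case .
  qed simp
  obtain bs where bs: "set bs = (Basis :: 'a set)" "distinct bs"
    using finite_distinct_list finite_Basis by blast
  have meas: "(\<lambda>x. \<Prod>b\<in>Basis. epow (line_int b (g b) x) c) \<in> borel_measurable borel"
    by measurable
  \<comment> \<open>Once all directions are used up, factor b has been integrated exactly once in
    each of them: the full integral by Fubini.\<close>
  have "foldr line_int (removeAll b bs) (line_int b (g b)) 0 = (\<integral>\<^sup>+x. g b x \<partial>lborel)" if "b \<in> Basis" for b
    using foldr_line_int_Basis[of "g b" "removeAll b bs @ [b]" 0] that bs
    by (auto simp: distinct_removeAll)
  then show ?thesis
    using step[OF bs(2), of 0] bs foldr_line_int_Basis[OF meas bs(2,1), of 0]
    by (simp cong: prod.cong)
qed


text \<open>Young's inequality, first as it stands for integrability, then for the functions divided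
  by their norms. A vanishing norm is treated apart, since the product is then 0 almost
  everywhere.\<close>

lemma Holder_integral:
  fixes f g :: "'a \<Rightarrow> real"
  assumes ab: "1 < a" "1 < b" "1 / a + 1 / b = 1"
    and [measurable]: "f \<in> borel_measurable M" "g \<in> borel_measurable M"
    and f: "integrable M (\<lambda>x. \<bar>f x\<bar> powr a)" and g: "integrable M (\<lambda>x. \<bar>g x\<bar> powr b)"
  shows "integrable M (\<lambda>x. f x * g x)"
    and "(\<integral>x. \<bar>f x * g x\<bar> \<partial>M) \<le> (\<integral>x. \<bar>f x\<bar> powr a \<partial>M) powr (1 / a) * (\<integral>x. \<bar>g x\<bar> powr b \<partial>M) powr (1 / b)"
proof -
  show int: "integrable M (\<lambda>x. f x * g x)"
  proof (rule Bochner_Integration.integrable_bound)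
    show "integrable M (\<lambda>x. \<bar>f x\<bar> powr a / a + \<bar>g x\<bar> powr b / b)" using f g by simp
    show "AE x in M. norm (f x * g x) \<le> norm (\<bar>f x\<bar> powr a / a + \<bar>g x\<bar> powr b / b)"
      using Youngs_inequality[OF ab, of "\<bar>f _\<bar>" "\<bar>g _\<bar>"] ab by (intro AE_I2) (simp add: abs_mult)
  qed measurable
  define A B where "A = (\<integral>x. \<bar>f x\<bar> powr a \<partial>M)" and "B = (\<integral>x. \<bar>g x\<bar> powr b \<partial>M)"
  have "A \<ge> 0" "B \<ge> 0" by (simp_all add: A_def B_def)
  then consider "A = 0 \<or> B = 0" | "A > 0" "B > 0" by linarith
  then have "(\<integral>x. \<bar>f x * g x\<bar> \<partial>M) \<le> A powr (1 / a) * B powr (1 / b)"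
  proof cases
    case 1
    have "AE x in M. f x * g x = 0"
    proof (cases "A = 0")
      case True
      then have "AE x in M. \<bar>f x\<bar> powr a = 0"
        using integral_nonneg_eq_0_iff_AE[OF f] by (simp add: A_def)
      then show ?thesis by eventually_elim auto
    next
      case False
      then have "AE x in M. \<bar>g x\<bar> powr b = 0"
        using integral_nonneg_eq_0_iff_AE[OF g] 1 by (simp add: B_def)
      then show ?thesis by eventually_elim auto
    qed
    then have "(\<integral>x. \<bar>f x * g x\<bar> \<partial>M) = 0"
      by (intro integral_eq_zero_AE) auto
    then show ?thesis by simp
  next
    case 2
    define s t where "s = A powr (1 / a)" and "t = B powr (1 / b)"
    have st: "s > 0" "t > 0" "s powr a = A" "t powr b = B"
      using 2 ab by (auto simp: s_def t_def powr_powr)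
    have "\<bar>f x * g x\<bar> \<le> s * t * (\<bar>f x\<bar> powr a / (a * A) + \<bar>g x\<bar> powr b / (b * B))" for x
    proof -
      have "\<bar>f x\<bar> / s * (\<bar>g x\<bar> / t) \<le> (\<bar>f x\<bar> / s) powr a / a + (\<bar>g x\<bar> / t) powr b / b"
        using st by (intro Youngs_inequality ab) auto
      also have "\<dots> = \<bar>f x\<bar> powr a / (a * A) + \<bar>g x\<bar> powr b / (b * B)"
        using st by (simp add: powr_divide mult.commute)
      finally show ?thesis using st by (simp add: field_simps abs_mult)
    qed
    then have "(\<integral>x. \<bar>f x * g x\<bar> \<partial>M) \<le>
        (\<integral>x. s * t * (\<bar>f x\<bar> powr a / (a * A) + \<bar>g x\<bar> powr b / (b * B)) \<partial>M)"
      using int f g by (intro integral_mono) auto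
    also have "\<dots> = s * t * (A / (a * A) + B / (b * B))"
      using f g by (simp add: A_def B_def)
    also have "\<dots> = s * t" using 2 ab by simp
    finally show ?thesis by (simp add: s_def t_def)
  qed
  then show "(\<integral>x. \<bar>f x * g x\<bar> \<partial>M) \<le> (\<integral>x. \<bar>f x\<bar> powr a \<partial>M) powr (1 / a) * (\<integral>x. \<bar>g x\<bar> powr b \<partial>M) powr (1 / b)"
    by (simp add: A_def B_def)
qed

section \<open>Sobolev's inequality for functions of bounded support\<close>

lemma integrable_continuous_bounded_support:
  fixes f :: "'a::euclidean_space \<Rightarrow> real"
  assumes "continuous_on UNIV f" and "\<And>x. R \<le> norm x \<Longrightarrow> f x = 0"
  shows "integrable lborel f"
proof -
  have "integrable lborel (\<lambda>x. indicator (cball 0 R) x *\<^sub>R f x)"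
    using assms(1) by (intro borel_integrable_compact) (auto intro: continuous_on_subset)
  moreover have "(\<lambda>x. indicator (cball 0 R) x *\<^sub>R f x) = f"
    using assms(2) by (auto simp: indicator_def fun_eq_iff)
  ultimately show ?thesis by simp
qed

text \<open>Away from 0 this is the power rule. At 0 the difference quotient is
  \<open>sgn h * \<bar>h\<bar> powr (r - 1)\<close>, which tends to 0 because r > 1.\<close>

lemma has_real_derivative_abs_powr:
  assumes "1 < (r::real)"
  shows "((\<lambda>s. \<bar>s\<bar> powr r) has_real_derivative r * \<bar>s\<bar> powr (r - 1) * sgn s) (at s)"
proof -
  consider "s > 0" | "s < 0" | "s = 0" by linarith
  then show ?thesis
  proof cases
    case 1
    have "((\<lambda>s. s powr r) has_real_derivative r * \<bar>s\<bar> powr (r - 1) * sgn s) (at s)"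
      using 1 by (auto intro!: derivative_eq_intros)
    then show ?thesis
      by (rule has_field_derivative_transform_within_open[of _ _ _ "{0<..}"]) (use 1 in auto)
  next
    case 2
    have "((\<lambda>s. (- s) powr r) has_real_derivative r * \<bar>s\<bar> powr (r - 1) * sgn s) (at s)"
      using 2 by (auto intro!: derivative_eq_intros)
    then show ?thesis
      by (rule has_field_derivative_transform_within_open[of _ _ _ "{..<0}"]) (use 2 in auto)
  next
    case 3
    have "((\<lambda>h. \<bar>h\<bar> powr (r - 1)) \<longlongrightarrow> 0) (at 0)"
      using assms by (auto intro!: tendsto_eq_intros simp: tendsto_rabs_zero)
    then have "((\<lambda>h. sgn h * \<bar>h\<bar> powr (r - 1)) \<longlongrightarrow> 0) (at 0)"
      by (rule Lim_null_comparison[rotated]) (auto simp: abs_mult abs_sgn_eq)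
    moreover have "(\<bar>0 + h\<bar> powr r - \<bar>0\<bar> powr r) / h = sgn h * \<bar>h\<bar> powr (r - 1)" if "h \<noteq> 0" for h :: real
      using that by (auto simp: powr_diff sgn_if)
    ultimately show ?thesis using 3
      unfolding DERIV_def by (auto elim!: Lim_transform_eventually simp: eventually_at_filter)
  qed
qed

text \<open>The Gagliardo--Nirenberg argument for a power of \<phi>: each of the N coordinate
  directions bounds it by a line integral of its derivative, Loomis--Whitney multiplies these
  bounds, and Hoelder's inequality separates \<phi> from its gradient. The integral of \<phi> then
  stands on both sides, with an exponent below 1 on the right, and is absorbed.\<close>

lemma sobolev_bound:
  fixes \<phi> :: "'a::euclidean_space \<Rightarrow> real" and d :: "'a \<Rightarrow> 'a \<Rightarrow> real" and p :: real
  assumes p: "1 < p" "p < DIM('a)"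
    and \<phi>: "continuous_on UNIV \<phi>" "\<And>x. R \<le> norm x \<Longrightarrow> \<phi> x = 0"
    and d: "\<And>b. b \<in> Basis \<Longrightarrow> continuous_on UNIV (d b)"
      "\<And>b x. b \<in> Basis \<Longrightarrow> R \<le> norm x \<Longrightarrow> d b x = 0"
      "\<And>b x. b \<in> Basis \<Longrightarrow> ((\<lambda>t. \<phi> (x + t *\<^sub>R b)) has_real_derivative d b x) (at 0)"
    and B: "\<And>b. b \<in> Basis \<Longrightarrow> (\<integral>x. \<bar>d b x\<bar> powr p \<partial>lborel) \<le> B"
  defines "N \<equiv> real DIM('a)"
  shows "(\<integral>x. \<bar>\<phi> x\<bar> powr (p * N / (N - p)) \<partial>lborel) \<le>
    (p * (N - 1) / (N - p)) powr (p * N / (N - p)) * B powr (N / (N - p))"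
proof -
  \<comment> \<open>The exponent \<gamma> is forced twice, and consistently: N \<gamma> / (N - 1) =
    P, so that Loomis--Whitney yields the power P, and (\<gamma> - 1) p' = P, so that Hoelder's
    inequality returns the same power.\<close>
  define \<gamma> P p' c where "\<gamma> = p * (N - 1) / (N - p)" and "P = p * N / (N - p)"
    and "p' = p / (p - 1)" and "c = 1 / real (DIM('a) - 1)"
  have N: "N > p" "N > 1" using p by (auto simp: N_def)
  have DIM: "DIM('a) \<ge> 2" using N by (simp add: N_def)
  have c: "c = 1 / (N - 1)" using DIM by (simp add: c_def N_def of_nat_diff)
  have P: "P > 0" using N p by (simp add: P_def)
  have \<gamma>: "\<gamma> > 1"
  proof -
    have "N - p < p * (N - 1)" using N p by (simp add: algebra_simps)
    then show ?thesis using N by (simp add: \<gamma>_def)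
  qed
  have p': "p' > 1" "1 / p' + 1 / p = 1" using p by (auto simp: p'_def field_simps)
  have \<gamma>p': "(\<gamma> - 1) * p' = P"
  proof -
    have "\<gamma> - 1 = N * (p - 1) / (N - p)" using N by (simp add: \<gamma>_def field_simps)
    then show ?thesis using p by (simp add: p'_def P_def)
  qed
  have \<gamma>P: "N * (\<gamma> * c) = P" using N by (simp add: c \<gamma>_def P_def)
  have obt: "\<exists>b. b \<in> (Basis :: 'a set)" using SOME_Basis by blast
  have B0: "B \<ge> 0"
    using obt B by (metis (no_types, lifting) abs_ge_zero integral_nonneg_AE AE_I2 order_trans powr_ge_zero)
  define G where "G b x = \<gamma> * \<bar>\<phi> x\<bar> powr (\<gamma> - 1) * \<bar>d b x\<bar>" for b x
  have [measurable]: "\<phi> \<in> borel_measurable borel"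
    using \<phi> by (simp add: borel_measurable_continuous_onI)
  have dm [measurable]: "d b \<in> borel_measurable borel" if "b \<in> Basis" for b
    using d that by (simp add: borel_measurable_continuous_onI)
  have Gm [measurable]: "(\<lambda>x. ennreal (G b x)) \<in> borel_measurable borel" if "b \<in> Basis" for b
    using that unfolding G_def by measurable
  have pw: "ennreal (\<bar>\<phi> x\<bar> powr \<gamma>) \<le> line_int b (\<lambda>x. ennreal (G b x)) x" if b: "b \<in> Basis" for b x
  proof -
    \<comment> \<open>At parameter -T the point has norm at least T - |x| = |R|, outside the
      support, so the fundamental theorem has no boundary term there.\<close>
    define T where "T = \<bar>R\<bar> + norm x"
    define h h' where "h t = \<bar>\<phi> (x + t *\<^sub>R b)\<bar> powr \<gamma>"
      and "h' t = \<gamma> * \<bar>\<phi> (x + t *\<^sub>R b)\<bar> powr (\<gamma> - 1) * sgn (\<phi> (x + t *\<^sub>R b)) * d b (x + t *\<^sub>R b)" for t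
    have "norm (x + (- T) *\<^sub>R b) = norm (T *\<^sub>R b - x)"
      by (simp add: norm_minus_commute)
    then have "R \<le> norm (x + (- T) *\<^sub>R b)"
      using norm_triangle_ineq2[of "T *\<^sub>R b" x] b by (simp add: T_def)
    then have h0: "h (- T) = 0" using \<phi>(2) by (simp add: h_def)
    have der: "(h has_real_derivative h' t) (at t)" for t
    proof -
      have "((\<lambda>s. \<phi> ((x + t *\<^sub>R b) + s *\<^sub>R b)) has_real_derivative d b (x + t *\<^sub>R b)) (at 0)"
        using d(3) b by blast
      then have "((\<lambda>s. \<phi> (x + s *\<^sub>R b)) has_real_derivative d b (x + t *\<^sub>R b)) (at t)"
        using DERIV_shift[of "\<lambda>s. \<phi> (x + s *\<^sub>R b)" _ 0 t]
        by (simp add: algebra_simps)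
      from DERIV_chain2[OF has_real_derivative_abs_powr[OF \<gamma>] this]
      show ?thesis by (simp add: h_def[abs_def] h'_def)
    qed
    \<comment> \<open>The jump of \<open>sgn\<close> at 0 is harmless: \<gamma> > 1 makes the other
      factor vanish there. This gives the continuous derivative that the fundamental theorem
      requires.\<close>
    have "continuous_on UNIV (\<lambda>s::real. \<bar>s\<bar> powr (\<gamma> - 1) * sgn s)"
    proof -
      have "isCont (\<lambda>s::real. \<bar>s\<bar> powr (\<gamma> - 1) * sgn s) s" for s
      proof (cases "s = 0")
        case True
        have "((\<lambda>h. \<bar>h\<bar> powr (\<gamma> - 1)) \<longlongrightarrow> 0) (at (0::real))"
          using \<gamma> by (auto intro!: tendsto_eq_intros simp: tendsto_rabs_zero)
        then have "((\<lambda>h. \<bar>h\<bar> powr (\<gamma> - 1) * sgn h) \<longlongrightarrow> 0) (at (0::real))"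
          by (rule Lim_null_comparison[rotated]) (auto simp: abs_mult abs_sgn_eq)
        then show ?thesis using True by (simp add: isCont_def)
      next
        case False
        then show ?thesis by (auto intro!: continuous_intros)
      qed
      then show ?thesis by (simp add: continuous_on_eq_continuous_at)
    qed
    note sgn_cont = this
    have l: "continuous_on UNIV (\<lambda>t. x + t *\<^sub>R b)" by (intro continuous_intros)
    have "continuous_on UNIV (\<lambda>t. \<phi> (x + t *\<^sub>R b))"
      by (rule continuous_on_compose2[OF \<phi>(1) l]) simp
    from continuous_on_compose2[OF sgn_cont this]
    have "continuous_on UNIV (\<lambda>t. \<bar>\<phi> (x + t *\<^sub>R b)\<bar> powr (\<gamma> - 1) * sgn (\<phi> (x + t *\<^sub>R b)))" by simp
    moreover have "continuous_on UNIV (\<lambda>t. d b (x + t *\<^sub>R b))"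
      by (rule continuous_on_compose2[OF d(1)[OF b] l]) simp
    ultimately have "continuous_on UNIV (\<lambda>t. \<gamma> * ((\<bar>\<phi> (x + t *\<^sub>R b)\<bar> powr (\<gamma> - 1) * sgn (\<phi> (x + t *\<^sub>R b))) * d b (x + t *\<^sub>R b)))"
      by (intro continuous_on_mult_left) (rule continuous_on_mult)
    then have "continuous_on UNIV h'" by (simp add: h'_def[abs_def] mult.assoc)
    then have cont: "continuous_on {- T..0} h'" by (rule continuous_on_subset) simp
    have int: "integrable lborel (\<lambda>t. indicator {- T..0} t *\<^sub>R h' t)"
      using cont by (intro borel_integrable_compact) auto
    have "T \<ge> 0" by (simp add: T_def)
    then have "(\<integral>t. indicator {- T..0} t *\<^sub>R h' t \<partial>lborel) = h 0 - h (- T)"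
      using der cont by (intro integral_FTC_atLeastAtMost)
        (auto intro: has_vector_derivative_at_within simp: has_real_derivative_iff_has_vector_derivative)
    then have "ennreal (\<bar>\<phi> x\<bar> powr \<gamma>) = ennreal (norm (\<integral>t. indicator {- T..0} t *\<^sub>R h' t \<partial>lborel))"
      by (simp add: h0) (simp add: h_def)
    also have "\<dots> \<le> (\<integral>\<^sup>+t. norm (indicator {- T..0} t *\<^sub>R h' t) \<partial>lborel)"
      by (rule integral_norm_bound_ennreal[OF int])
    also have "\<dots> \<le> (\<integral>\<^sup>+t. ennreal (G b (x + t *\<^sub>R b)) \<partial>lborel)"
      using \<gamma> by (intro nn_integral_mono ennreal_leI) (auto simp: G_def h'_def abs_mult abs_sgn_eq indicator_def)
    finally show ?thesis by (simp add: line_int_def)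
  qed
  define A where "A = (\<integral>x. \<bar>\<phi> x\<bar> powr P \<partial>lborel)"
  have A0: "A \<ge> 0" by (simp add: A_def)
  have intA: "integrable lborel (\<lambda>x. \<bar>\<phi> x\<bar> powr P)"
    using \<phi> P by (intro integrable_continuous_bounded_support[where R=R] continuous_on_powr' continuous_intros) auto
  have intd: "integrable lborel (\<lambda>x. \<bar>d b x\<bar> powr p)" if "b \<in> Basis" for b
    using d that p by (intro integrable_continuous_bounded_support[where R=R] continuous_on_powr' continuous_intros) auto
  \<comment> \<open>Hoelder bound for the integral of \<open>G b\<close>: raised to the power p',
    the factor \<open>\<bar>\<phi> x\<bar> powr (\<gamma> - 1)\<close> becomes the integrand of
    \<open>A\<close>.\<close>
  define E where "E = \<gamma> * (A powr (1 / p') * B powr (1 / p))"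
  have GE: "(\<integral>\<^sup>+x. ennreal (G b x) \<partial>lborel) \<le> ennreal E" if b: "b \<in> Basis" for b
  proof -
    have pp: "\<bar>\<bar>\<phi> x\<bar> powr (\<gamma> - 1)\<bar> powr p' = \<bar>\<phi> x\<bar> powr P" for x
      by (simp add: powr_powr \<gamma>p')
    note H = Holder_integral[OF p'(1) p(1) p'(2), of "\<lambda>x. \<bar>\<phi> x\<bar> powr (\<gamma> - 1)" lborel "\<lambda>x. \<bar>d b x\<bar>"]
    have i: "integrable lborel (\<lambda>x. \<bar>\<phi> x\<bar> powr (\<gamma> - 1) * \<bar>d b x\<bar>)"
      and l: "(\<integral>x. \<bar>\<bar>\<phi> x\<bar> powr (\<gamma> - 1) * \<bar>d b x\<bar>\<bar> \<partial>lborel) \<le>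
        A powr (1 / p') * (\<integral>x. \<bar>d b x\<bar> powr p \<partial>lborel) powr (1 / p)"
      using H b intA intd[OF b] unfolding pp A_def by (simp_all add: dm)
    have "(\<integral>\<^sup>+x. ennreal (G b x) \<partial>lborel) = ennreal (\<integral>x. G b x \<partial>lborel)"
      unfolding G_def using i \<gamma> by (intro nn_integral_eq_integral) (auto simp: mult.assoc)
    also have "(\<integral>x. G b x \<partial>lborel) = \<gamma> * (\<integral>x. \<bar>\<bar>\<phi> x\<bar> powr (\<gamma> - 1) * \<bar>d b x\<bar>\<bar> \<partial>lborel)"
      by (simp add: G_def mult.assoc abs_mult)
    also have "\<dots> \<le> E"
      unfolding E_def using \<gamma> p B[OF b]
      by (intro mult_left_mono order_trans[OF l] powr_mono2) auto
    finally show ?thesis by (simp add: ennreal_leI)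
  qed
  have E0: "E \<ge> 0" using \<gamma> by (simp add: E_def)
  have "ennreal A = (\<integral>\<^sup>+x. ennreal (\<bar>\<phi> x\<bar> powr P) \<partial>lborel)"
    unfolding A_def using intA by (intro nn_integral_eq_integral[symmetric]) auto
  \<comment> \<open>The power P is a product of N equal factors, one for each direction, ready to be
    bounded separately.\<close>
  also have "\<dots> = (\<integral>\<^sup>+x. (\<Prod>b\<in>(Basis::'a set). epow (ennreal (\<bar>\<phi> x\<bar> powr \<gamma>)) c) \<partial>lborel)"
  proof (rule nn_integral_cong)
    fix x
    have "(\<Prod>b\<in>(Basis::'a set). epow (ennreal (\<bar>\<phi> x\<bar> powr \<gamma>)) c) = ennreal ((\<bar>\<phi> x\<bar> powr (\<gamma> * c)) ^ DIM('a))"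
      by (simp add: epow_ennreal powr_powr ennreal_power)
    also have "(\<bar>\<phi> x\<bar> powr (\<gamma> * c)) ^ DIM('a) = \<bar>\<phi> x\<bar> powr P"
      by (cases "\<phi> x = 0") (auto simp: powr_realpow[symmetric] powr_powr N_def[symmetric] \<gamma>P mult_ac)
    finally show "ennreal (\<bar>\<phi> x\<bar> powr P) = (\<Prod>b\<in>(Basis::'a set). epow (ennreal (\<bar>\<phi> x\<bar> powr \<gamma>)) c)" by simp
  qed
  also have "\<dots> \<le> (\<integral>\<^sup>+x. (\<Prod>b\<in>(Basis::'a set). epow (line_int b (\<lambda>x. ennreal (G b x)) x) c) \<partial>lborel)"
    using pw c N by (intro nn_integral_mono prod_mono_ennreal epow_mono) auto
  also have "\<dots> \<le> (\<Prod>b\<in>(Basis::'a set). epow (\<integral>\<^sup>+x. ennreal (G b x) \<partial>lborel) c)"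
    unfolding c_def using DIM by (intro loomis_whitney) auto
  also have "\<dots> \<le> (\<Prod>b\<in>(Basis::'a set). epow (ennreal E) c)"
    using GE c N by (intro prod_mono_ennreal epow_mono) auto
  also have "\<dots> = ennreal ((E powr c) ^ DIM('a))"
    using E0 by (simp add: epow_ennreal ennreal_power)
  also have "(E powr c) ^ DIM('a) = E powr (N * c)"
    using E0 DIM by (cases "E = 0") (auto simp: powr_realpow[symmetric] powr_powr N_def mult_ac)
  finally have AE: "A \<le> E powr (N * c)" by (simp add: ennreal_le_iff)
  have "A \<le> \<gamma> powr P * B powr (N / (N - p))"
  proof (cases "A = 0")
    case True
    then show ?thesis by simp
  next
    case False
    then have A: "A > 0" using A0 by simp
    \<comment> \<open>\<open>A\<close> enters the right side with exponent N c / p' = 1 - e.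
      Dividing by that power, legitimate because \<open>A\<close> is positive and finite, leaves
      A^e, and the power 1 / e gives the claim.\<close>
    define e where "e = (N - p) / ((N - 1) * p)"
    have e: "e > 0" using N p by (simp add: e_def)
    have e1: "N * c * (1 / p') = 1 - e"
      using N p by (simp add: c p'_def e_def field_simps)
    have "E powr (N * c) = \<gamma> powr (N * c) * (A powr (1 - e) * B powr (N * c / p))"
      using \<gamma> A B0 e1 by (simp add: E_def powr_mult powr_powr mult_ac)
    then have "A powr e * A powr (1 - e) \<le> (\<gamma> powr (N * c) * B powr (N * c / p)) * A powr (1 - e)"
      using AE A by (simp add: powr_add[symmetric] mult_ac)
    then have "A powr e \<le> \<gamma> powr (N * c) * B powr (N * c / p)" using A by simp
    then have "(A powr e) powr (1 / e) \<le> (\<gamma> powr (N * c) * B powr (N * c / p)) powr (1 / e)"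
      using e by (intro powr_mono2) auto
    moreover have "N * c / e = P" "N * c / p / e = N / (N - p)"
      using N p by (auto simp: c e_def P_def)
    ultimately show ?thesis using A e B0 \<gamma> by (simp add: powr_powr powr_mult)
  qed
  then show ?thesis by (simp add: A_def \<gamma>_def P_def)
qed

subsection \<open>Smooth functions\<close>

lemma smooth_differentiable: "smooth f \<Longrightarrow> f differentiable (at x)"
  using foldr.simps(1) unfolding smooth_def by (metis id_apply)

lemma smooth_pd: "smooth f \<Longrightarrow> smooth (pd i f)"
  unfolding smooth_def
proof (intro allI)
  fix l x assume *: "\<forall>is x. foldr pd is f differentiable at x"
  show "foldr pd l (pd i f) differentiable at x"
    using *[rule_format, of "l @ [i]" x] by simp
qed

lemma smooth_foldr_pd: "smooth f \<Longrightarrow> smooth (foldr pd l f)"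
  by (induction l) (auto intro: smooth_pd)

lemma smooth_continuous: "smooth f \<Longrightarrow> continuous_on UNIV f"
  by (simp add: continuous_on_eq_continuous_at differentiable_imp_continuous_within smooth_differentiable)

text \<open>Reduces smoothness to finding a class of differentiable functions closed under partial
  derivatives, without formulas for the iterated derivatives.\<close>

lemma smooth_coinduct:
  assumes "f \<in> S" and "\<And>f x. f \<in> S \<Longrightarrow> f differentiable (at x)" and "\<And>f i. f \<in> S \<Longrightarrow> pd i f \<in> S"
  shows "smooth f"
proof -
  have "foldr pd l f \<in> S" for l
    by (induction l) (use assms in auto)
  then show ?thesis using assms(2) by (auto simp: smooth_def)
qed

lemma differentiable_has_pd:
  fixes f :: "real ^ 'n \<Rightarrow> real"
  assumes "f differentiable (at x)"
  shows "((\<lambda>t. f (x + t *\<^sub>R axis i 1)) has_real_derivative pd i f x) (at 0)"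
proof -
  from assms obtain f' where f': "(f has_derivative f') (at x)" by (auto simp: differentiable_def)
  have l: "((\<lambda>t. x + t *\<^sub>R axis i 1) has_derivative (\<lambda>t. t *\<^sub>R axis i 1)) (at 0)"
    by (auto intro!: derivative_eq_intros)
  have "((\<lambda>t. f (x + t *\<^sub>R axis i 1)) has_derivative (\<lambda>t. f' (t *\<^sub>R axis i 1))) (at 0)"
    using has_derivative_compose[OF l, of f f'] f' by simp
  moreover have "f' (t *\<^sub>R axis i 1) = f' (axis i 1) * t" for t
    using has_derivative_linear[OF f'] by (simp add: linear_cmul)
  ultimately have "((\<lambda>t. f (x + t *\<^sub>R axis i 1)) has_real_derivative f' (axis i 1)) (at 0)"
    by (simp add: has_field_derivative_def)
  moreover from this have "pd i f x = f' (axis i 1)" by (simp add: pd_def DERIV_imp_deriv)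
  ultimately show ?thesis by simp
qed

lemma smooth_has_pd:
  "smooth f \<Longrightarrow> ((\<lambda>t. f (x + t *\<^sub>R axis i 1)) has_real_derivative pd i f (x + s *\<^sub>R axis i 1)) (at s)"
  using differentiable_has_pd[OF smooth_differentiable, of f "x + s *\<^sub>R axis i 1" i]
    DERIV_shift[of "\<lambda>t. f (x + t *\<^sub>R axis i 1)" _ 0 s]
  by (simp add: algebra_simps)

lemma pd_eqI: "((\<lambda>t. f (x + t *\<^sub>R axis i 1)) has_real_derivative D) (at 0) \<Longrightarrow> pd i f x = D"
  by (simp add: pd_def DERIV_imp_deriv)

lemma pd_const [simp]: "pd i (\<lambda>x. c) = (\<lambda>x. 0)"
  by (auto intro!: ext pd_eqI derivative_eq_intros)

lemma pd_add:
  assumes "\<And>x. f differentiable (at x)" "\<And>x. g differentiable (at x)"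
  shows "pd i (\<lambda>x. f x + g x) = (\<lambda>x. pd i f x + pd i g x)"
  by (intro ext pd_eqI DERIV_add differentiable_has_pd assms)

lemma pd_mult:
  assumes "\<And>x. f differentiable (at x)" "\<And>x. g differentiable (at x)"
  shows "pd i (\<lambda>x. f x * g x) = (\<lambda>x. pd i f x * g x + pd i g x * f x)"
proof (intro ext pd_eqI)
  fix x
  show "((\<lambda>t. f (x + t *\<^sub>R axis i 1) * g (x + t *\<^sub>R axis i 1)) has_real_derivative
      pd i f x * g x + pd i g x * f x) (at 0)"
    using DERIV_mult[OF differentiable_has_pd[OF assms(1), of x i] differentiable_has_pd[OF assms(2), of x i]]
    by simp
qed

lemma pd_affine:
  assumes "\<And>x. f differentiable (at x)"
  shows "pd i (\<lambda>x. c * f (a *\<^sub>R x + v)) = (\<lambda>x. (c * a) * pd i f (a *\<^sub>R x + v))"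
proof (intro ext pd_eqI)
  fix x
  have "((\<lambda>t. f ((a *\<^sub>R x + v) + t *\<^sub>R axis i 1)) has_real_derivative pd i f (a *\<^sub>R x + v)) (at (a * 0))"
    using differentiable_has_pd[OF assms] by simp
  from DERIV_chain2[where x=0 and s=UNIV and g="\<lambda>t. a * t" and Db=a, OF this]
  have "((\<lambda>t. f ((a *\<^sub>R x + v) + (a * t) *\<^sub>R axis i 1)) has_real_derivative pd i f (a *\<^sub>R x + v) * a) (at 0)"
    by (auto intro!: derivative_eq_intros)
  from DERIV_cmult[OF this, of c]
  show "((\<lambda>t. c * f (a *\<^sub>R (x + t *\<^sub>R axis i 1) + v)) has_real_derivative c * a * pd i f (a *\<^sub>R x + v)) (at 0)"
    by (simp add: algebra_simps)
qed

text \<open>The Leibniz rule turns a product into a sum of products, so neither sums nor products of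
  smooth functions form a class closed under differentiation alone; the algebra that they generate
  does.\<close>

inductive_set smooth_alg :: "(real ^ 'n \<Rightarrow> real) set" where
  base: "smooth f \<Longrightarrow> f \<in> smooth_alg"
| add: "f \<in> smooth_alg \<Longrightarrow> g \<in> smooth_alg \<Longrightarrow> (\<lambda>x. f x + g x) \<in> smooth_alg"
| mult: "f \<in> smooth_alg \<Longrightarrow> g \<in> smooth_alg \<Longrightarrow> (\<lambda>x. f x * g x) \<in> smooth_alg"

lemma smooth_alg_imp_smooth: "f \<in> smooth_alg \<Longrightarrow> smooth f"
proof (erule smooth_coinduct)
  have *: "(\<forall>x. f differentiable (at x)) \<and> (\<forall>i. pd i f \<in> smooth_alg)" if "f \<in> smooth_alg" for f :: "real ^ 'n \<Rightarrow> real"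
    using that
  proof induction
    case (base f)
    then show ?case by (auto intro: smooth_alg.base smooth_pd smooth_differentiable)
  next
    case (add f g)
    then show ?case by (auto simp: pd_add intro: smooth_alg.add)
  next
    case (mult f g)
    then show ?case by (auto simp: pd_mult intro!: smooth_alg.add smooth_alg.mult)
  qed
  then show "f differentiable (at x)" "pd i f \<in> smooth_alg" if "f \<in> smooth_alg" for f :: "real ^ 'n \<Rightarrow> real" and x i
    using that by auto
qed

lemma smooth_add: "smooth f \<Longrightarrow> smooth g \<Longrightarrow> smooth (\<lambda>x. f x + g x)"
  and smooth_mult: "smooth f \<Longrightarrow> smooth g \<Longrightarrow> smooth (\<lambda>x. f x * g x)"
  by (rule smooth_alg_imp_smooth; intro smooth_alg.intros; assumption)+

lemma smooth_const: "smooth (\<lambda>x. c)"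
  by (rule smooth_coinduct[of _ "range (\<lambda>c x. c)"]) auto

lemma smooth_prod: "finite A \<Longrightarrow> (\<And>a. a \<in> A \<Longrightarrow> smooth (f a)) \<Longrightarrow> smooth (\<lambda>x. \<Prod>a\<in>A. f a x)"
  by (induction A rule: finite_induct) (auto intro: smooth_const smooth_mult)

lemma smooth_affine:
  assumes "smooth f"
  shows "smooth (\<lambda>x. c * f (a *\<^sub>R x + v))"
\<comment> \<open>The scalar varies within the class, since every derivative contributes another
  factor \<open>a\<close>.\<close>
proof (rule smooth_coinduct[where S="{\<lambda>x. c * f (a *\<^sub>R x + v) | c f. smooth f}"])
  show "(\<lambda>x. c * f (a *\<^sub>R x + v)) \<in> {\<lambda>x. c * f (a *\<^sub>R x + v) | c f. smooth f}"
    using assms by blast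
next
  fix g :: "real ^ 'a \<Rightarrow> real" and x
  assume "g \<in> {\<lambda>x. c * f (a *\<^sub>R x + v) | c f. smooth f}"
  then obtain c f where g: "g = (\<lambda>x. c * f (a *\<^sub>R x + v))" "smooth f" by blast
  have "(\<lambda>x. f (a *\<^sub>R x + v)) differentiable (at x)"
    by (rule differentiable_compose[where f=f]) (auto intro!: smooth_differentiable g)
  then show "g differentiable (at x)" by (simp add: g)
next
  fix g :: "real ^ 'a \<Rightarrow> real" and i
  assume "g \<in> {\<lambda>x. c * f (a *\<^sub>R x + v) | c f. smooth f}"
  then obtain c f where g: "g = (\<lambda>x. c * f (a *\<^sub>R x + v))" "smooth f" by blast
  then have "pd i g = (\<lambda>x. (c * a) * pd i f (a *\<^sub>R x + v))"
    by (simp add: pd_affine smooth_differentiable)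
  then show "pd i g \<in> {\<lambda>x. c * f (a *\<^sub>R x + v) | c f. smooth f}"
    using g(2) smooth_pd by blast
qed

lemma smooth_cmult: "smooth f \<Longrightarrow> smooth (\<lambda>x. c * f x)"
  using smooth_mult[OF smooth_const] by blast

lemma smooth_diff: "smooth f \<Longrightarrow> smooth g \<Longrightarrow> smooth (\<lambda>x. f x - g x)"
  using smooth_add[OF _ smooth_cmult[of g "-1"], of f] by simp

lemma foldr_pd_affine:
  assumes "smooth f"
  shows "foldr pd l (\<lambda>x. c * f (a *\<^sub>R x + v)) = (\<lambda>x. (c * a ^ length l) * foldr pd l f (a *\<^sub>R x + v))"
proof (induction l)
  case (Cons i l)
  then show ?case
    using pd_affine[OF smooth_differentiable[OF smooth_foldr_pd[OF assms]], of i "c * a ^ length l" l a v]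
    by (simp add: mult_ac)
qed simp

lemma foldr_pd_diff:
  assumes "smooth f" "smooth g"
  shows "foldr pd l (\<lambda>x. f x - g x) = (\<lambda>x. foldr pd l f x - foldr pd l g x)"
proof (induction l)
  case (Cons i l)
  have "pd i (\<lambda>x. foldr pd l f x + (-1) * foldr pd l g x) =
    (\<lambda>x. pd i (foldr pd l f) x + pd i (\<lambda>x. (-1) * foldr pd l g x) x)"
    by (intro pd_add smooth_differentiable smooth_cmult smooth_foldr_pd assms)
  moreover have "pd i (\<lambda>x. (-1) * foldr pd l g x) = (\<lambda>x. (-1) * pd i (foldr pd l g) x)"
    using pd_affine[of "foldr pd l g" i "-1" 1 0] smooth_differentiable[OF smooth_foldr_pd[OF assms(2)]] by simp
  ultimately show ?case using Cons by simp
qed simp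

text \<open>Both mixed partials are limits of the same second difference quotient.\<close>

lemma pd_mixed_mvt:
  assumes f: "smooth f" and h: "0 < h"
  shows "\<exists>\<xi> \<eta>. 0 < \<xi> \<and> \<xi> < h \<and> 0 < \<eta> \<and> \<eta> < h \<and>
    f (x + h *\<^sub>R axis i 1 + h *\<^sub>R axis j 1) - f (x + h *\<^sub>R axis i 1) - f (x + h *\<^sub>R axis j 1) + f x =
    h * h * pd j (pd i f) (x + \<xi> *\<^sub>R axis i 1 + \<eta> *\<^sub>R axis j 1)"
proof -
  \<comment> \<open>The first difference in direction j, followed along direction i. The mean value
    theorem for \<open>g\<close> produces \<xi>; applied to the resulting difference of
    \<open>pd i f\<close>, it produces \<eta>.\<close>
  define g where "g s = f ((x + h *\<^sub>R axis j 1) + s *\<^sub>R axis i 1) - f (x + s *\<^sub>R axis i 1)" for s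
  let ?g' = "\<lambda>s. pd i f ((x + h *\<^sub>R axis j 1) + s *\<^sub>R axis i 1) - pd i f (x + s *\<^sub>R axis i 1)"
  have g': "(g has_real_derivative ?g' s) (at s)" for s
    unfolding g_def[abs_def] by (intro DERIV_diff smooth_has_pd f)
  obtain \<xi> where \<xi>: "0 < \<xi>" "\<xi> < h"
    "g h - g 0 = (h - 0) * (pd i f ((x + h *\<^sub>R axis j 1) + \<xi> *\<^sub>R axis i 1) - pd i f (x + \<xi> *\<^sub>R axis i 1))"
    using MVT2[of 0 h g ?g', OF h g'] by blast
  obtain \<eta> where \<eta>: "0 < \<eta>" "\<eta> < h"
    "pd i f ((x + \<xi> *\<^sub>R axis i 1) + h *\<^sub>R axis j 1) - pd i f ((x + \<xi> *\<^sub>R axis i 1) + 0 *\<^sub>R axis j 1) =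
      (h - 0) * pd j (pd i f) ((x + \<xi> *\<^sub>R axis i 1) + \<eta> *\<^sub>R axis j 1)"
    using MVT2[of 0 h "\<lambda>t. pd i f ((x + \<xi> *\<^sub>R axis i 1) + t *\<^sub>R axis j 1)"
      "\<lambda>t. pd j (pd i f) ((x + \<xi> *\<^sub>R axis i 1) + t *\<^sub>R axis j 1)", OF h smooth_has_pd[OF smooth_pd[OF f]]]
    by blast
  have "g h - g 0 = h * (h * pd j (pd i f) (x + \<xi> *\<^sub>R axis i 1 + \<eta> *\<^sub>R axis j 1))"
    using \<xi>(3) \<eta>(3) by (simp add: add_ac)
  then show ?thesis using \<xi>(1,2) \<eta>(1,2)
    by (intro exI[of _ \<xi>] exI[of _ \<eta>]) (simp add: g_def add_ac)
qed

lemma pd_commute: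
  fixes f :: "real ^ 'n \<Rightarrow> real"
  assumes f: "smooth f"
  shows "pd i (pd j f) = pd j (pd i f)"
proof
  fix x :: "real ^ 'n"
  define h where "h n = inverse (real (Suc n))" for n
  have h0: "h \<longlonglongrightarrow> 0" unfolding h_def by (rule LIMSEQ_inverse_real_of_nat)
  have hp: "h n > 0" for n by (simp add: h_def)
  have "\<forall>n. \<exists>\<xi> \<eta> \<xi>' \<eta>'. 0 < \<xi> \<and> \<xi> < h n \<and> 0 < \<eta> \<and> \<eta> < h n \<and> 0 < \<xi>' \<and> \<xi>' < h n \<and> 0 < \<eta>' \<and> \<eta>' < h n \<and>
      pd j (pd i f) (x + \<xi> *\<^sub>R axis i 1 + \<eta> *\<^sub>R axis j 1) = pd i (pd j f) (x + \<xi>' *\<^sub>R axis j 1 + \<eta>' *\<^sub>R axis i 1)"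
  proof
    fix n
    obtain \<xi> \<eta> where 1: "0 < \<xi>" "\<xi> < h n" "0 < \<eta>" "\<eta> < h n" and e1:
      "f (x + h n *\<^sub>R axis i 1 + h n *\<^sub>R axis j 1) - f (x + h n *\<^sub>R axis i 1) - f (x + h n *\<^sub>R axis j 1) + f x =
        h n * h n * pd j (pd i f) (x + \<xi> *\<^sub>R axis i 1 + \<eta> *\<^sub>R axis j 1)"
      using pd_mixed_mvt[OF f hp] by blast
    obtain \<xi>' \<eta>' where 2: "0 < \<xi>'" "\<xi>' < h n" "0 < \<eta>'" "\<eta>' < h n" and e2:
      "f (x + h n *\<^sub>R axis j 1 + h n *\<^sub>R axis i 1) - f (x + h n *\<^sub>R axis j 1) - f (x + h n *\<^sub>R axis i 1) + f x =
        h n * h n * pd i (pd j f) (x + \<xi>' *\<^sub>R axis j 1 + \<eta>' *\<^sub>R axis i 1)"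
      using pd_mixed_mvt[OF f hp] by blast
    have "h n * h n * pd j (pd i f) (x + \<xi> *\<^sub>R axis i 1 + \<eta> *\<^sub>R axis j 1) =
        h n * h n * pd i (pd j f) (x + \<xi>' *\<^sub>R axis j 1 + \<eta>' *\<^sub>R axis i 1)"
      unfolding e1[symmetric] e2[symmetric] by (simp add: algebra_simps)
    then have "pd j (pd i f) (x + \<xi> *\<^sub>R axis i 1 + \<eta> *\<^sub>R axis j 1) =
        pd i (pd j f) (x + \<xi>' *\<^sub>R axis j 1 + \<eta>' *\<^sub>R axis i 1)"
      using hp[of n] by simp
    with 1 2 show "\<exists>\<xi> \<eta> \<xi>' \<eta>'. 0 < \<xi> \<and> \<xi> < h n \<and> 0 < \<eta> \<and> \<eta> < h n \<and> 0 < \<xi>' \<and> \<xi>' < h n \<and> 0 < \<eta>' \<and> \<eta>' < h n \<and>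
      pd j (pd i f) (x + \<xi> *\<^sub>R axis i 1 + \<eta> *\<^sub>R axis j 1) = pd i (pd j f) (x + \<xi>' *\<^sub>R axis j 1 + \<eta>' *\<^sub>R axis i 1)"
      by blast
  qed
  then obtain \<xi> \<eta> \<xi>' \<eta>' where b: "\<And>n. 0 < \<xi> n \<and> \<xi> n < h n \<and> 0 < \<eta> n \<and> \<eta> n < h n \<and> 0 < \<xi>' n \<and> \<xi>' n < h n \<and> 0 < \<eta>' n \<and> \<eta>' n < h n"
    and eq: "\<And>n. pd j (pd i f) (x + \<xi> n *\<^sub>R axis i 1 + \<eta> n *\<^sub>R axis j 1) =
        pd i (pd j f) (x + \<xi>' n *\<^sub>R axis j 1 + \<eta>' n *\<^sub>R axis i 1)"
    by metis
  have sq: "s \<longlonglongrightarrow> 0" if "\<And>n. 0 < s n \<and> s n < h n" for s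
    by (rule tendsto_sandwich[OF _ _ tendsto_const h0]) (use that in \<open>auto intro!: always_eventually less_imp_le\<close>)
  have c: "isCont (pd i (pd j f)) x" "isCont (pd j (pd i f)) x"
    using smooth_continuous[OF smooth_pd[OF smooth_pd[OF f]]] by (auto simp: continuous_on_eq_continuous_at)
  have "(\<lambda>n. x + \<xi> n *\<^sub>R axis i 1 + \<eta> n *\<^sub>R axis j 1) \<longlonglongrightarrow> x + 0 *\<^sub>R axis i 1 + 0 *\<^sub>R axis j 1"
    by (intro tendsto_intros sq) (use b in auto)
  with isCont_tendsto_compose[OF c(2)]
  have 1: "(\<lambda>n. pd j (pd i f) (x + \<xi> n *\<^sub>R axis i 1 + \<eta> n *\<^sub>R axis j 1)) \<longlonglongrightarrow> pd j (pd i f) x" by simp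
  have "(\<lambda>n. x + \<xi>' n *\<^sub>R axis j 1 + \<eta>' n *\<^sub>R axis i 1) \<longlonglongrightarrow> x + 0 *\<^sub>R axis j 1 + 0 *\<^sub>R axis i 1"
    by (intro tendsto_intros sq) (use b in auto)
  with isCont_tendsto_compose[OF c(1)]
  have "(\<lambda>n. pd i (pd j f) (x + \<xi>' n *\<^sub>R axis j 1 + \<eta>' n *\<^sub>R axis i 1)) \<longlonglongrightarrow> pd i (pd j f) x" by simp
  with 1 eq show "pd i (pd j f) x = pd j (pd i f) x"
    using LIMSEQ_unique by auto
qed

section \<open>Independence of the order of differentiation; multi-indices as lists\<close>

lemma pd_foldr_pd: "smooth f \<Longrightarrow> pd i (foldr pd l f) = foldr pd l (pd i f)"
  by (induction l) (auto simp: pd_commute smooth_foldr_pd)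

lemma foldr_pd_perm:
  "smooth f \<Longrightarrow> mset k = mset l \<Longrightarrow> foldr pd k f = foldr pd l f"
proof (induction k arbitrary: l)
  case (Cons i k)
  then have "i \<in> set l" by (metis list.set_intros(1) mset_eq_setD)
  then obtain l1 l2 where l: "l = l1 @ i # l2" by (meson split_list)
  then have "foldr pd k f = foldr pd (l1 @ l2) f" using Cons by (intro Cons.IH) auto
  then show ?case using Cons.prems(1) by (simp add: l pd_foldr_pd smooth_foldr_pd)
qed simp

lemma mi_list_ex: "\<exists>l. \<forall>i::'n::finite. count_list l i = \<alpha> $ i"
proof -
  obtain l where "mset l = (\<Sum>i\<in>(UNIV::'n set). replicate_mset (\<alpha> $ i) i)" using ex_mset by blast
  then have "count (mset l) j = \<alpha> $ j" for j by (simp add: count_sum if_distrib cong: if_cong)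
  then show ?thesis by (auto simp: count_mset)
qed

text \<open>Removes the choice operator in \<open>mi_pd\<close>: any list with the right
  multiplicities is a permutation of the chosen one, and partial derivatives commute.\<close>

lemma mi_pd_eq:
  assumes "smooth f" and "\<And>i. count_list l i = \<alpha> $ i"
  shows "mi_pd \<alpha> f = foldr pd l f"
proof -
  have "\<forall>i. count_list (SOME l. \<forall>i. count_list l i = \<alpha> $ i) i = \<alpha> $ i"
    by (rule someI_ex[OF mi_list_ex])
  then show ?thesis unfolding mi_pd_def
    by (intro foldr_pd_perm assms(1)) (auto simp: multiset_eq_iff count_mset assms(2))
qed

lemma mi_order_length: "(\<And>i. count_list l i = \<alpha> $ i) \<Longrightarrow> mi_order \<alpha> = length l"
  using sum_count_set[of l UNIV] by (simp add: mi_order_def)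

subsection \<open>Test functions\<close>

lemma test_functions_bounded_support:
  fixes \<phi> :: "real ^ 'n \<Rightarrow> real"
  assumes "\<phi> \<in> test_functions"
  obtains R where "R > 0" "\<And>x. R \<le> norm x \<Longrightarrow> \<phi> x = 0"
proof -
  have "bounded {x. \<phi> x \<noteq> 0}"
    using assms by (auto simp: test_functions_def intro: bounded_subset[OF compact_imp_bounded closure_subset])
  then obtain R where R: "\<forall>x\<in>{x. \<phi> x \<noteq> 0}. norm x \<le> R" by (auto simp: bounded_iff)
  show ?thesis by (rule that[of "\<bar>R\<bar> + 1"]) (use R in force)+
qed

lemma test_functionsI:
  fixes \<phi> :: "real ^ 'n \<Rightarrow> real"
  assumes "smooth \<phi>" and "\<And>x. R \<le> norm x \<Longrightarrow> \<phi> x = 0"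
  shows "\<phi> \<in> test_functions"
proof -
  have "{x. \<phi> x \<noteq> 0} \<subseteq> cball 0 R" using assms(2) by (auto simp: not_le) (meson linear)
  then have "bounded {x. \<phi> x \<noteq> 0}" using bounded_cball bounded_subset by blast
  then show ?thesis using assms(1) by (simp add: test_functions_def compact_eq_bounded_closed bounded_closure)
qed

lemma test_functions_smooth: "\<phi> \<in> test_functions \<Longrightarrow> smooth \<phi>"
  by (simp add: test_functions_def)

lemma test_functions_continuous: "\<phi> \<in> test_functions \<Longrightarrow> continuous_on UNIV \<phi>"
  by (simp add: smooth_continuous test_functions_smooth)

lemma test_functions_measurable: "\<phi> \<in> test_functions \<Longrightarrow> \<phi> \<in> borel_measurable borel"
  by (simp add: test_functions_continuous borel_measurable_continuous_onI)

lemma test_functions_bounded: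
  assumes "\<phi> \<in> test_functions"
  obtains M where "M > 0" "\<And>x. \<bar>\<phi> x\<bar> \<le> M"
proof -
  obtain R where R: "R > 0" "\<And>x. R \<le> norm x \<Longrightarrow> \<phi> x = 0"
    using test_functions_bounded_support[OF assms] by blast
  have "compact (\<phi> ` cball 0 R)"
    by (intro compact_continuous_image continuous_on_subset[OF test_functions_continuous[OF assms]]) auto
  then obtain M where M: "M > 0" "\<forall>z\<in>\<phi> ` cball 0 R. norm z \<le> M"
    using compact_imp_bounded bounded_pos by blast
  show ?thesis
  proof (rule that[OF M(1)])
    fix x show "\<bar>\<phi> x\<bar> \<le> M"
      by (cases "norm x \<le> R") (use M R(2)[of x] in auto)
  qed
qed

lemma test_functions_pd:
  assumes "\<phi> \<in> test_functions"
  shows "pd i \<phi> \<in> test_functions"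
proof -
  obtain R where R: "R > 0" "\<And>x. R \<le> norm x \<Longrightarrow> \<phi> x = 0"
    using test_functions_bounded_support[OF assms] by blast
  show ?thesis
  proof (rule test_functionsI[of _ "R + 1"])
    fix x :: "real ^ 'a" assume x: "R + 1 \<le> norm x"
    have "((\<lambda>t. \<phi> (x + t *\<^sub>R axis i 1)) has_real_derivative 0) (at 0)"
    proof (rule has_field_derivative_transform_within_open[of "\<lambda>_. 0"])
      fix t :: real assume "t \<in> {-1<..<1}"
      then have "R \<le> norm (x + t *\<^sub>R axis i 1)"
        using x norm_diff_ineq[of x "t *\<^sub>R axis i 1"] by auto
      then show "0 = \<phi> (x + t *\<^sub>R axis i 1)" using R by simp
    qed auto
    then show "pd i \<phi> x = 0" by (rule pd_eqI)
  qed (use assms in \<open>simp add: smooth_pd test_functions_smooth\<close>)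
qed

lemma test_functions_foldr_pd: "\<phi> \<in> test_functions \<Longrightarrow> foldr pd l \<phi> \<in> test_functions"
  by (induction l) (auto intro: test_functions_pd)

lemma test_functions_mult:
  assumes "\<phi> \<in> test_functions" "smooth \<psi>"
  shows "(\<lambda>x. \<phi> x * \<psi> x) \<in> test_functions"
proof -
  obtain R where R: "R > 0" "\<And>x. R \<le> norm x \<Longrightarrow> \<phi> x = 0"
    using test_functions_bounded_support[OF assms(1)] by blast
  have "smooth (\<lambda>x. \<phi> x * \<psi> x)"
    using assms by (simp add: smooth_mult test_functions_smooth)
  then show ?thesis by (rule test_functionsI[of _ R]) (simp add: R)
qed

lemma test_functions_diff:
  assumes "\<phi> \<in> test_functions" "\<psi> \<in> test_functions"
  shows "(\<lambda>x. \<phi> x - \<psi> x) \<in> test_functions"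
proof -
  obtain R where R: "R > 0" "\<And>x. R \<le> norm x \<Longrightarrow> \<phi> x = 0"
    using test_functions_bounded_support[OF assms(1)] by blast
  obtain R' where R': "R' > 0" "\<And>x. R' \<le> norm x \<Longrightarrow> \<psi> x = 0"
    using test_functions_bounded_support[OF assms(2)] by blast
  have "smooth (\<lambda>x. \<phi> x - \<psi> x)"
    using assms by (simp add: smooth_diff test_functions_smooth)
  then show ?thesis by (rule test_functionsI[of _ "max R R'"]) (simp add: R R')
qed

lemma test_functions_affine:
  assumes "\<phi> \<in> test_functions" "a \<noteq> 0"
  shows "(\<lambda>x. c * \<phi> (a *\<^sub>R x + v)) \<in> test_functions"
proof -
  obtain R where R: "R > 0" "\<And>x. R \<le> norm x \<Longrightarrow> \<phi> x = 0"
    using test_functions_bounded_support[OF assms(1)] by blast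
  show ?thesis
  proof (rule test_functionsI[OF smooth_affine[OF test_functions_smooth[OF assms(1)]], of "(R + norm v) / \<bar>a\<bar>"])
    fix x :: "real ^ 'a" assume "(R + norm v) / \<bar>a\<bar> \<le> norm x"
    then have "R + norm v \<le> norm (a *\<^sub>R x)" using assms by (simp add: field_simps)
    also have "\<dots> \<le> norm (a *\<^sub>R x + v) + norm v" using norm_triangle_ineq4[of "a *\<^sub>R x + v" v] by simp
    finally show "c * \<phi> (a *\<^sub>R x + v) = 0" using R by simp
  qed
qed

lemma test_functions_integrable: "\<phi> \<in> test_functions \<Longrightarrow> integrable lborel \<phi>"
  by (meson integrable_continuous_bounded_support test_functions_bounded_support test_functions_continuous)

lemma test_functions_integrable_powr:
  assumes "\<phi> \<in> test_functions" "0 < r"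
  shows "integrable lborel (\<lambda>x. \<bar>\<phi> x\<bar> powr r)"
proof -
  obtain R where R: "R > 0" "\<And>x. R \<le> norm x \<Longrightarrow> \<phi> x = 0"
    using test_functions_bounded_support[OF assms(1)] by blast
  show ?thesis
    using R assms test_functions_continuous[OF assms(1)]
    by (intro integrable_continuous_bounded_support[where R=R] continuous_on_powr' continuous_intros) auto
qed

text \<open>By translation invariance the integral of every difference quotient is 0; dominated
  convergence carries this over to the derivative.\<close>

lemma integral_pd_eq_0:
  fixes f :: "real ^ 'n \<Rightarrow> real"
  assumes f: "f \<in> test_functions"
  shows "(\<integral>x. pd i f x \<partial>lborel) = 0"
proof -
  obtain R where R: "R > 0" "\<And>x. R \<le> norm x \<Longrightarrow> f x = 0"
    using test_functions_bounded_support[OF f] by blast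
  obtain M where M: "M > 0" "\<And>x. \<bar>pd i f x\<bar> \<le> M"
    using test_functions_bounded[OF test_functions_pd[OF f]] by blast
  note [measurable] = test_functions_measurable[OF f] test_functions_measurable[OF test_functions_pd[OF f]]
  define h where "h n = inverse (real (Suc n))" for n
  have h: "h n > 0" "h n \<le> 1" for n by (auto simp: h_def inverse_le_1_iff)
  have h0: "h \<longlonglongrightarrow> 0" unfolding h_def by (rule LIMSEQ_inverse_real_of_nat)
  define s where "s n x = (f (x + h n *\<^sub>R axis i 1) - f x) / h n" for n x
  have "(\<lambda>n. \<integral>x. s n x \<partial>lborel) \<longlonglongrightarrow> (\<integral>x. pd i f x \<partial>lborel)"
  proof (rule integral_dominated_convergence)
    show "integrable lborel (\<lambda>x::real ^ 'n. M * indicator (cball 0 (R + 1)) x)"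
      \<comment> \<open>The radius R + 1 covers all shifted supports because the increments are at
        most 1; the height M comes from the mean value theorem.\<close>
      by (intro integrable_mult_right integrable_real_indicator) (use emeasure_bounded_finite[of "cball 0 (R + 1) :: (real ^ 'n) set"] in \<open>auto simp: less_top\<close>)
    show "AE x in lborel. (\<lambda>n. s n x) \<longlonglongrightarrow> pd i f x"
    proof (rule AE_I2)
      fix x
      have "((\<lambda>t. (f (x + t *\<^sub>R axis i 1) - f x) / t) \<longlongrightarrow> pd i f x) (at 0)"
        using smooth_has_pd[OF test_functions_smooth[OF f], of x i 0] by (simp add: DERIV_def)
      moreover have "filterlim h (at 0) sequentially"
        using h0 h(1) by (auto simp: filterlim_at intro!: always_eventually less_imp_neq[THEN not_sym])
      ultimately show "(\<lambda>n. s n x) \<longlonglongrightarrow> pd i f x"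
        unfolding s_def by (rule filterlim_compose)
    qed
    show "AE x in lborel. norm (s n x) \<le> M * indicator (cball 0 (R + 1)) x" for n
    proof (rule AE_I2)
      fix x
      show "norm (s n x) \<le> M * indicator (cball 0 (R + 1)) x"
      proof (cases "norm x \<le> R + 1")
        case True
        obtain z where "f (x + h n *\<^sub>R axis i 1) - f (x + 0 *\<^sub>R axis i 1) = (h n - 0) * pd i f (x + z *\<^sub>R axis i 1)"
          using MVT2[of 0 "h n" "\<lambda>t. f (x + t *\<^sub>R axis i 1)" "\<lambda>t. pd i f (x + t *\<^sub>R axis i 1)",
            OF h(1) smooth_has_pd[OF test_functions_smooth[OF f]]] by blast
        then have "s n x = pd i f (x + z *\<^sub>R axis i 1)" using h(1)[of n] by (simp add: s_def)
        then show ?thesis using True M by simp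
      next
        case False
        have "R \<le> norm (x + h n *\<^sub>R axis i 1)"
          using False norm_diff_ineq[of x "h n *\<^sub>R axis i 1"] h[of n] by auto
        then show ?thesis using False R by (simp add: s_def)
      qed
    qed
  qed (unfold s_def, measurable)
  moreover have "(\<integral>x. s n x \<partial>lborel) = 0" for n
  proof -
    have int: "integrable lborel (\<lambda>x. f (x + h n *\<^sub>R axis i 1))"
      using test_functions_integrable[OF test_functions_affine[OF f, of 1 1 "h n *\<^sub>R axis i 1"]] by simp
    have "(\<integral>x. f (h n *\<^sub>R axis i 1 + x) \<partial>lborel) = (\<integral>x. f x \<partial>lborel)"
      by (subst (2) lborel_distr_plus[of "h n *\<^sub>R axis i 1", symmetric], subst integral_distr) auto
    then show ?thesis
      using int test_functions_integrable[OF f] by (simp add: s_def add.commute)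
  qed
  ultimately show ?thesis by (simp add: LIMSEQ_const_iff)
qed

lemma integral_by_parts_pd:
  assumes f: "f \<in> test_functions" and g: "g \<in> test_functions"
  shows "(\<integral>x. f x * pd i g x \<partial>lborel) = - (\<integral>x. pd i f x * g x \<partial>lborel)"
proof -
  have "(\<integral>x. pd i (\<lambda>x. f x * g x) x \<partial>lborel) = 0"
    by (intro integral_pd_eq_0 test_functions_mult f test_functions_smooth g)
  moreover have "pd i (\<lambda>x. f x * g x) = (\<lambda>x. pd i f x * g x + f x * pd i g x)"
    by (subst pd_mult) (auto intro!: smooth_differentiable test_functions_smooth f g)
  moreover have "integrable lborel (\<lambda>x. pd i f x * g x)" "integrable lborel (\<lambda>x. f x * pd i g x)"
    using f g by (simp_all add: test_functions_integrable test_functions_mult test_functions_pd test_functions_smooth)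
  ultimately show ?thesis by simp
qed

lemma integral_by_parts_foldr_pd:
  assumes "f \<in> test_functions" and g: "g \<in> test_functions"
  shows "(\<integral>x. f x * foldr pd l g x \<partial>lborel) = (- 1) ^ length l * (\<integral>x. foldr pd l f x * g x \<partial>lborel)"
  using assms(1)
proof (induction l arbitrary: f)
  case (Cons i l)
  have "(\<integral>x. f x * foldr pd (i # l) g x \<partial>lborel) = - (\<integral>x. pd i f x * foldr pd l g x \<partial>lborel)"
    using integral_by_parts_pd[OF Cons.prems test_functions_foldr_pd[OF g]] by simp
  also have "\<dots> = - ((- 1) ^ length l * (\<integral>x. foldr pd l (pd i f) x * g x \<partial>lborel))"
    by (subst Cons.IH[OF test_functions_pd[OF Cons.prems]]) simp
  also have "foldr pd l (pd i f) = foldr pd (i # l) f"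
    using pd_foldr_pd[OF test_functions_smooth[OF Cons.prems]] by simp
  finally show ?case by simp
qed simp

subsection \<open>Bump functions\<close>

text \<open>\<open>flat 0\<close> is the classical function exp(-1/t), extended by 0. The powers of
  1/t are those that differentiation generates, so that the derivatives stay in the span of the
  family.\<close>

definition flat :: "nat \<Rightarrow> real \<Rightarrow> real" where
  "flat n t = (if t > 0 then (1 / t) ^ n / exp (1 / t) else 0)"

lemma flat_tendsto_0: "((\<lambda>t. (1 / t) ^ n / exp (1 / t)) \<longlongrightarrow> (0::real)) (at_right 0)"
  using filterlim_compose[OF tendsto_power_div_exp_0[of n] filterlim_inverse_at_top_right]
  by (simp add: inverse_eq_divide)

lemma flat_has_derivative:
  "(flat n has_real_derivative flat (n + 2) t - real n * flat (n + 1) t) (at t)"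
proof -
  consider "t > 0" | "t < 0" | "t = 0" by linarith
  then show ?thesis
  proof cases
    case 1
    have "((\<lambda>s::real. s ^ n * exp (- s)) has_real_derivative
        real n * s ^ (n - 1) * exp (- s) + - exp (- s) * s ^ n) (at s)" for s
      by (rule DERIV_mult) (auto intro!: derivative_eq_intros)
    moreover have "((\<lambda>t. 1 / t) has_real_derivative - ((1 / t)\<^sup>2)) (at t)"
      using 1 by (auto intro!: derivative_eq_intros simp: power2_eq_square)
    ultimately have "((\<lambda>t. (1 / t) ^ n * exp (- (1 / t))) has_real_derivative
        (real n * (1 / t) ^ (n - 1) * exp (- (1 / t)) + - exp (- (1 / t)) * (1 / t) ^ n) * - ((1 / t)\<^sup>2)) (at t)"
      by (rule DERIV_chain2)
    moreover have "(real n * s ^ (n - 1) * e + - e * s ^ n) * - (s\<^sup>2) = s ^ (n + 2) * e - real n * (s ^ (n + 1) * e)" for s e :: real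
      by (cases n) (simp_all add: power2_eq_square algebra_simps)
    ultimately have "((\<lambda>t. (1 / t) ^ n * exp (- (1 / t))) has_real_derivative
        (1 / t) ^ (n + 2) * exp (- (1 / t)) - real n * ((1 / t) ^ (n + 1) * exp (- (1 / t)))) (at t)"
      by simp
    then have "((\<lambda>t. (1 / t) ^ n / exp (1 / t)) has_real_derivative
        flat (n + 2) t - real n * flat (n + 1) t) (at t)"
      using 1 by (simp add: flat_def exp_minus divide_inverse)
    then show ?thesis
      by (rule has_field_derivative_transform_within_open[of _ _ _ "{0<..}"]) (use 1 in \<open>auto simp: flat_def\<close>)
  next
    case 2
    have "((\<lambda>t. 0) has_real_derivative flat (n + 2) t - real n * flat (n + 1) t) (at t)"
      using 2 by (simp add: flat_def)
    then show ?thesis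
      by (rule has_field_derivative_transform_within_open[of _ _ _ "{..<0}"]) (use 2 in \<open>auto simp: flat_def\<close>)
  next
    case 3
    \<comment> \<open>For h > 0 the quotient is \<open>flat (n + 1) h\<close>, whence the exponent n
      + 1.\<close>
    have "((\<lambda>h. flat n h / h) \<longlongrightarrow> 0) (at_right 0)"
      by (rule Lim_transform_eventually[OF flat_tendsto_0[of "n + 1"]])
        (auto simp: eventually_at_filter flat_def)
    moreover have "((\<lambda>h. flat n h / h) \<longlongrightarrow> 0) (at_left 0)"
      by (rule Lim_transform_eventually[OF tendsto_const]) (auto simp: eventually_at_filter flat_def)
    ultimately show ?thesis using 3
      by (simp add: DERIV_def filterlim_split_at flat_def[of _ 0])
  qed
qed

text \<open>The class for \<open>smooth_coinduct\<close>: a derivative of a generator is a sum of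
  two generators, with coefficients 0 if the direction is not the coordinate k.\<close>

inductive_set flat_alg :: "(real ^ 'n \<Rightarrow> real) set" where
  base: "(\<lambda>x. c * flat n (s * x $ k + t)) \<in> flat_alg"
| add: "f \<in> flat_alg \<Longrightarrow> g \<in> flat_alg \<Longrightarrow> (\<lambda>x. f x + g x) \<in> flat_alg"

lemma smooth_flat: "smooth (\<lambda>x::real ^ 'n. flat n (s * x $ k + t))"
proof (rule smooth_coinduct[where S=flat_alg])
  show "(\<lambda>x::real ^ 'n. flat n (s * x $ k + t)) \<in> flat_alg"
    using flat_alg.base[of 1] by simp
  have *: "(\<forall>x. f differentiable (at x)) \<and> (\<forall>i. pd i f \<in> flat_alg)" if "f \<in> flat_alg" for f :: "real ^ 'n \<Rightarrow> real"
    using that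
  proof induction
    case (base c n s k t)
    have "(\<lambda>x::real ^ 'n. c * flat n (s * x $ k + t)) differentiable (at x)" for x
    proof -
      have "((\<lambda>x::real ^ 'n. s * x $ k + t) has_derivative (\<lambda>x. s * x $ k)) (at x)"
        by (auto intro!: derivative_eq_intros bounded_linear_imp_has_derivative bounded_linear_vec_nth)
      from has_derivative_compose[OF this, of "flat n" "\<lambda>y. (flat (n + 2) (s * x $ k + t) - real n * flat (n + 1) (s * x $ k + t)) * y"]
      have "(\<lambda>x::real ^ 'n. flat n (s * x $ k + t)) differentiable (at x)"
        using flat_has_derivative[of n "s * x $ k + t"]
        by (auto simp: has_field_derivative_def differentiable_def)
      then show ?thesis by simp
    qed
    moreover have "pd i (\<lambda>x::real ^ 'n. c * flat n (s * x $ k + t)) =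
        (\<lambda>x. (if k = i then c * s else 0) * flat (n + 2) (s * x $ k + t) +
          (if k = i then - c * s * real n else 0) * flat (n + 1) (s * x $ k + t))" for i
    proof (intro ext pd_eqI)
      fix x :: "real ^ 'n"
      define a where "a = (if k = i then 1 else 0 :: real)"
      have "((\<lambda>r. s * (x $ k + r * a) + t) has_real_derivative s * a) (at 0)"
        by (auto intro!: derivative_eq_intros)
      from DERIV_cmult[OF DERIV_chain2[where x=0 and s=UNIV and g="\<lambda>r. s * (x $ k + r * a) + t", OF flat_has_derivative this], of c]
      show "((\<lambda>r. c * flat n (s * (x + r *\<^sub>R axis i 1) $ k + t)) has_real_derivative
        (if k = i then c * s else 0) * flat (n + 2) (s * x $ k + t) +
          (if k = i then - c * s * real n else 0) * flat (n + 1) (s * x $ k + t)) (at 0)"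
        by (auto simp: a_def axis_def algebra_simps split: if_splits)
    qed
    ultimately show ?case by (simp only: flat_alg.add flat_alg.base simp_thms)
  next
    case (add f g)
    then show ?case by (auto simp: pd_add intro: flat_alg.add)
  qed
  then show "f differentiable (at x)" "pd i f \<in> flat_alg" if "f \<in> flat_alg" for f :: "real ^ 'n \<Rightarrow> real" and x i
    using that by auto
qed

text \<open>Smooth approximations, with values in [0, 1], of the indicator of the open box: each
  factor has the form exp(-1/(n t)) with t > 0 inside the box and tends to 1, while outside some
  factor vanishes.\<close>

definition bump :: "nat \<Rightarrow> real ^ 'n \<Rightarrow> real ^ 'n \<Rightarrow> real ^ 'n \<Rightarrow> real" where
  "bump n a b x = (\<Prod>k\<in>UNIV. flat 0 (real n * (x $ k - a $ k)) * flat 0 (real n * (b $ k - x $ k)))"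

lemma flat_0_bounds: "0 \<le> flat 0 t" "flat 0 t \<le> 1"
  by (auto simp: flat_def)

lemma bump_outside: "x \<notin> box a b \<Longrightarrow> bump n a b x = 0"
proof -
  assume "x \<notin> box a b"
  then obtain i where "x $ i \<le> a $ i \<or> b $ i \<le> x $ i" by (auto simp: mem_box_cart not_less)
  then have "real n * (x $ i - a $ i) \<le> 0 \<or> real n * (b $ i - x $ i) \<le> 0"
    by (auto simp: mult_le_0_iff)
  then show "bump n a b x = 0"
    unfolding bump_def by (intro prod_zero bexI[of _ i]) (auto simp: flat_def not_less)
qed

lemma bump_bounds: "0 \<le> bump n a b x" "bump n a b x \<le> 1"
  by (auto simp: bump_def flat_0_bounds intro!: prod_nonneg prod_le_1 mult_le_one)

lemma bump_test_function: "bump n a b \<in> test_functions"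
proof -
  obtain R where R: "box a b \<subseteq> cball 0 R"
    using bounded_box[of a b] by (auto simp: bounded_iff subset_iff)
  have "smooth (\<lambda>x. flat 0 (real n * (x $ k - a $ k)))" "smooth (\<lambda>x. flat 0 (real n * (b $ k - x $ k)))" for k
    using smooth_flat[of 0 "real n" k "- (real n * a $ k)"] smooth_flat[of 0 "- real n" k "real n * b $ k"]
    by (simp_all add: right_diff_distrib)
  then have "smooth (\<lambda>x. flat 0 (real n * (x $ k - a $ k)) * flat 0 (real n * (b $ k - x $ k)))" for k
    by (rule smooth_mult)
  then have "smooth (bump n a b)"
    unfolding bump_def[abs_def] by (rule smooth_prod[OF finite_class.finite_UNIV])
  then show ?thesis
  proof (rule test_functionsI[of _ "R + 1"])
    fix x :: "real ^ 'a" assume "R + 1 \<le> norm x"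
    then have "x \<notin> cball 0 R" by simp
    then show "bump n a b x = 0" using R bump_outside by blast
  qed
qed

lemma bump_tendsto:
  fixes a b x :: "real ^ 'n"
  shows "(\<lambda>n. bump n a b x) \<longlonglongrightarrow> indicator (box a b) x"
proof (cases "x \<in> box a b")
  case True
  have l: "(\<lambda>n. flat 0 (real n * t)) \<longlonglongrightarrow> 1" if "t > 0" for t
  proof -
    have "(\<lambda>n. 1 / exp (1 / t * (1 / real n))) \<longlonglongrightarrow> 1 / exp (1 / t * 0)"
      by (intro tendsto_intros lim_1_over_n) auto
    moreover have "eventually (\<lambda>n. 1 / exp (1 / t * (1 / real n)) = flat 0 (real n * t)) sequentially"
      using eventually_gt_at_top[of 0] by eventually_elim (use that in \<open>auto simp: flat_def mult.commute\<close>)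
    ultimately show ?thesis by (auto intro: Lim_transform_eventually)
  qed
  have "(\<lambda>n. bump n a b x) \<longlonglongrightarrow> (\<Prod>k\<in>(UNIV::'n set). 1 * 1)"
    unfolding bump_def by (intro tendsto_prod tendsto_mult l) (use True in \<open>auto simp: mem_box_cart\<close>)
  then show ?thesis using True by simp
qed (simp add: bump_outside)

subsection \<open>Weak derivatives\<close>

text \<open>The positive and the negative part of f define measures that agree on boxes. These are
  stable under intersection and generate the Borel sets, so the measures coincide, and uniqueness of
  densities makes the two parts equal.\<close>

lemma AE_zero_if_integral_box_zero:
  fixes f :: "'a::euclidean_space \<Rightarrow> real"
  assumes f: "integrable lebesgue f"
    and zero: "\<And>a b. (LINT x|lebesgue. f x * indicator (box a b) x) = 0"
  shows "AE x in lebesgue. f x = 0"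
proof -
  \<comment> \<open>The uniqueness theorems are applied to Borel measures, so f is first replaced by
    a Borel representative.\<close>
  obtain g where g: "g \<in> borel_measurable lborel" "AE x in lborel. f x = g x"
    using completion_ex_borel_measurable_real[of f lborel] f by auto
  note [measurable] = g(1) borel_measurable_integrable[OF f]
  have fg: "AE x in lebesgue. f x = g x" using g(2) by (rule AE_completion)
  have "integrable lebesgue g"
    by (rule integrable_cong_AE_imp[OF f measurable_completion[OF g(1)] fg])
  then have gi: "integrable lborel g" by (simp add: integrable_completion)
  have g0: "(\<integral>x. g x * indicator (box a b) x \<partial>lborel) = 0" for a b
  proof -
    have "(\<integral>x. g x * indicator (box a b) x \<partial>lborel) = (LINT x|lebesgue. g x * indicator (box a b) x)"
      by (rule integral_completion[symmetric]) measurable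
    also have "\<dots> = (LINT x|lebesgue. f x * indicator (box a b) x)"
    proof (rule integral_cong_AE)
      show "(\<lambda>x. g x * indicator (box a b) x) \<in> borel_measurable lebesgue"
        by (rule measurable_completion) measurable
      show "(\<lambda>x. f x * indicator (box a b) x) \<in> borel_measurable lebesgue"
        by (rule borel_measurable_integrable[OF integrable_real_mult_indicator[OF _ f]]) simp
      show "AE x in lebesgue. g x * indicator (box a b) x = f x * indicator (box a b) x"
        using fg by eventually_elim simp
    qed
    finally show ?thesis using zero by simp
  qed
  \<comment> \<open>\<open>ennreal\<close> sends negative numbers to 0, so these densities are the
    positive and the negative part of \<open>g\<close>.\<close>
  let ?M = "density lborel (\<lambda>x. ennreal (g x))" and ?M' = "density lborel (\<lambda>x. ennreal (- g x))"
  have box: "emeasure ?M (box a b) = emeasure ?M' (box a b)" "emeasure ?M (box a b) \<noteq> \<infinity>" for a b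
  proof -
    have int: "integrable lborel (\<lambda>x. g x * indicator (box a b) x)"
      using gi by (intro integrable_real_mult_indicator) auto
    have e: "emeasure ?M (box a b) = (\<integral>\<^sup>+x. ennreal (g x * indicator (box a b) x) \<partial>lborel)"
      "emeasure ?M' (box a b) = (\<integral>\<^sup>+x. ennreal (- (g x * indicator (box a b) x)) \<partial>lborel)"
      by (auto simp: emeasure_density indicator_def intro!: nn_integral_cong)
    have fin: "(\<integral>\<^sup>+x. ennreal (g x * indicator (box a b) x) \<partial>lborel) \<noteq> \<infinity>"
      "(\<integral>\<^sup>+x. ennreal (- (g x * indicator (box a b) x)) \<partial>lborel) \<noteq> \<infinity>"
      using int by (auto simp: real_integrable_def)
    have inj: "a = b" if "a \<noteq> \<infinity>" "b \<noteq> \<infinity>" "enn2real a = enn2real b" for a b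
      using that by (cases a; cases b) auto
    have "enn2real (\<integral>\<^sup>+x. ennreal (g x * indicator (box a b) x) \<partial>lborel) =
        enn2real (\<integral>\<^sup>+x. ennreal (- (g x * indicator (box a b) x)) \<partial>lborel)"
      using real_lebesgue_integral_def[OF int] g0[of a b] by simp
    then show "emeasure ?M (box a b) = emeasure ?M' (box a b)"
      unfolding e by (rule inj[OF fin])
    show "emeasure ?M (box a b) \<noteq> \<infinity>" unfolding e by (rule fin)
  qed
  have "?M = ?M'"
  proof (rule measure_eqI_generator_eq)
    let ?E = "range (\<lambda>(a, b). box a b::'a set)"
    let ?A = "\<lambda>n::nat. box (- (real n *\<^sub>R One)) (real n *\<^sub>R One) :: 'a set"
    show "Int_stable ?E" by (auto simp: Int_stable_def box_Int_box)
    show "?E \<subseteq> Pow UNIV" "sets ?M = sigma_sets UNIV ?E" "sets ?M' = sigma_sets UNIV ?E"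
      by (simp_all add: borel_eq_box)
    show "range ?A \<subseteq> ?E" "(\<Union>i. ?A i) = UNIV" unfolding UN_box_eq_UNIV by auto
    show "emeasure ?M (?A i) \<noteq> \<infinity>" for i by (rule box)
    show "emeasure ?M X = emeasure ?M' X" if "X \<in> ?E" for X using that box by auto
  qed
  then have "AE x in lborel. ennreal (g x) = ennreal (- g x)"
    by (intro sigma_finite_measure.density_unique[OF sigma_finite_lborel]) auto
  then have "AE x in lborel. g x = 0"
  proof eventually_elim
    fix x assume "ennreal (g x) = ennreal (- g x)"
    then show "g x = 0"
      using ennreal_neg[of "g x"] ennreal_neg[of "- g x"] by (cases "g x \<ge> 0") (auto simp: ennreal_eq_0_iff)
  qed
  then have "AE x in lebesgue. g x = 0" by (rule AE_completion)
  with fg show ?thesis by eventually_elim simp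
qed

lemma locally_integrable_measurable:
  fixes v :: "real ^ 'n \<Rightarrow> real"
  assumes "locally_integrable v"
  shows "v \<in> borel_measurable lebesgue"
proof (rule borel_measurable_LIMSEQ_real)
  show "(\<lambda>x. indicator (cball 0 (real n)) x *\<^sub>R v x) \<in> borel_measurable lebesgue" for n
    using assms by (auto simp: locally_integrable_def set_integrable_def dest!: spec[of _ "cball 0 (real n)"])
  fix x :: "real ^ 'n"
  obtain k where k: "norm x \<le> real k" using real_arch_simple by blast
  have "eventually (\<lambda>n. v x = indicator (cball 0 (real n)) x *\<^sub>R v x) sequentially"
    using eventually_ge_at_top[of k] by eventually_elim (use k in auto)
  then show "(\<lambda>n. indicator (cball 0 (real n)) x *\<^sub>R v x) \<longlonglongrightarrow> v x"
    by (rule Lim_transform_eventually[OF tendsto_const])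
qed

lemma locally_integrable_box: "locally_integrable v \<Longrightarrow> integrable lebesgue (\<lambda>x. v x * indicator (box a b) x)"
proof -
  assume v: "locally_integrable v"
  have "integrable lebesgue (\<lambda>x. (indicator (cbox a b) x *\<^sub>R v x) * indicator (box a b) x)"
    using v by (intro integrable_real_mult_indicator) (auto simp: locally_integrable_def set_integrable_def)
  moreover have "(\<lambda>x. (indicator (cbox a b) x *\<^sub>R v x) * indicator (box a b) x) = (\<lambda>x. v x * indicator (box a b) x)"
    using box_subset_cbox[of a b] by (auto simp: indicator_def fun_eq_iff)
  ultimately show ?thesis by (simp only:)
qed

lemma locally_integrable_mult_test:
  assumes v: "locally_integrable v" and \<phi>: "\<phi> \<in> test_functions"
  shows "integrable lebesgue (\<lambda>x. v x * \<phi> x)"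
proof -
  obtain R where R: "\<And>x. R \<le> norm x \<Longrightarrow> \<phi> x = 0"
    using test_functions_bounded_support[OF \<phi>] by blast
  obtain M where M: "M > 0" "\<And>x. \<bar>\<phi> x\<bar> \<le> M"
    using test_functions_bounded[OF \<phi>] by blast
  show ?thesis
  proof (rule Bochner_Integration.integrable_bound)
    show "integrable lebesgue (\<lambda>x. M * (indicator (cball 0 R) x *\<^sub>R v x))"
      using v by (intro integrable_mult_right) (auto simp: locally_integrable_def set_integrable_def)
    show "(\<lambda>x. v x * \<phi> x) \<in> borel_measurable lebesgue"
      by (rule borel_measurable_times[OF locally_integrable_measurable[OF v] measurable_completion])
        (use test_functions_measurable[OF \<phi>] in simp)
    show "AE x in lebesgue. norm (v x * \<phi> x) \<le> norm (M * (indicator (cball 0 R) x *\<^sub>R v x))"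
    proof (rule AE_I2)
      fix x show "norm (v x * \<phi> x) \<le> norm (M * (indicator (cball 0 R) x *\<^sub>R v x))"
        using M R[of x] by (cases "norm x \<le> R") (auto simp: abs_mult mult.commute intro!: mult_right_mono)
    qed
  qed
qed

text \<open>The fundamental lemma of the calculus of variations: bumps converge boundedly to
  indicators of boxes, which reduces it to integrals over boxes.\<close>

lemma AE_zero_if_test_zero:
  fixes v :: "real ^ 'n \<Rightarrow> real"
  assumes v: "locally_integrable v"
    and zero: "\<And>\<phi>. \<phi> \<in> test_functions \<Longrightarrow> (LINT x|lebesgue. v x * \<phi> x) = 0"
  shows "AE x in lebesgue. v x = 0"
proof -
  note [measurable] = locally_integrable_measurable[OF v]
  have box0: "(LINT x|lebesgue. v x * indicator (box a b) x) = 0" for a b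
  proof -
    have "(\<lambda>n. LINT x|lebesgue. v x * bump n a b x) \<longlonglongrightarrow> (LINT x|lebesgue. v x * indicator (box a b) x)"
    proof (rule integral_dominated_convergence)
      show "integrable lebesgue (\<lambda>x. \<bar>v x * indicator (box a b) x\<bar>)"
        by (intro integrable_abs locally_integrable_box v)
      show "(\<lambda>x. v x * bump n a b x) \<in> borel_measurable lebesgue" for n
        using borel_measurable_integrable[OF locally_integrable_mult_test[OF v bump_test_function]] .
      show "(\<lambda>x. v x * indicator (box a b) x) \<in> borel_measurable lebesgue"
        using borel_measurable_integrable[OF locally_integrable_box[OF v]] .
      show "AE x in lebesgue. (\<lambda>n. v x * bump n a b x) \<longlonglongrightarrow> v x * indicator (box a b) x"
        by (intro AE_I2 tendsto_mult tendsto_const bump_tendsto)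
      show "AE x in lebesgue. norm (v x * bump n a b x) \<le> \<bar>v x * indicator (box a b) x\<bar>" for n
      proof (rule AE_I2)
        fix x show "norm (v x * bump n a b x) \<le> \<bar>v x * indicator (box a b) x\<bar>"
          using bump_bounds[of n a b x] bump_outside[of x a b n]
          by (cases "x \<in> box a b") (auto simp: abs_mult intro!: mult_left_le)
      qed
    qed
    then show ?thesis by (simp add: zero bump_test_function LIMSEQ_const_iff)
  qed
  \<comment> \<open>\<open>v\<close> is only locally integrable, so it is cut off to boxes
    exhausting the space; the intersection with a test box is again a box.\<close>
  have "AE x in lebesgue. v x * indicator (box (- (real n *\<^sub>R One)) (real n *\<^sub>R One)) x = 0" for n
  proof (rule AE_zero_if_integral_box_zero[OF locally_integrable_box[OF v]])
    fix a b
    show "(LINT x|lebesgue. v x * indicator (box (- (real n *\<^sub>R One)) (real n *\<^sub>R One)) x * indicator (box a b) x) = 0"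
      using box0 by (simp add: mult.assoc indicator_inter_arith[symmetric] Int_interval box_Int_box)
  qed
  then have "AE x in lebesgue. \<forall>n. v x * indicator (box (- (real n *\<^sub>R One)) (real n *\<^sub>R One)) x = 0"
    by (subst AE_all_countable) (rule allI)
  then show ?thesis
  proof eventually_elim
    fix x assume *: "\<forall>n. v x * indicator (box (- (real n *\<^sub>R One)) (real n *\<^sub>R One)) x = 0"
    obtain n where "x \<in> box (- (real n *\<^sub>R One)) (real n *\<^sub>R One)" using UN_box_eq_UNIV[where ?'a="real ^ 'n"] by blast
    then show "v x = 0" using *[rule_format, of n] by simp
  qed
qed

section \<open>Linearity and uniqueness of weak derivatives\<close>

lemma locally_integrable_add: "locally_integrable u \<Longrightarrow> locally_integrable v \<Longrightarrow> locally_integrable (\<lambda>x. u x + v x)"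
  by (simp add: locally_integrable_def set_integral_add)

lemma locally_integrable_cmult: "locally_integrable u \<Longrightarrow> locally_integrable (\<lambda>x. c * u x)"
  by (simp add: locally_integrable_def)

lemma mi_pd_test: "\<phi> \<in> test_functions \<Longrightarrow> mi_pd \<alpha> \<phi> \<in> test_functions"
  by (simp add: mi_pd_def test_functions_foldr_pd)

lemma is_weak_deriv_add:
  assumes "is_weak_deriv \<alpha> u v" "is_weak_deriv \<alpha> u' v'"
  shows "is_weak_deriv \<alpha> (\<lambda>x. u x + u' x) (\<lambda>x. v x + v' x)"
  using assms
  by (auto simp: is_weak_deriv_def locally_integrable_add locally_integrable_mult_test mi_pd_test distrib_right distrib_left)

lemma is_weak_deriv_cmult:
  assumes "is_weak_deriv \<alpha> u v"
  shows "is_weak_deriv \<alpha> (\<lambda>x. c * u x) (\<lambda>x. c * v x)"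
  using assms by (auto simp: is_weak_deriv_def locally_integrable_cmult mult.assoc)

lemma is_weak_deriv_zero: "is_weak_deriv \<alpha> (\<lambda>x. 0) (\<lambda>x. 0)"
  by (simp add: is_weak_deriv_def locally_integrable_def set_integrable_def)

lemma is_weak_deriv_diff:
  assumes "is_weak_deriv \<alpha> u v" "is_weak_deriv \<alpha> u' v'"
  shows "is_weak_deriv \<alpha> (\<lambda>x. u x - u' x) (\<lambda>x. v x - v' x)"
  using is_weak_deriv_add[OF assms(1) is_weak_deriv_cmult[OF assms(2), of "-1"]] by simp

lemma is_weak_deriv_sum:
  assumes "finite A" "\<And>l. l \<in> A \<Longrightarrow> is_weak_deriv \<alpha> (u l) (v l)"
  shows "is_weak_deriv \<alpha> (\<lambda>x. \<Sum>l\<in>A. u l x) (\<lambda>x. \<Sum>l\<in>A. v l x)"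
  using assms by (induction A rule: finite_induct) (auto intro: is_weak_deriv_zero is_weak_deriv_add)

lemma is_weak_deriv_unique:
  assumes "is_weak_deriv \<alpha> u v" "is_weak_deriv \<alpha> u v'"
  shows "AE x in lebesgue. v x = v' x"
proof -
  have d: "is_weak_deriv \<alpha> (\<lambda>x. 0) (\<lambda>x. v x - v' x)"
    using is_weak_deriv_diff[OF assms] by simp
  have "AE x in lebesgue. v x - v' x = 0"
  proof (rule AE_zero_if_test_zero)
    show "locally_integrable (\<lambda>x. v x - v' x)" using d by (simp add: is_weak_deriv_def)
    fix \<phi> :: "real ^ 'a \<Rightarrow> real" assume "\<phi> \<in> test_functions"
    then have "0 = (- 1) ^ mi_order \<alpha> * (LINT x|lebesgue. (v x - v' x) * \<phi> x)"
      using d by (auto simp: is_weak_deriv_def)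
    then show "(LINT x|lebesgue. (v x - v' x) * \<phi> x) = 0" by simp
  qed
  then show ?thesis by eventually_elim simp
qed

lemma is_weak_deriv_wderiv: "is_weak_deriv \<alpha> u v \<Longrightarrow> is_weak_deriv \<alpha> u (wderiv \<alpha> u)"
  unfolding wderiv_def by (rule someI[of "is_weak_deriv \<alpha> u"])

text \<open>Whatever representative the choice in \<open>wderiv\<close> picks, it may be replaced by
  a derivative found explicitly. Every later computation of a derivative passes through
  this.\<close>

lemma wderiv_AE_eq: "is_weak_deriv \<alpha> u v \<Longrightarrow> AE x in lebesgue. wderiv \<alpha> u x = v x"
  using is_weak_deriv_unique is_weak_deriv_wderiv by blast

lemma test_function_locally_integrable:
  assumes "\<phi> \<in> test_functions"
  shows "locally_integrable \<phi>"
  unfolding locally_integrable_def set_integrable_def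
proof (intro allI impI)
  fix K :: "(real ^ 'a) set" assume "compact K"
  then have "K \<in> sets lebesgue" by (rule fmeasurableD[OF lmeasurable_compact])
  moreover have "integrable lebesgue \<phi>"
    using test_functions_integrable[OF assms] test_functions_measurable[OF assms]
    by (subst integrable_completion) auto
  ultimately have "integrable lebesgue (\<lambda>x. \<phi> x * indicator K x)"
    by (rule integrable_real_mult_indicator)
  then show "integrable lebesgue (\<lambda>x. indicator K x *\<^sub>R \<phi> x)" by (simp add: mult.commute)
qed

lemma is_weak_deriv_test:
  assumes "\<phi> \<in> test_functions"
  shows "is_weak_deriv \<alpha> \<phi> (mi_pd \<alpha> \<phi>)"
  unfolding is_weak_deriv_def
proof (intro conjI ballI)
  show "locally_integrable \<phi>" "locally_integrable (mi_pd \<alpha> \<phi>)"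
    using assms by (auto intro: test_function_locally_integrable mi_pd_test)
  fix \<psi> :: "real ^ 'a \<Rightarrow> real" assume \<psi>: "\<psi> \<in> test_functions"
  obtain l where l: "\<And>i. count_list l i = \<alpha> $ i" using mi_list_ex by blast
  note m = test_functions_measurable[OF assms] test_functions_measurable[OF \<psi>]
    test_functions_measurable[OF test_functions_foldr_pd[OF \<psi>], of l]
    test_functions_measurable[OF test_functions_foldr_pd[OF assms], of l]
  have "(LINT x|lebesgue. \<phi> x * foldr pd l \<psi> x) = (\<integral>x. \<phi> x * foldr pd l \<psi> x \<partial>lborel)"
    by (rule integral_completion) (use m in auto)
  also have "\<dots> = (- 1) ^ length l * (\<integral>x. foldr pd l \<phi> x * \<psi> x \<partial>lborel)"
    by (rule integral_by_parts_foldr_pd[OF assms \<psi>])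
  also have "(\<integral>x. foldr pd l \<phi> x * \<psi> x \<partial>lborel) = (LINT x|lebesgue. foldr pd l \<phi> x * \<psi> x)"
    by (rule integral_completion[symmetric]) (use m in auto)
  finally show "(LINT x|lebesgue. \<phi> x * mi_pd \<alpha> \<psi> x) = (- 1) ^ mi_order \<alpha> * (LINT x|lebesgue. mi_pd \<alpha> \<phi> x * \<psi> x)"
    using mi_pd_eq[OF test_functions_smooth[OF assms] l] mi_pd_eq[OF test_functions_smooth[OF \<psi>] l] mi_order_length[OF l]
    by simp
qed

section \<open>Weak derivatives under dilations and translations\<close>

lemma lebesgue_eq_scaled:
  fixes y :: "'a::euclidean_space"
  assumes "a > 0"
  shows "lebesgue = density (distr lebesgue lebesgue (\<lambda>x. a *\<^sub>R (x - y))) (\<lambda>_. ennreal (a ^ DIM('a)))"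
    and "(\<lambda>x. a *\<^sub>R (x - y)) \<in> lebesgue \<rightarrow>\<^sub>M lebesgue"
proof -
  have "(\<lambda>x. - (a *\<^sub>R y) + (\<Sum>j\<in>Basis. (a * (x \<bullet> j)) *\<^sub>R j)) = (\<lambda>x. a *\<^sub>R (x - y))"
    unfolding scaleR_scaleR[symmetric] scaleR_sum_right[symmetric] euclidean_representation
    by (simp add: algebra_simps)
  then show "lebesgue = density (distr lebesgue lebesgue (\<lambda>x. a *\<^sub>R (x - y))) (\<lambda>_. ennreal (a ^ DIM('a)))"
    and "(\<lambda>x. a *\<^sub>R (x - y)) \<in> lebesgue \<rightarrow>\<^sub>M lebesgue"
    using lebesgue_affine_euclidean[of "\<lambda>_. a" "- (a *\<^sub>R y)"] lebesgue_affine_measurable[of "\<lambda>_. a" "- (a *\<^sub>R y)"] assms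
    by simp_all
qed

lemma measurable_lebesgue_scale:
  assumes "a > 0" "g \<in> borel_measurable lebesgue"
  shows "(\<lambda>x. g (a *\<^sub>R (x - y))) \<in> borel_measurable lebesgue"
  using measurable_compose[OF lebesgue_eq_scaled(2)[OF assms(1)] assms(2)] by simp

lemma integral_lebesgue_scale:
  fixes y :: "'a::euclidean_space" and g :: "'a \<Rightarrow> real"
  assumes a: "a > 0" and g: "g \<in> borel_measurable lebesgue"
  shows "(LINT x|lebesgue. g (a *\<^sub>R (x - y))) = (LINT x|lebesgue. g x) / a ^ DIM('a)"
    and "integrable lebesgue (\<lambda>x. g (a *\<^sub>R (x - y))) \<longleftrightarrow> integrable lebesgue g"
proof -
  note T = lebesgue_eq_scaled(2)[OF a, of y]
  have "(LINT x|lebesgue. g x) = (LINT x|density (distr lebesgue lebesgue (\<lambda>x. a *\<^sub>R (x - y))) (\<lambda>_. ennreal (a ^ DIM('a))). g x)"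
    by (subst lebesgue_eq_scaled(1)[OF a, of y]) simp
  also have "\<dots> = (LINT x|distr lebesgue lebesgue (\<lambda>x. a *\<^sub>R (x - y)). a ^ DIM('a) *\<^sub>R g x)"
    using a g by (intro integral_density) auto
  also have "\<dots> = (LINT x|lebesgue. a ^ DIM('a) *\<^sub>R g (a *\<^sub>R (x - y)))"
    using g by (intro integral_distr T) auto
  finally show "(LINT x|lebesgue. g (a *\<^sub>R (x - y))) = (LINT x|lebesgue. g x) / a ^ DIM('a)"
    using a by simp
  have "integrable lebesgue g \<longleftrightarrow> integrable (density (distr lebesgue lebesgue (\<lambda>x. a *\<^sub>R (x - y))) (\<lambda>_. ennreal (a ^ DIM('a)))) g"
    by (subst lebesgue_eq_scaled(1)[OF a, of y]) simp
  also have "\<dots> \<longleftrightarrow> integrable (distr lebesgue lebesgue (\<lambda>x. a *\<^sub>R (x - y))) (\<lambda>x. a ^ DIM('a) *\<^sub>R g x)"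
    using a g by (intro integrable_density) auto
  also have "\<dots> \<longleftrightarrow> integrable lebesgue (\<lambda>x. a ^ DIM('a) *\<^sub>R g (a *\<^sub>R (x - y)))"
    using g by (intro integrable_distr_eq T) auto
  finally show "integrable lebesgue (\<lambda>x. g (a *\<^sub>R (x - y))) \<longleftrightarrow> integrable lebesgue g"
    using a by simp
qed

lemma locally_integrable_scale:
  fixes v :: "real ^ 'n \<Rightarrow> real"
  assumes a: "a > 0" and v: "locally_integrable v"
  shows "locally_integrable (\<lambda>x. v (a *\<^sub>R (x - y)))"
  unfolding locally_integrable_def set_integrable_def
proof (intro allI impI)
  fix K :: "(real ^ 'n) set" assume "compact K"
  define K' where "K' = (\<lambda>x. a *\<^sub>R (x - y)) ` K"
  have "compact K'" unfolding K'_def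
    using \<open>compact K\<close> by (intro compact_continuous_image continuous_intros)
  then have "integrable lebesgue (\<lambda>x. indicator K' x *\<^sub>R v x)"
    using v by (simp add: locally_integrable_def set_integrable_def)
  then have "integrable lebesgue (\<lambda>x. indicator K' (a *\<^sub>R (x - y)) *\<^sub>R v (a *\<^sub>R (x - y)))"
    by (subst integral_lebesgue_scale(2)[OF a, of "\<lambda>x. indicator K' x *\<^sub>R v x"]) auto
  moreover have "indicator K' (a *\<^sub>R (x - y)) = (indicator K x :: real)" for x
    using a by (auto simp: K'_def indicator_def)
  ultimately show "integrable lebesgue (\<lambda>x. indicator K x *\<^sub>R v (a *\<^sub>R (x - y)))" by simp
qed

lemma is_weak_deriv_scale:
  fixes u :: "real ^ 'n \<Rightarrow> real"
  assumes uv: "is_weak_deriv \<alpha> u v" and a: "a > 0"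
  shows "is_weak_deriv \<alpha> (\<lambda>x. u (a *\<^sub>R (x - y))) (\<lambda>x. a ^ mi_order \<alpha> * v (a *\<^sub>R (x - y)))"
  unfolding is_weak_deriv_def
proof (intro conjI ballI locally_integrable_cmult)
  show "locally_integrable (\<lambda>x. u (a *\<^sub>R (x - y)))" "locally_integrable (\<lambda>x. v (a *\<^sub>R (x - y)))"
    using uv a by (auto simp: is_weak_deriv_def intro: locally_integrable_scale)
  fix \<phi> :: "real ^ 'n \<Rightarrow> real" assume \<phi>: "\<phi> \<in> test_functions"
  \<comment> \<open>The dilation is moved to the test function: \<psi> at a (x - y) is \<phi> at x,
    so a change of variables reduces both pairings to those of \<open>u\<close> and \<open>v\<close>
    with \<psi>. The factor 1 matches the form of \<open>test_functions_affine\<close>.\<close>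
  define \<psi> where "\<psi> x = 1 * \<phi> ((1 / a) *\<^sub>R x + y)" for x
  have \<psi>: "\<psi> \<in> test_functions"
    unfolding \<psi>_def[abs_def] using \<phi> a by (intro test_functions_affine) auto
  obtain l where l: "\<And>i. count_list l i = \<alpha> $ i" using mi_list_ex by blast
  have "foldr pd l \<psi> = (\<lambda>x. (1 / a) ^ length l * foldr pd l \<phi> ((1 / a) *\<^sub>R x + y))"
    using foldr_pd_affine[OF test_functions_smooth[OF \<phi>], of l 1 "1 / a" y] by (simp add: \<psi>_def[abs_def])
  then have mi: "mi_pd \<alpha> \<psi> x = (1 / a) ^ mi_order \<alpha> * mi_pd \<alpha> \<phi> ((1 / a) *\<^sub>R x + y)" for x
    using mi_pd_eq[OF test_functions_smooth[OF \<phi>] l] mi_pd_eq[OF test_functions_smooth[OF \<psi>] l] mi_order_length[OF l]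
    by simp
  have inv: "(1 / a) *\<^sub>R (a *\<^sub>R (x - y)) + y = x" for x using a by simp
  have \<psi>inv: "\<psi> (a *\<^sub>R (x - y)) = \<phi> x" for x unfolding \<psi>_def inv by simp
  have int: "integrable lebesgue (\<lambda>x. u x * mi_pd \<alpha> \<psi> x)" "integrable lebesgue (\<lambda>x. v x * \<psi> x)"
    using uv \<psi> by (auto simp: is_weak_deriv_def intro!: locally_integrable_mult_test mi_pd_test)
  have "(LINT x|lebesgue. u (a *\<^sub>R (x - y)) * mi_pd \<alpha> \<phi> x) =
      (LINT x|lebesgue. a ^ mi_order \<alpha> * (u (a *\<^sub>R (x - y)) * mi_pd \<alpha> \<psi> (a *\<^sub>R (x - y))))"
    using a unfolding mi inv by (intro Bochner_Integration.integral_cong refl) (simp add: power_one_over)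
  also have "\<dots> = a ^ mi_order \<alpha> * ((LINT x|lebesgue. u x * mi_pd \<alpha> \<psi> x) / a ^ CARD('n))"
    using integral_lebesgue_scale(1)[OF a borel_measurable_integrable[OF int(1)], of y] by simp
  also have "(LINT x|lebesgue. u x * mi_pd \<alpha> \<psi> x) = (- 1) ^ mi_order \<alpha> * (LINT x|lebesgue. v x * \<psi> x)"
    using uv \<psi> by (auto simp: is_weak_deriv_def)
  also have "a ^ mi_order \<alpha> * ((- 1) ^ mi_order \<alpha> * (LINT x|lebesgue. v x * \<psi> x) / a ^ CARD('n)) =
      (- 1) ^ mi_order \<alpha> * (a ^ mi_order \<alpha> * ((LINT x|lebesgue. v x * \<psi> x) / a ^ CARD('n)))"
    by simp
  also have "(LINT x|lebesgue. v x * \<psi> x) / a ^ CARD('n) = (LINT x|lebesgue. v (a *\<^sub>R (x - y)) * \<phi> x)"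
    using integral_lebesgue_scale(1)[OF a borel_measurable_integrable[OF int(2)], of y] by (simp add: \<psi>inv)
  also have "(a ^ mi_order \<alpha> * (LINT x|lebesgue. v (a *\<^sub>R (x - y)) * \<phi> x)) =
      (LINT x|lebesgue. a ^ mi_order \<alpha> * v (a *\<^sub>R (x - y)) * \<phi> x)"
    by (simp add: mult.assoc)
  finally show "(LINT x|lebesgue. u (a *\<^sub>R (x - y)) * mi_pd \<alpha> \<phi> x) =
    (- 1) ^ mi_order \<alpha> * (LINT x|lebesgue. a ^ mi_order \<alpha> * v (a *\<^sub>R (x - y)) * \<phi> x)" .
qed

subsection \<open>Lebesgue spaces\<close>

text \<open>Stands in for Minkowski's inequality below: the sum is at most twice the larger
  term.\<close>

lemma abs_add_powr_le:
  fixes a b :: real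
  assumes "0 \<le> q"
  shows "\<bar>a + b\<bar> powr q \<le> 2 powr q * (\<bar>a\<bar> powr q + \<bar>b\<bar> powr q)"
proof -
  have "\<bar>a + b\<bar> powr q \<le> (2 * max \<bar>a\<bar> \<bar>b\<bar>) powr q"
    using assms by (intro powr_mono2) auto
  also have "\<dots> = 2 powr q * max \<bar>a\<bar> \<bar>b\<bar> powr q" by (simp add: powr_mult)
  also have "max \<bar>a\<bar> \<bar>b\<bar> powr q \<le> \<bar>a\<bar> powr q + \<bar>b\<bar> powr q"
    by (auto simp: max_def)
  finally show ?thesis by simp
qed

definition Lq :: "real \<Rightarrow> ('a::euclidean_space \<Rightarrow> real) set" where
  "Lq q = {v. v \<in> borel_measurable lebesgue \<and> integrable lebesgue (\<lambda>x. \<bar>v x\<bar> powr q)}"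

lemma Lq_measurable: "v \<in> Lq q \<Longrightarrow> v \<in> borel_measurable lebesgue"
  and Lq_integrable: "v \<in> Lq q \<Longrightarrow> integrable lebesgue (\<lambda>x. \<bar>v x\<bar> powr q)"
  by (auto simp: Lq_def)

lemma LqI_bound:
  assumes "v \<in> borel_measurable lebesgue" "integrable lebesgue g" "\<And>x. \<bar>v x\<bar> powr q \<le> g x"
  shows "v \<in> Lq q"
proof -
  note [measurable] = assms(1)
  have "integrable lebesgue (\<lambda>x. \<bar>v x\<bar> powr q)"
    by (rule Bochner_Integration.integrable_bound[OF assms(2)])
      (auto intro!: AE_I2 order_trans[OF assms(3)])
  then show ?thesis using assms by (simp add: Lq_def)
qed

lemma Lq_add: "u \<in> Lq q \<Longrightarrow> v \<in> Lq q \<Longrightarrow> 0 \<le> q \<Longrightarrow> (\<lambda>x. u x + v x) \<in> Lq q"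
  by (rule LqI_bound[of _ "\<lambda>x. 2 powr q * (\<bar>u x\<bar> powr q + \<bar>v x\<bar> powr q)"])
    (auto simp: Lq_def intro!: abs_add_powr_le)

lemma Lq_cmult: "v \<in> Lq q \<Longrightarrow> (\<lambda>x. c * v x) \<in> Lq q"
  by (auto simp: Lq_def abs_mult powr_mult)

lemma Lq_zero: "(\<lambda>x. 0) \<in> Lq q"
  by (simp add: Lq_def)

lemma Lq_diff: "u \<in> Lq q \<Longrightarrow> v \<in> Lq q \<Longrightarrow> 0 \<le> q \<Longrightarrow> (\<lambda>x. u x - v x) \<in> Lq q"
  using Lq_add[of u q "\<lambda>x. (-1) * v x"] Lq_cmult[of v q "-1"] by simp

lemma Lq_sum: "finite A \<Longrightarrow> (\<And>l. l \<in> A \<Longrightarrow> v l \<in> Lq q) \<Longrightarrow> 0 \<le> q \<Longrightarrow> (\<lambda>x. \<Sum>l\<in>A. v l x) \<in> Lq q"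
  by (induction A rule: finite_induct) (auto intro: Lq_zero Lq_add)

lemma Lq_cong_AE:
  assumes "v \<in> Lq q" "AE x in lebesgue. u x = v x"
  shows "u \<in> Lq q"
proof -
  have u: "u \<in> borel_measurable lebesgue"
  proof (rule borel_measurable_AE[OF Lq_measurable[OF assms(1)]])
    show "AE x in lebesgue. v x = u x" using assms(2) by eventually_elim simp
  qed
  have "integrable lebesgue (\<lambda>x. \<bar>u x\<bar> powr q)"
  proof (rule integrable_cong_AE_imp[OF Lq_integrable[OF assms(1)]])
    show "(\<lambda>x. \<bar>u x\<bar> powr q) \<in> borel_measurable lebesgue" using u by measurable
    show "AE x in lebesgue. \<bar>v x\<bar> powr q = \<bar>u x\<bar> powr q" using assms(2) by eventually_elim simp
  qed
  with u show ?thesis by (simp add: Lq_def)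
qed

lemma Lq_iff_nn_integral:
  "v \<in> Lq q \<longleftrightarrow> v \<in> borel_measurable lebesgue \<and> (\<integral>\<^sup>+x. ennreal (\<bar>v x\<bar> powr q) \<partial>lebesgue) < \<infinity>"
  by (auto simp: Lq_def integrable_iff_bounded)

lemma nn_integral_Lq: "v \<in> Lq q \<Longrightarrow> (\<integral>\<^sup>+x. ennreal (\<bar>v x\<bar> powr q) \<partial>lebesgue) = ennreal (LINT x|lebesgue. \<bar>v x\<bar> powr q)"
  by (rule nn_integral_eq_integral) (auto simp: Lq_def)

lemma Lq_locally_integrable:
  fixes v :: "real ^ 'n \<Rightarrow> real"
  assumes v: "v \<in> Lq q" and q: "1 \<le> q"
  shows "locally_integrable v"
  unfolding locally_integrable_def set_integrable_def
proof (intro allI impI)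
  fix K :: "(real ^ 'n) set" assume K: "compact K"
  have Ks [measurable]: "K \<in> sets lebesgue" using K by (rule fmeasurableD[OF lmeasurable_compact])
  note [measurable] = Lq_measurable[OF v]
  show "integrable lebesgue (\<lambda>x. indicator K x *\<^sub>R v x)"
  proof (rule Bochner_Integration.integrable_bound)
    show "integrable lebesgue (\<lambda>x. indicator K x + \<bar>v x\<bar> powr q)"
      using lmeasurable_compact[OF K] Lq_integrable[OF v]
      by (intro Bochner_Integration.integrable_add integrable_real_indicator) (auto simp: fmeasurable_def)
    \<comment> \<open>Replaces Hoelder's inequality on \<open>K\<close>: the constant 1 is
      integrable over the compact set.\<close>
    have "\<bar>t\<bar> \<le> 1 + \<bar>t\<bar> powr q" for t :: real
    proof (cases "\<bar>t\<bar> \<le> 1")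
      case False
      then have "\<bar>t\<bar> powr 1 \<le> \<bar>t\<bar> powr q" using q by (intro powr_mono) auto
      then show ?thesis using False by simp
    qed (simp add: add_increasing2)
    then show "AE x in lebesgue. norm (indicator K x *\<^sub>R v x) \<le> norm (indicator K x + \<bar>v x\<bar> powr q)"
      by (intro AE_I2) (auto simp: indicator_def)
  qed measurable
qed

lemma test_functions_Lq: "\<phi> \<in> test_functions \<Longrightarrow> 0 < q \<Longrightarrow> \<phi> \<in> Lq q"
  using test_functions_integrable_powr[of \<phi> q] test_functions_measurable[of \<phi>]
  by (auto simp: Lq_def integrable_completion measurable_completion)

text \<open>Lets the identity that defines a weak derivative pass to an L^q limit; a test function
  lies in the dual exponent, so Hoelder's inequality bounds the error.\<close>

lemma Lq_pairing_tendsto: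
  fixes f :: "nat \<Rightarrow> real ^ 'n \<Rightarrow> real"
  assumes q: "1 < q" and f: "\<And>i. f i \<in> Lq q" and g: "g \<in> Lq q"
    and lim: "(\<lambda>i. LINT x|lebesgue. \<bar>f i x - g x\<bar> powr q) \<longlonglongrightarrow> 0" and \<psi>: "\<psi> \<in> test_functions"
  shows "(\<lambda>i. LINT x|lebesgue. f i x * \<psi> x) \<longlonglongrightarrow> (LINT x|lebesgue. g x * \<psi> x)"
proof -
  define q' where "q' = q / (q - 1)"
  have q': "1 < q'" "1 / q + 1 / q' = 1" using q by (auto simp: q'_def field_simps)
  have \<psi>q: "\<psi> \<in> Lq q'" using \<psi> q' by (intro test_functions_Lq) auto
  have d: "(\<lambda>x. f i x - g x) \<in> Lq q" for i using f g q by (intro Lq_diff) auto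
  note H = Holder_integral[OF q q'(1) q'(2) Lq_measurable Lq_measurable[OF \<psi>q] Lq_integrable Lq_integrable[OF \<psi>q]]
  let ?b = "\<lambda>i. (LINT x|lebesgue. \<bar>f i x - g x\<bar> powr q) powr (1 / q) * (LINT x|lebesgue. \<bar>\<psi> x\<bar> powr q') powr (1 / q')"
  have "((\<lambda>i. ?b i) \<longlonglongrightarrow> 0 powr (1 / q) * (LINT x|lebesgue. \<bar>\<psi> x\<bar> powr q') powr (1 / q'))"
    using q by (intro tendsto_mult tendsto_const tendsto_powr2 lim) (auto intro!: always_eventually)
  then have b: "?b \<longlonglongrightarrow> 0" by simp
  have "(\<lambda>i. (LINT x|lebesgue. f i x * \<psi> x) - (LINT x|lebesgue. g x * \<psi> x)) \<longlonglongrightarrow> 0"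
  proof (rule Lim_null_comparison[OF _ b], intro always_eventually allI)
    fix i
    have "(LINT x|lebesgue. f i x * \<psi> x) - (LINT x|lebesgue. g x * \<psi> x) = (LINT x|lebesgue. (f i x - g x) * \<psi> x)"
      using H(1)[OF f f, of i] H(1)[OF g g] by (simp add: left_diff_distrib)
    also have "norm \<dots> \<le> (LINT x|lebesgue. \<bar>(f i x - g x) * \<psi> x\<bar>)"
      using integral_norm_bound[of lebesgue "\<lambda>x. (f i x - g x) * \<psi> x"] by simp
    also have "\<dots> \<le> ?b i" by (rule H(2)[OF d d])
    finally show "norm ((LINT x|lebesgue. f i x * \<psi> x) - (LINT x|lebesgue. g x * \<psi> x)) \<le> ?b i" .
  qed
  then show ?thesis by (simp add: LIM_zero_iff)
qed

text \<open>The weight \<open>2 powr (k * q)\<close> forces geometric decay of the increments along the subsequence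
  almost everywhere, which makes Minkowski's inequality unnecessary.\<close>

lemma Lq_complete:
  fixes f :: "nat \<Rightarrow> 'a \<Rightarrow> real"
  assumes q: "0 < q" and [measurable]: "\<And>i. f i \<in> borel_measurable M"
    and cauchy: "\<And>\<epsilon>::real. 0 < \<epsilon> \<Longrightarrow> \<exists>K. \<forall>i\<ge>K. \<forall>k\<ge>K. (\<integral>\<^sup>+x. ennreal (\<bar>f i x - f k x\<bar> powr q) \<partial>M) \<le> ennreal \<epsilon>"
  shows "\<exists>v\<in>borel_measurable M. \<forall>\<epsilon>>0. \<exists>K. \<forall>i\<ge>K. (\<integral>\<^sup>+x. ennreal (\<bar>f i x - v x\<bar> powr q) \<partial>M) \<le> ennreal \<epsilon>"
proof -
  \<comment> \<open>Chosen so that the weight 2^{kq} times the tolerance is 2^{-k}, a summable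
    bound.\<close>
  define e where "e k = (1 / 2) ^ k * 2 powr (- real k * q)" for k :: nat
  have "\<forall>k. \<exists>K. \<forall>i\<ge>K. \<forall>i'\<ge>K. (\<integral>\<^sup>+x. ennreal (\<bar>f i x - f i' x\<bar> powr q) \<partial>M) \<le> ennreal (e k)"
    by (intro allI cauchy) (simp add: e_def)
  then obtain K where K: "\<And>k i i'. K k \<le> i \<Longrightarrow> K k \<le> i' \<Longrightarrow>
      (\<integral>\<^sup>+x. ennreal (\<bar>f i x - f i' x\<bar> powr q) \<partial>M) \<le> ennreal (e k)" by metis
  \<comment> \<open>Summing all earlier thresholds makes the index sequence monotone; adding k makes
    it unbounded.\<close>
  define s where "s k = k + (\<Sum>j\<le>k. K j)" for k
  have sK: "K k \<le> s k" for k
    using member_le_sum[of k "{..k}" K] by (simp add: s_def)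
  have s_Suc: "s k \<le> s (Suc k)" for k by (simp add: s_def)
  have s_ge: "k \<le> s k" for k by (simp add: s_def)
  define d where "d k x = f (s (Suc k)) x - f (s k) x" for k x
  have [measurable]: "d k \<in> borel_measurable M" for k unfolding d_def[abs_def] by measurable
  have "(\<integral>\<^sup>+x. (\<Sum>k. ennreal (2 powr (real k * q) * \<bar>d k x\<bar> powr q)) \<partial>M) =
      (\<Sum>k. \<integral>\<^sup>+x. ennreal (2 powr (real k * q) * \<bar>d k x\<bar> powr q) \<partial>M)"
    by (rule nn_integral_suminf) measurable
  also have "\<dots> \<le> (\<Sum>k. ennreal ((1 / 2) ^ k))"
  proof (rule suminf_le)
    fix k
    have "(\<integral>\<^sup>+x. ennreal (2 powr (real k * q) * \<bar>d k x\<bar> powr q) \<partial>M) =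
        ennreal (2 powr (real k * q)) * (\<integral>\<^sup>+x. ennreal (\<bar>d k x\<bar> powr q) \<partial>M)"
      by (simp add: ennreal_mult nn_integral_cmult)
    also have "\<dots> \<le> ennreal (2 powr (real k * q)) * ennreal (e k)"
      unfolding d_def using sK[of k] s_Suc[of k] by (intro mult_left_mono K) auto
    also have "\<dots> = ennreal ((1 / 2) ^ k)"
      by (simp add: e_def ennreal_mult[symmetric] powr_minus)
    finally show "(\<integral>\<^sup>+x. ennreal (2 powr (real k * q) * \<bar>d k x\<bar> powr q) \<partial>M) \<le> ennreal ((1 / 2) ^ k)" .
  qed auto
  also have "\<dots> = ennreal (\<Sum>k. (1 / 2) ^ k)"
    by (rule suminf_ennreal2) auto
  also have "\<dots> < \<infinity>" by simp
  finally have "AE x in M. (\<Sum>k. ennreal (2 powr (real k * q) * \<bar>d k x\<bar> powr q)) \<noteq> \<infinity>"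
    by (intro nn_integral_PInf_AE) auto
  then have conv: "AE x in M. convergent (\<lambda>k. f (s k) x)"
  proof eventually_elim
    fix x assume fin: "(\<Sum>k. ennreal (2 powr (real k * q) * \<bar>d k x\<bar> powr q)) \<noteq> \<infinity>"
    define S where "S = enn2real (\<Sum>k. ennreal (2 powr (real k * q) * \<bar>d k x\<bar> powr q))"
    have S: "ennreal S = (\<Sum>k. ennreal (2 powr (real k * q) * \<bar>d k x\<bar> powr q))"
      using fin by (simp add: S_def less_top)
    \<comment> \<open>A single term of the series is at most its sum S; taking the q-th root turns
      the weight into the factor 2^{-k}.\<close>
    have "\<bar>d k x\<bar> \<le> S powr (1 / q) * (1 / 2) ^ k" for k
    proof -
      have "ennreal (2 powr (real k * q) * \<bar>d k x\<bar> powr q) \<le> ennreal S"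
        unfolding S using sum_le_suminf[OF summableI, of "{k}" "\<lambda>k. ennreal (2 powr (real k * q) * \<bar>d k x\<bar> powr q)"]
        by (simp only: sum.insert finite.intros sum.empty add_0_right not_False_eq_True empty_iff zero_le simp_thms)
      then have "2 powr (real k * q) * \<bar>d k x\<bar> powr q \<le> S"
        by (subst (asm) ennreal_le_iff) (simp_all add: S_def)
      then have "(2 powr (real k * q) * \<bar>d k x\<bar> powr q) powr (1 / q) \<le> S powr (1 / q)"
        using q by (intro powr_mono2) auto
      then have "2 powr real k * \<bar>d k x\<bar> \<le> S powr (1 / q)"
        using q by (simp add: powr_mult powr_powr)
      then show ?thesis by (simp add: powr_realpow power_one_over field_simps)
    qed
    then have "summable (\<lambda>k. d k x)"
      by (intro summable_comparison_test[of "\<lambda>k. d k x" "\<lambda>k. S powr (1 / q) * (1 / 2) ^ k"] summable_mult) auto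
    then have "convergent (\<lambda>n. \<Sum>k<n. d k x)" by (simp add: summable_iff_convergent)
    then have "convergent (\<lambda>n. (\<Sum>k<n. d k x) + f (s 0) x)" by (intro convergent_add convergent_const)
    moreover have "(\<Sum>k<n. d k x) + f (s 0) x = f (s n) x" for n
      by (induction n) (simp_all add: d_def)
    ultimately show "convergent (\<lambda>k. f (s k) x)" by simp
  qed
  define v where "v x = lim (\<lambda>k. f (s k) x)" for x
  have v [measurable]: "v \<in> borel_measurable M"
    unfolding v_def[abs_def] by (rule borel_measurable_lim_metric) measurable
  have "\<exists>K. \<forall>i\<ge>K. (\<integral>\<^sup>+x. ennreal (\<bar>f i x - v x\<bar> powr q) \<partial>M) \<le> ennreal \<epsilon>" if eps: "\<epsilon> > 0" for \<epsilon> :: real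
  proof -
    \<comment> \<open>Fatou's lemma along the subsequence gives the limit \<open>v\<close> the
      Cauchy bound of the full sequence.\<close>
    obtain K where K: "\<And>i k. K \<le> i \<Longrightarrow> K \<le> k \<Longrightarrow> (\<integral>\<^sup>+x. ennreal (\<bar>f i x - f k x\<bar> powr q) \<partial>M) \<le> ennreal \<epsilon>"
      using cauchy[OF eps] by blast
    show ?thesis
    proof (intro exI allI impI)
      fix i assume i: "K \<le> i"
      have "(\<integral>\<^sup>+x. ennreal (\<bar>f i x - v x\<bar> powr q) \<partial>M) =
          (\<integral>\<^sup>+x. liminf (\<lambda>k. ennreal (\<bar>f i x - f (s k) x\<bar> powr q)) \<partial>M)"
        using conv
      proof (intro nn_integral_cong_AE, eventually_elim)
        fix x assume "convergent (\<lambda>k. f (s k) x)"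
        then have "(\<lambda>k. f (s k) x) \<longlonglongrightarrow> v x" by (simp add: v_def convergent_LIMSEQ_iff)
        then have "(\<lambda>k. ennreal (\<bar>f i x - f (s k) x\<bar> powr q)) \<longlonglongrightarrow> ennreal (\<bar>f i x - v x\<bar> powr q)"
          using q by (intro tendsto_ennrealI tendsto_powr2 tendsto_intros) (auto intro!: always_eventually)
        then show "ennreal (\<bar>f i x - v x\<bar> powr q) = liminf (\<lambda>k. ennreal (\<bar>f i x - f (s k) x\<bar> powr q))"
          by (rule lim_imp_Liminf[OF trivial_limit_sequentially, symmetric])
      qed
      also have "\<dots> \<le> liminf (\<lambda>k. \<integral>\<^sup>+x. ennreal (\<bar>f i x - f (s k) x\<bar> powr q) \<partial>M)"
        by (rule nn_integral_liminf) measurable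
      also have "\<dots> \<le> liminf (\<lambda>k. ennreal \<epsilon>)"
        using eventually_ge_at_top[of K]
        by (intro Liminf_mono, eventually_elim) (use K i s_ge in \<open>meson order_trans\<close>)
      also have "\<dots> = ennreal \<epsilon>" by (simp add: Liminf_const)
      finally show "(\<integral>\<^sup>+x. ennreal (\<bar>f i x - v x\<bar> powr q) \<partial>M) \<le> ennreal \<epsilon>" .
    qed
  qed
  with v show ?thesis by blast
qed

subsection \<open>Sobolev embedding\<close>

lemma epow_epow_inverse: "r \<noteq> 0 \<Longrightarrow> epow (epow a (1 / r)) r = a"
  by (cases a) (auto simp: epow_def powr_powr)

lemma ennreal_tendsto_0_iff_real:
  fixes f :: "'a \<Rightarrow> ennreal"
  shows "(f \<longlongrightarrow> 0) F \<longleftrightarrow> (\<forall>\<epsilon>::real>0. eventually (\<lambda>x. f x \<le> ennreal \<epsilon>) F)"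
proof
  assume *: "(f \<longlongrightarrow> 0) F"
  show "\<forall>\<epsilon>::real>0. eventually (\<lambda>x. f x \<le> ennreal \<epsilon>) F"
  proof (intro allI impI)
    fix \<epsilon> :: real assume "0 < \<epsilon>"
    then have "eventually (\<lambda>x. f x < ennreal \<epsilon>) F"
      using order_tendstoD(2)[OF *, of "ennreal \<epsilon>"] by simp
    then show "eventually (\<lambda>x. f x \<le> ennreal \<epsilon>) F" by eventually_elim simp
  qed
next
  assume *: "\<forall>\<epsilon>::real>0. eventually (\<lambda>x. f x \<le> ennreal \<epsilon>) F"
  show "(f \<longlongrightarrow> 0) F"
  proof (rule order_tendstoI)
    fix a :: ennreal assume "0 < a"
    then obtain b where b: "0 < b" "b < a" using dense by blast
    then obtain c where c: "b = ennreal c" "c > 0"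
      by (cases b) (auto simp: ennreal_zero_less_top)
    have "eventually (\<lambda>x. f x \<le> ennreal c) F" using * c by blast
    then show "eventually (\<lambda>x. f x < a) F" by eventually_elim (use b c in auto)
  qed simp
qed

lemma epow_tendsto_0:
  assumes "(f \<longlongrightarrow> 0) F" "r > 0"
  shows "((\<lambda>x. epow (f x) r) \<longlongrightarrow> 0) F"
  unfolding ennreal_tendsto_0_iff_real
proof (intro allI impI)
  fix \<epsilon> :: real assume \<epsilon>: "0 < \<epsilon>"
  then have "eventually (\<lambda>x. f x \<le> ennreal (\<epsilon> powr (1 / r))) F"
    using assms(1)[unfolded ennreal_tendsto_0_iff_real] by simp
  then show "eventually (\<lambda>x. epow (f x) r \<le> ennreal \<epsilon>) F"
  proof eventually_elim
    fix x assume "f x \<le> ennreal (\<epsilon> powr (1 / r))"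
    then have "epow (f x) r \<le> epow (ennreal (\<epsilon> powr (1 / r))) r" using assms(2) by (intro epow_mono) auto
    also have "\<dots> = ennreal \<epsilon>" using assms(2) \<epsilon> by (simp add: epow_ennreal powr_powr)
    finally show "epow (f x) r \<le> ennreal \<epsilon>" .
  qed
qed

lemma epow_Lp_norm: "p \<noteq> 0 \<Longrightarrow> epow (Lp_norm p UNIV f) p = (\<integral>\<^sup>+x. ennreal (\<bar>f x\<bar> powr p) \<partial>lebesgue)"
  by (simp add: Lp_norm_def epow_epow_inverse)

text \<open>A sum over an infinite set is 0 in HOL, so it is finiteness that lets
  \<open>W_norm\<close> dominate each of its summands.\<close>

lemma finite_mi_order: "finite {\<alpha> :: nat ^ 'n. mi_order \<alpha> = m}"
proof (rule finite_subset)
  show "{\<alpha> :: nat ^ 'n. mi_order \<alpha> = m} \<subseteq> (\<lambda>l. \<chi> i. count_list l i) ` {l. set l \<subseteq> UNIV \<and> length l = m}"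
  proof
    fix \<alpha> :: "nat ^ 'n" assume "\<alpha> \<in> {\<alpha>. mi_order \<alpha> = m}"
    moreover obtain l where l: "\<And>i. count_list l i = \<alpha> $ i" using mi_list_ex by blast
    ultimately have "length l = m" using mi_order_length[OF l] by simp
    moreover have "\<alpha> = (\<chi> i. count_list l i)" using l by (simp add: vec_eq_iff)
    ultimately show "\<alpha> \<in> (\<lambda>l. \<chi> i. count_list l i) ` {l. set l \<subseteq> UNIV \<and> length l = m}" by blast
  qed
  show "finite ((\<lambda>l. \<chi> i. count_list l i) ` {l :: 'n list. set l \<subseteq> UNIV \<and> length l = m})"
    by (intro finite_imageI finite_lists_length_eq) simp
qed

lemma nn_integral_wderiv_le_W_norm:
  fixes u :: "real ^ 'n \<Rightarrow> real"
  assumes "p \<noteq> 0"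
  shows "(\<integral>\<^sup>+x. ennreal (\<bar>wderiv \<alpha> u x\<bar> powr p) \<partial>lebesgue) \<le> epow (W_norm (mi_order \<alpha>) p UNIV u) p"
proof -
  have "epow (W_norm (mi_order \<alpha>) p UNIV u) p =
      (\<Sum>\<beta>\<in>{\<beta>. mi_order \<beta> = mi_order \<alpha>}. \<integral>\<^sup>+x. ennreal (\<bar>wderiv \<beta> u x\<bar> powr p) \<partial>lebesgue)"
    using assms by (simp add: W_norm_def epow_epow_inverse epow_Lp_norm)
  also have "\<dots> \<ge> (\<integral>\<^sup>+x. ennreal (\<bar>wderiv \<alpha> u x\<bar> powr p) \<partial>lebesgue)"
    by (rule member_le_sum) (auto simp: finite_mi_order)
  finally show ?thesis .
qed

text \<open>The norm is defined by multi-indices and weak derivatives, whereas the induction on the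
  order uses lists and classical ones. This is the passage between them.\<close>

lemma integral_foldr_pd_le_W_norm:
  fixes \<phi> :: "real ^ 'n \<Rightarrow> real"
  assumes \<phi>: "\<phi> \<in> test_functions" and p: "p > 0"
  shows "ennreal (\<integral>x. \<bar>foldr pd l \<phi> x\<bar> powr p \<partial>lborel) \<le> epow (W_norm (length l) p UNIV \<phi>) p"
proof -
  define \<alpha> where "\<alpha> = (\<chi> i. count_list l i)"
  have l: "count_list l i = \<alpha> $ i" for i by (simp add: \<alpha>_def)
  have "AE x in lebesgue. wderiv \<alpha> \<phi> x = foldr pd l \<phi> x"
    using wderiv_AE_eq[OF is_weak_deriv_test[OF \<phi>, of \<alpha>]] mi_pd_eq[OF test_functions_smooth[OF \<phi>] l] by simp
  then have "(\<integral>\<^sup>+x. ennreal (\<bar>wderiv \<alpha> \<phi> x\<bar> powr p) \<partial>lebesgue) = (\<integral>\<^sup>+x. ennreal (\<bar>foldr pd l \<phi> x\<bar> powr p) \<partial>lebesgue)"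
    by (intro nn_integral_cong_AE) (auto elim!: eventually_mono)
  also have "\<dots> = (\<integral>\<^sup>+x. ennreal (\<bar>foldr pd l \<phi> x\<bar> powr p) \<partial>lborel)"
    by (rule nn_integral_completion)
  also have "\<dots> = ennreal (\<integral>x. \<bar>foldr pd l \<phi> x\<bar> powr p \<partial>lborel)"
    by (intro nn_integral_eq_integral test_functions_integrable_powr test_functions_foldr_pd \<phi> p) auto
  finally show ?thesis
    using nn_integral_wderiv_le_W_norm[of p \<alpha> \<phi>] p mi_order_length[OF l] by simp
qed

lemma sobolev_test:
  fixes \<phi> :: "real ^ 'n \<Rightarrow> real"
  assumes \<phi>: "\<phi> \<in> test_functions" and p: "1 < p" "p < real CARD('n)"
    and B: "\<And>i. (\<integral>x. \<bar>pd i \<phi> x\<bar> powr p \<partial>lborel) \<le> B"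
  defines "N \<equiv> real CARD('n)"
  shows "(\<integral>x. \<bar>\<phi> x\<bar> powr (p * N / (N - p)) \<partial>lborel) \<le>
    (p * (N - 1) / (N - p)) powr (p * N / (N - p)) * B powr (N / (N - p))"
proof -
  define ix :: "real ^ 'n \<Rightarrow> 'n" where "ix b = (SOME i. b = axis i 1)" for b
  have ix: "b = axis (ix b) 1" if "b \<in> Basis" for b
  proof -
    have "\<exists>i. b = axis i 1" using that by (auto simp: Basis_vec_def)
    then show ?thesis unfolding ix_def by (rule someI_ex)
  qed
  obtain R0 where R0: "R0 > 0" "\<And>x. R0 \<le> norm x \<Longrightarrow> \<phi> x = 0"
    using test_functions_bounded_support[OF \<phi>] by blast
  have "\<forall>i. \<exists>R>0. \<forall>x. R \<le> norm x \<longrightarrow> pd i \<phi> x = 0"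
  proof
    fix i
    show "\<exists>R>0. \<forall>x. R \<le> norm x \<longrightarrow> pd i \<phi> x = 0"
      using test_functions_bounded_support[OF test_functions_pd[OF \<phi>, of i]] by blast
  qed
  then obtain R1 where R1: "\<And>i. R1 i > 0" "\<And>i x. R1 i \<le> norm x \<Longrightarrow> pd i \<phi> x = 0" by metis
  \<comment> \<open>A common radius for \<phi> and all its partial derivatives; a sum of positive
    radii bounds each of them.\<close>
  define R where "R = R0 + (\<Sum>i\<in>UNIV. R1 i)"
  have R: "R0 \<le> R" "R1 i \<le> R" for i
    using R0 R1(1) member_le_sum[of i UNIV R1] by (auto simp: R_def less_imp_le sum_nonneg)
  have "(\<integral>x. \<bar>\<phi> x\<bar> powr (p * real DIM(real ^ 'n) / (real DIM(real ^ 'n) - p)) \<partial>lborel) \<le>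
    (p * (real DIM(real ^ 'n) - 1) / (real DIM(real ^ 'n) - p)) powr (p * real DIM(real ^ 'n) / (real DIM(real ^ 'n) - p)) *
      B powr (real DIM(real ^ 'n) / (real DIM(real ^ 'n) - p))"
  proof (rule sobolev_bound[where R=R and d="\<lambda>b. pd (ix b) \<phi>"])
    show "continuous_on UNIV \<phi>" "\<And>b. continuous_on UNIV (pd (ix b) \<phi>)"
      using \<phi> by (auto intro: test_functions_continuous test_functions_pd)
    show "\<phi> x = 0" if "R \<le> norm x" for x using R0(2)[of x] R(1) that by simp
    show "pd (ix b) \<phi> x = 0" if "R \<le> norm x" for b x using R1(2)[of "ix b" x] R(2)[of "ix b"] that by simp
    show "((\<lambda>t. \<phi> (x + t *\<^sub>R b)) has_real_derivative pd (ix b) \<phi> x) (at 0)" if "b \<in> Basis" for b x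
      using smooth_has_pd[OF test_functions_smooth[OF \<phi>], of x "ix b" 0] ix[OF that] by simp
  qed (use p B in auto)
  then show ?thesis by (simp add: N_def)
qed

section \<open>Critical exponents and the iteration of Sobolev's inequality\<close>

lemma crit_0: "crit TYPE('n::finite) p 0 = p"
  by (simp add: crit_def)

text \<open>The first-order Sobolev exponent of p^*_s is p^*_{s+1}, so each application of the
  inequality trades exactly one derivative. The bound by N makes the next application
  admissible.\<close>

lemma crit_Suc:
  assumes "1 < p" "real (Suc s) * p < real CARD('n::finite)"
  defines "N \<equiv> real CARD('n)"
  shows "crit TYPE('n) p (Suc s) = crit TYPE('n) p s * N / (N - crit TYPE('n) p s)"
    and "crit TYPE('n) p s < N"
proof -
  have a: "N - s * p > p" "N > 0" using assms by (auto simp: algebra_simps)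
  then have "N - s * p > 0" using assms(1) by linarith
  have "p * N < N * (N - s * p)" using a by simp
  with \<open>N - s * p > 0\<close> show "crit TYPE('n) p s < N"
    by (simp add: crit_def N_def[symmetric] divide_less_eq)
  have "N - p * N / (N - s * p) = N * (N - (1 + real s) * p) / (N - s * p)"
    using \<open>N - s * p > 0\<close> by (simp add: field_simps)
  then show "crit TYPE('n) p (Suc s) = crit TYPE('n) p s * N / (N - crit TYPE('n) p s)"
    using a \<open>N - s * p > 0\<close> by (simp add: crit_def N_def[symmetric])
qed

lemma crit_ge:
  assumes "0 < p" "real s * p < real CARD('n::finite)"
  shows "p \<le> crit TYPE('n) p s"
  using assms by (simp add: crit_def pos_le_divide_eq algebra_simps)

text \<open>Stated with \<epsilon> and \<delta> because it only has to transfer the Cauchy property;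
  the Sobolev constants of the m steps then need not be tracked.\<close>

lemma sobolev_iterated:
  assumes p: "1 < p" and m: "real m * p < real CARD('n::finite)"
  shows "s \<le> m \<Longrightarrow> 0 < \<epsilon> \<Longrightarrow> \<exists>\<delta>>0. \<forall>\<phi>\<in>test_functions :: (real ^ 'n \<Rightarrow> real) set.
    (\<forall>l. length l = m \<longrightarrow> (\<integral>x. \<bar>foldr pd l \<phi> x\<bar> powr p \<partial>lborel) \<le> \<delta>) \<longrightarrow>
    (\<forall>l. length l = m - s \<longrightarrow> (\<integral>x. \<bar>foldr pd l \<phi> x\<bar> powr crit TYPE('n) p s \<partial>lborel) \<le> \<epsilon>)"
proof (induction s arbitrary: \<epsilon>)
  case 0
  then show ?case by (intro exI[of _ \<epsilon>]) (simp add: crit_0)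
next
  case (Suc s)
  define N P where "N = real CARD('n)" and "P = crit TYPE('n) p s"
  have "real (Suc s) * p \<le> real m * p" using Suc.prems p by (intro mult_right_mono) auto
  then have sN: "real (Suc s) * p < real CARD('n)" using m by simp
  then have "real s * p < real CARD('n)" using p by (simp add: distrib_right)
  then have P: "1 < P" "P < N" "crit TYPE('n) p (Suc s) = P * N / (N - P)"
    using crit_Suc[OF p sN] crit_ge[of p s, where 'n='n] p by (auto simp: P_def N_def)
  define K where "K = (P * (N - 1) / (N - P)) powr (P * N / (N - P))"
  define r where "r = N / (N - P)"
  have r: "r > 0" using P by (simp add: r_def)
  have K: "K \<ge> 0" by (simp add: K_def)
  \<comment> \<open>Solves (K + 1) \<eta>^r = \<epsilon>; the added 1 keeps the quotient meaningful
    when K = 0.\<close>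
  define \<eta> where "\<eta> = (\<epsilon> / (K + 1)) powr (1 / r)"
  have \<eta>: "\<eta> > 0" using Suc.prems K by (simp add: \<eta>_def)
  have K\<eta>: "K * \<eta> powr r \<le> \<epsilon>"
  proof -
    have "(K + 1) * \<eta> powr r = \<epsilon>" using r Suc.prems K by (simp add: \<eta>_def powr_powr)
    then show ?thesis using powr_ge_zero[of \<eta> r] by (simp only: distrib_right)
  qed
  obtain \<delta> where \<delta>: "\<delta> > 0" and D: "\<And>\<phi> :: real ^ 'n \<Rightarrow> real. \<phi> \<in> test_functions \<Longrightarrow>
    (\<forall>l. length l = m \<longrightarrow> (\<integral>x. \<bar>foldr pd l \<phi> x\<bar> powr p \<partial>lborel) \<le> \<delta>) \<Longrightarrow>
    (\<forall>l. length l = m - s \<longrightarrow> (\<integral>x. \<bar>foldr pd l \<phi> x\<bar> powr P \<partial>lborel) \<le> \<eta>)"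
    using Suc.IH[of \<eta>] Suc.prems \<eta> unfolding P_def by (meson Suc_leD)
  have "(\<integral>x. \<bar>foldr pd l \<phi> x\<bar> powr crit TYPE('n) p (Suc s) \<partial>lborel) \<le> \<epsilon>"
    if \<phi>: "\<phi> \<in> test_functions" and le: "\<forall>l. length l = m \<longrightarrow> (\<integral>x. \<bar>foldr pd l \<phi> x\<bar> powr p \<partial>lborel) \<le> \<delta>"
      and l: "length l = m - Suc s" for \<phi> :: "real ^ 'n \<Rightarrow> real" and l
  proof -
    \<comment> \<open>The functions \<open>foldr pd l \<phi>\<close> have one derivative fewer, so
      their first partial derivatives are those controlled by the induction hypothesis.\<close>
    have "(\<integral>x. \<bar>pd i (foldr pd l \<phi>) x\<bar> powr P \<partial>lborel) \<le> \<eta>" for i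
      using D[OF \<phi> le, rule_format, of "i # l"] l Suc.prems(1) by simp
    from sobolev_test[OF test_functions_foldr_pd[OF \<phi>] P(1) P(2)[unfolded N_def] this]
    have "(\<integral>x. \<bar>foldr pd l \<phi> x\<bar> powr (P * N / (N - P)) \<partial>lborel) \<le> K * \<eta> powr r"
      by (simp add: K_def r_def N_def)
    then show ?thesis using K\<eta> P(3) by simp
  qed
  with \<delta> show ?case by blast
qed

text \<open>The approximating test functions converge to \<open>u\<close> in L^{p^*_m}, and their
  derivatives of order \<alpha> are Cauchy in L^q. Passing to the limit on both sides of the
  integration by parts identifies the limit of the derivatives as the weak derivative.\<close>

theorem Wdot_weak_deriv:
  fixes u :: "real ^ 'n \<Rightarrow> real"
  assumes p: "1 < p" and m: "1 \<le> m" "p < real CARD('n) / real m"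
    and u: "u \<in> Wdot m p" and \<alpha>: "mi_order \<alpha> < m"
  defines "q \<equiv> crit TYPE('n) p (m - mi_order \<alpha>)"
  shows "is_weak_deriv \<alpha> u (wderiv \<alpha> u)" and "wderiv \<alpha> u \<in> Lq q"
proof -
  have mN: "real m * p < real CARD('n)" using m p by (simp add: field_simps)
  define s where "s = m - mi_order \<alpha>"
  have s: "s \<le> m" "m - s = mi_order \<alpha>" using \<alpha> by (auto simp: s_def)
  have sp: "real s * p \<le> real m * p" using s p by (intro mult_right_mono) auto
  have "p \<le> q" unfolding q_def s_def[symmetric] using p by (intro crit_ge le_less_trans[OF sp mN]) auto
  then have q: "1 < q" using p by simp
  define Q where "Q = crit TYPE('n) p m"
  have Q: "1 < Q" using crit_ge[of p m, where 'n='n] p mN by (auto simp: Q_def)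
  obtain \<phi> where \<phi>: "\<And>i. \<phi> i \<in> test_functions"
    and cau: "\<And>\<epsilon>. \<epsilon> > 0 \<Longrightarrow> \<exists>K. \<forall>i\<ge>K. \<forall>k\<ge>K. W_norm m p UNIV (\<lambda>x. \<phi> i x - \<phi> k x) < \<epsilon>"
    and lim: "(\<lambda>i. Lp_norm Q UNIV (\<lambda>x. \<phi> i x - u x)) \<longlonglongrightarrow> 0" and um: "u \<in> borel_measurable lebesgue"
    using u unfolding Wdot_def Q_def by blast
  obtain l where l: "\<And>i. count_list l i = \<alpha> $ i" using mi_list_ex by blast
  have len: "length l = m - s" using mi_order_length[OF l] s by simp
  have mi: "mi_pd \<alpha> (\<phi> i) = foldr pd l (\<phi> i)" for i
    by (rule mi_pd_eq[OF test_functions_smooth[OF \<phi>] l])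
  have \<phi>q: "foldr pd l (\<phi> i) \<in> Lq q" for i
    using q by (intro test_functions_Lq test_functions_foldr_pd \<phi>) auto
  have cauchy: "\<exists>K. \<forall>i\<ge>K. \<forall>k\<ge>K.
      (\<integral>\<^sup>+x. ennreal (\<bar>foldr pd l (\<phi> i) x - foldr pd l (\<phi> k) x\<bar> powr q) \<partial>lebesgue) \<le> ennreal \<epsilon>"
    if eps: "\<epsilon> > 0" for \<epsilon>
  proof -
    obtain \<delta> where \<delta>: "\<delta> > 0" and D: "\<And>\<psi> :: real ^ 'n \<Rightarrow> real. \<psi> \<in> test_functions \<Longrightarrow>
      (\<forall>l. length l = m \<longrightarrow> (\<integral>x. \<bar>foldr pd l \<psi> x\<bar> powr p \<partial>lborel) \<le> \<delta>) \<Longrightarrow>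
      (\<forall>l. length l = m - s \<longrightarrow> (\<integral>x. \<bar>foldr pd l \<psi> x\<bar> powr q \<partial>lborel) \<le> \<epsilon>)"
      using sobolev_iterated[OF p mN s(1) eps] unfolding q_def s_def by blast
    have "ennreal (\<delta> powr (1 / p)) > 0" using \<delta> by simp
    then obtain K where K: "\<And>i k. i \<ge> K \<Longrightarrow> k \<ge> K \<Longrightarrow> W_norm m p UNIV (\<lambda>x. \<phi> i x - \<phi> k x) < ennreal (\<delta> powr (1 / p))"
      using cau by blast
    show ?thesis
    proof (intro exI allI impI)
      fix i k assume ik: "K \<le> i" "K \<le> k"
      define \<psi> where "\<psi> x = \<phi> i x - \<phi> k x" for x
      have \<psi>: "\<psi> \<in> test_functions" unfolding \<psi>_def[abs_def] by (intro test_functions_diff \<phi>)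
      have "(\<integral>x. \<bar>foldr pd l' \<psi> x\<bar> powr p \<partial>lborel) \<le> \<delta>" if "length l' = m" for l'
      proof -
        have "ennreal (\<integral>x. \<bar>foldr pd l' \<psi> x\<bar> powr p \<partial>lborel) \<le> epow (W_norm m p UNIV \<psi>) p"
          using integral_foldr_pd_le_W_norm[OF \<psi>, of p l'] p that by simp
        also have "\<dots> \<le> epow (ennreal (\<delta> powr (1 / p))) p"
          using less_imp_le[OF K[OF ik]] p unfolding \<psi>_def[abs_def] by (intro epow_mono) auto
        also have "\<dots> = ennreal \<delta>" using p \<delta> by (simp add: epow_ennreal powr_powr)
        finally show ?thesis using \<delta> by (simp add: ennreal_le_iff)
      qed
      then have le: "(\<integral>x. \<bar>foldr pd l \<psi> x\<bar> powr q \<partial>lborel) \<le> \<epsilon>" using D[OF \<psi>] len by blast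
      have "(\<integral>\<^sup>+x. ennreal (\<bar>foldr pd l (\<phi> i) x - foldr pd l (\<phi> k) x\<bar> powr q) \<partial>lebesgue) =
          (\<integral>\<^sup>+x. ennreal (\<bar>foldr pd l \<psi> x\<bar> powr q) \<partial>lborel)"
        unfolding nn_integral_completion \<psi>_def[abs_def]
        by (subst foldr_pd_diff[OF test_functions_smooth[OF \<phi>] test_functions_smooth[OF \<phi>]]) (rule refl)
      also have "\<dots> = ennreal (\<integral>x. \<bar>foldr pd l \<psi> x\<bar> powr q \<partial>lborel)"
        using q by (intro nn_integral_eq_integral test_functions_integrable_powr test_functions_foldr_pd \<psi>) auto
      also have "\<dots> \<le> ennreal \<epsilon>" using le by (rule ennreal_leI)
      finally show "(\<integral>\<^sup>+x. ennreal (\<bar>foldr pd l (\<phi> i) x - foldr pd l (\<phi> k) x\<bar> powr q) \<partial>lebesgue) \<le> ennreal \<epsilon>" .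
    qed
  qed
  obtain v where vm: "v \<in> borel_measurable lebesgue"
    and v: "\<And>\<epsilon>::real. \<epsilon> > 0 \<Longrightarrow> \<exists>K. \<forall>i\<ge>K. (\<integral>\<^sup>+x. ennreal (\<bar>foldr pd l (\<phi> i) x - v x\<bar> powr q) \<partial>lebesgue) \<le> ennreal \<epsilon>"
    using Lq_complete[OF _ Lq_measurable[OF \<phi>q] cauchy] q by auto
  \<comment> \<open>That the limit has a finite norm is not known beforehand. It follows from one
    index where the difference is finite, since \<open>f i\<close> itself lies in the space.\<close>
  have limit: "g \<in> Lq r \<and> (\<lambda>i. LINT x|lebesgue. \<bar>f i x - g x\<bar> powr r) \<longlonglongrightarrow> 0"
    if r: "1 < r" and f: "\<And>i. f i \<in> Lq r" and gm: "g \<in> borel_measurable lebesgue"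
      and lim: "(\<lambda>i. \<integral>\<^sup>+x. ennreal (\<bar>f i x - g x\<bar> powr r) \<partial>lebesgue) \<longlonglongrightarrow> 0" for f g and r :: real
  proof -
    obtain i where "(\<integral>\<^sup>+x. ennreal (\<bar>f i x - g x\<bar> powr r) \<partial>lebesgue) < \<infinity>"
      using order_tendstoD(2)[OF lim, of \<infinity>] by (auto simp: eventually_sequentially)
    then have "(\<lambda>x. f i x - g x) \<in> Lq r"
      using Lq_measurable[OF f] gm by (auto simp: Lq_iff_nn_integral)
    from Lq_diff[OF f[of i] this] have g: "g \<in> Lq r" using r by simp
    have d: "(\<lambda>x. f i x - g x) \<in> Lq r" for i using f g r by (intro Lq_diff) auto
    have "(\<lambda>i. ennreal (LINT x|lebesgue. \<bar>f i x - g x\<bar> powr r)) \<longlonglongrightarrow> ennreal 0"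
      using lim by (simp add: nn_integral_Lq[OF d])
    then have "(\<lambda>i. LINT x|lebesgue. \<bar>f i x - g x\<bar> powr r) \<longlonglongrightarrow> 0"
      by (rule tendsto_ennrealD) auto
    with g show ?thesis by simp
  qed
  have lim_v: "(\<lambda>i. \<integral>\<^sup>+x. ennreal (\<bar>foldr pd l (\<phi> i) x - v x\<bar> powr q) \<partial>lebesgue) \<longlonglongrightarrow> 0"
    using v by (simp add: ennreal_tendsto_0_iff_real eventually_sequentially)
  have lim_u: "(\<lambda>i. \<integral>\<^sup>+x. ennreal (\<bar>\<phi> i x - u x\<bar> powr Q) \<partial>lebesgue) \<longlonglongrightarrow> 0"
    using epow_tendsto_0[OF lim, of Q] Q by (simp add: epow_Lp_norm)
  have \<phi>Q: "\<phi> i \<in> Lq Q" for i using Q by (intro test_functions_Lq \<phi>) auto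
  note lv = limit[OF q \<phi>q vm lim_v] and lu = limit[OF Q \<phi>Q um lim_u]
  have uv: "is_weak_deriv \<alpha> u v"
    unfolding is_weak_deriv_def
  proof (intro conjI ballI)
    show "locally_integrable u" "locally_integrable v"
      using lv lu q Q by (auto intro: Lq_locally_integrable)
    fix \<psi> :: "real ^ 'n \<Rightarrow> real" assume \<psi>: "\<psi> \<in> test_functions"
    have 1: "(\<lambda>i. LINT x|lebesgue. \<phi> i x * mi_pd \<alpha> \<psi> x) \<longlonglongrightarrow> (LINT x|lebesgue. u x * mi_pd \<alpha> \<psi> x)"
      using lu by (intro Lq_pairing_tendsto[OF Q \<phi>Q] mi_pd_test \<psi>) auto
    have 2: "(LINT x|lebesgue. \<phi> i x * mi_pd \<alpha> \<psi> x) =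
        (- 1) ^ mi_order \<alpha> * (LINT x|lebesgue. foldr pd l (\<phi> i) x * \<psi> x)" for i
      using is_weak_deriv_test[OF \<phi>[of i], of \<alpha>] \<psi> unfolding is_weak_deriv_def mi by blast
    have 3: "(\<lambda>i. (- 1) ^ mi_order \<alpha> * (LINT x|lebesgue. foldr pd l (\<phi> i) x * \<psi> x)) \<longlonglongrightarrow>
        (- 1) ^ mi_order \<alpha> * (LINT x|lebesgue. v x * \<psi> x)"
      using lv by (intro tendsto_mult tendsto_const Lq_pairing_tendsto[OF q \<phi>q] \<psi>) auto
    show "(LINT x|lebesgue. u x * mi_pd \<alpha> \<psi> x) = (- 1) ^ mi_order \<alpha> * (LINT x|lebesgue. v x * \<psi> x)"
      by (rule LIMSEQ_unique[OF 1[unfolded 2] 3])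
  qed
  show "is_weak_deriv \<alpha> u (wderiv \<alpha> u)" by (rule is_weak_deriv_wderiv[OF uv])
  show "wderiv \<alpha> u \<in> Lq q" using lv wderiv_AE_eq[OF uv] by (blast intro: Lq_cong_AE)
qed

subsection \<open>Dilations and asymptotic orthogonality\<close>

text \<open>The same rescaling as in \<open>bubble\<close>, but normalised for L^q instead of
  L^{p^*_m}.\<close>

definition dil :: "real \<Rightarrow> int \<Rightarrow> real ^ 'n \<Rightarrow> (real ^ 'n \<Rightarrow> real) \<Rightarrow> real ^ 'n \<Rightarrow> real" where
  "dil q j y g x = 2 powr (real_of_int j * real CARD('n) / q) * g (2 powr real_of_int j *\<^sub>R (x - y))"


lemma dil_measurable: "g \<in> borel_measurable lebesgue \<Longrightarrow> dil q j y g \<in> borel_measurable lebesgue"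
  unfolding dil_def[abs_def] by (intro borel_measurable_times borel_measurable_const measurable_lebesgue_scale) auto

lemma abs_dil_powr:
  fixes g :: "real ^ 'n \<Rightarrow> real"
  assumes "q > 0"
  shows "\<bar>dil q j y g x\<bar> powr q = 2 powr (real_of_int j * real CARD('n)) * \<bar>g (2 powr real_of_int j *\<^sub>R (x - y))\<bar> powr q"
  using assms by (simp add: dil_def abs_mult powr_mult powr_powr)

lemma
  fixes g :: "real ^ 'n \<Rightarrow> real"
  assumes g: "g \<in> borel_measurable lebesgue" and H: "H \<in> borel_measurable borel"
  shows integral_dil: "(LINT x|lebesgue. H (dil q j y g x)) =
      (LINT x|lebesgue. H (2 powr (real_of_int j * real CARD('n) / q) * g x)) / 2 powr (real_of_int j * real CARD('n))"
    and integrable_dil: "integrable lebesgue (\<lambda>x. H (dil q j y g x)) \<longleftrightarrow>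
      integrable lebesgue (\<lambda>x. H (2 powr (real_of_int j * real CARD('n) / q) * g x))"
proof -
  note [measurable] = g H
  have m: "(\<lambda>x. H (2 powr (real_of_int j * real CARD('n) / q) * g x)) \<in> borel_measurable lebesgue" by measurable
  have pos: "(0::real) < 2 powr real_of_int j" by simp
  have "(2 powr real_of_int j) ^ CARD('n) = (2::real) powr (real_of_int j * real CARD('n))"
    by (simp add: powr_powr[symmetric] powr_realpow)
  then show "(LINT x|lebesgue. H (dil q j y g x)) =
      (LINT x|lebesgue. H (2 powr (real_of_int j * real CARD('n) / q) * g x)) / 2 powr (real_of_int j * real CARD('n))"
    using integral_lebesgue_scale(1)[OF pos m, of y] by (simp add: dil_def)
  show "integrable lebesgue (\<lambda>x. H (dil q j y g x)) \<longleftrightarrow>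
      integrable lebesgue (\<lambda>x. H (2 powr (real_of_int j * real CARD('n) / q) * g x))"
    using integral_lebesgue_scale(2)[OF pos m, of y] by (simp add: dil_def)
qed

lemma
  fixes g :: "real ^ 'n \<Rightarrow> real"
  assumes g: "g \<in> Lq q" and q: "q > 0"
  shows dil_Lq: "dil q j y g \<in> Lq q"
    and integral_dil_powr: "(LINT x|lebesgue. \<bar>dil q j y g x\<bar> powr q) = (LINT x|lebesgue. \<bar>g x\<bar> powr q)"
proof -
  have e: "\<bar>2 powr (real_of_int j * real CARD('n) / q) * t\<bar> powr q = 2 powr (real_of_int j * real CARD('n)) * \<bar>t\<bar> powr q" for t
    using q by (simp add: abs_mult powr_mult powr_powr)
  have m: "(\<lambda>t::real. \<bar>t\<bar> powr q) \<in> borel_measurable borel" by measurable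
  show "(LINT x|lebesgue. \<bar>dil q j y g x\<bar> powr q) = (LINT x|lebesgue. \<bar>g x\<bar> powr q)"
    using integral_dil[OF Lq_measurable[OF g] m, of q j y] by (simp add: e)
  have "integrable lebesgue (\<lambda>x. \<bar>dil q j y g x\<bar> powr q)"
    using integrable_dil[OF Lq_measurable[OF g] m, of q j y] Lq_integrable[OF g] by (simp add: e)
  then show "dil q j y g \<in> Lq q"
    using dil_measurable[OF Lq_measurable[OF g]] by (simp add: Lq_def)
qed

text \<open>Prepares the orthogonality estimate: for functions that are bounded and of bounded
  support, the overlap of two dilations is controlled by height and volume. The cut at norm and
  value R leaves a tail that is small by dominated convergence.\<close>

lemma Lq_truncation:
  fixes g :: "'a::euclidean_space \<Rightarrow> real"
  assumes g: "g \<in> Lq q" and q: "q > 0" and \<epsilon>: "\<epsilon> > 0"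
  shows "\<exists>R>0. \<exists>g1\<in>Lq q. \<exists>g2\<in>Lq q. (\<forall>x. g x = g1 x + g2 x) \<and> (\<forall>x. \<bar>g1 x\<bar> \<le> R) \<and>
    (\<forall>x. R < norm x \<longrightarrow> g1 x = 0) \<and> (LINT x|lebesgue. \<bar>g2 x\<bar> powr q) \<le> \<epsilon>"
proof -
  note [measurable] = Lq_measurable[OF g]
  define A where "A R = {x. norm x \<le> R \<and> \<bar>g x\<bar> \<le> R}" for R
  have "A R \<in> sets lebesgue" for R
  proof -
    have "{x. \<bar>g x\<bar> \<le> R} \<in> sets lebesgue"
      using borel_measurable_le[of "\<lambda>x. \<bar>g x\<bar>" lebesgue "\<lambda>_. R"] by simp
    moreover have "(cball 0 R :: 'a set) \<in> sets lebesgue" by simp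
    moreover have "A R = cball 0 R \<inter> {x. \<bar>g x\<bar> \<le> R}" by (auto simp: A_def)
    ultimately show ?thesis by (metis sets.Int)
  qed
  note [measurable] = this
  define g2 where "g2 R x = g x * indicator (- A R) x" for R x
  define g1 where "g1 R x = g x * indicator (A R) x" for R x
  have [measurable]: "g2 R \<in> borel_measurable lebesgue" "g1 R \<in> borel_measurable lebesgue" for R
    unfolding g2_def[abs_def] g1_def[abs_def] by measurable
  have "(\<lambda>n. LINT x|lebesgue. \<bar>g2 (real n) x\<bar> powr q) \<longlonglongrightarrow> (LINT x|(lebesgue :: 'a measure). 0)"
  proof (rule integral_dominated_convergence[OF _ _ Lq_integrable[OF g]])
    show "AE x in lebesgue. (\<lambda>n. \<bar>g2 (real n) x\<bar> powr q) \<longlonglongrightarrow> 0"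
    proof (rule AE_I2)
      fix x
      obtain k where k: "norm x + \<bar>g x\<bar> \<le> real k" using real_arch_simple by blast
      have "eventually (\<lambda>n. 0 = \<bar>g2 (real n) x\<bar> powr q) sequentially"
        using eventually_ge_at_top[of k]
      proof eventually_elim
        fix n assume "k \<le> n"
        then have "real k \<le> real n" by simp
        then have "x \<in> A (real n)" unfolding A_def mem_Collect_eq using k norm_ge_zero[of x] abs_ge_zero[of "g x"] by linarith
        then show "0 = \<bar>g2 (real n) x\<bar> powr q" by (simp add: g2_def)
      qed
      then show "(\<lambda>n. \<bar>g2 (real n) x\<bar> powr q) \<longlonglongrightarrow> 0"
        by (rule Lim_transform_eventually[OF tendsto_const])
    qed
    show "AE x in lebesgue. norm (\<bar>g2 (real n) x\<bar> powr q) \<le> \<bar>g x\<bar> powr q" for n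
      by (intro AE_I2) (auto simp: g2_def indicator_def)
  qed measurable
  then have "eventually (\<lambda>n. (LINT x|lebesgue. \<bar>g2 (real n) x\<bar> powr q) < \<epsilon>) sequentially"
    using \<epsilon> by (intro order_tendstoD(2)) auto
  from eventually_happens[OF eventually_conj[OF this eventually_gt_at_top[of 0]]]
  obtain n where n: "n > 0" "(LINT x|lebesgue. \<bar>g2 (real n) x\<bar> powr q) < \<epsilon>"
    by auto
  have "g1 (real n) \<in> Lq q" "g2 (real n) \<in> Lq q"
    by (rule LqI_bound[OF _ Lq_integrable[OF g]]; auto simp: g1_def g2_def indicator_def)+
  then show ?thesis
    using n by (intro exI[of _ "real n"] conjI bexI[of _ "g1 (real n)"] bexI[of _ "g2 (real n)"])
      (auto simp: g1_def g2_def A_def indicator_def)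
qed

text \<open>The minimum of the sums is at most \<open>min \<bar>a\<bar> \<bar>c\<bar> + max
  \<bar>b\<bar> \<bar>d\<bar>\<close>: the truncation errors b and d enter without being multiplied
  by the main parts.\<close>

lemma min_powr_add_le:
  fixes a b c d :: real
  assumes "q > 0"
  shows "min \<bar>a + b\<bar> \<bar>c + d\<bar> powr q \<le> 2 powr q * (min \<bar>a\<bar> \<bar>c\<bar> powr q + (\<bar>b\<bar> powr q + \<bar>d\<bar> powr q))"
proof -
  have "min \<bar>a + b\<bar> \<bar>c + d\<bar> powr q \<le> \<bar>min \<bar>a\<bar> \<bar>c\<bar> + max \<bar>b\<bar> \<bar>d\<bar>\<bar> powr q"
    using assms by (intro powr_mono2) auto
  also have "\<dots> \<le> 2 powr q * (\<bar>min \<bar>a\<bar> \<bar>c\<bar>\<bar> powr q + \<bar>max \<bar>b\<bar> \<bar>d\<bar>\<bar> powr q)"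
    using assms by (intro abs_add_powr_le) auto
  also have "\<dots> \<le> 2 powr q * (min \<bar>a\<bar> \<bar>c\<bar> powr q + (\<bar>b\<bar> powr q + \<bar>d\<bar> powr q))"
    by (intro mult_left_mono add_mono) (auto simp: max_def)
  finally show ?thesis .
qed

lemma min_Lq:
  assumes "u \<in> Lq q" "v \<in> Lq q" "q > 0"
  shows "integrable lebesgue (\<lambda>x. min \<bar>u x\<bar> \<bar>v x\<bar> powr q)"
proof -
  note [measurable] = Lq_measurable[OF assms(1)] Lq_measurable[OF assms(2)]
  show ?thesis
    by (rule Bochner_Integration.integrable_bound[OF Lq_integrable[OF assms(1)]])
      (use assms in \<open>auto intro!: AE_I2 powr_mono2\<close>)
qed

text \<open>The finer dilation, with exponent j, lives on a ball of radius 2^{-j} R, and the q-th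
  power of the coarser one is at most 2^{kN} R^q. Volume times height decays with j - k, whatever
  the centres.\<close>

lemma integral_min_dil_truncated_le:
  fixes g h :: "real ^ 'n \<Rightarrow> real"
  assumes q: "q > 0" and g: "g \<in> Lq q" and h: "h \<in> Lq q" and R: "R > 0"
    and gb: "\<And>x. \<bar>g x\<bar> \<le> R" "\<And>x. R < norm x \<Longrightarrow> g x = 0"
    and hb: "\<And>x. \<bar>h x\<bar> \<le> R" "\<And>x. R < norm x \<Longrightarrow> h x = 0"
    and jk: "k \<le> j"
  shows "(LINT x|lebesgue. min \<bar>dil q j y g x\<bar> \<bar>dil q k z h x\<bar> powr q) \<le>
    R powr q * (unit_ball_vol (real CARD('n)) * R ^ CARD('n)) * 2 powr - real_of_int (j - k)"
proof -
  let ?N = "real CARD('n)"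
  define r where "r = 2 powr - real_of_int j * R"
  have r: "r > 0" using R by (simp add: r_def)
  have "(LINT x|lebesgue. min \<bar>dil q j y g x\<bar> \<bar>dil q k z h x\<bar> powr q) \<le>
      (LINT x|lebesgue. 2 powr (real_of_int k * ?N) * R powr q * indicator (cball y r) x)"
  proof (rule integral_mono)
    show "integrable lebesgue (\<lambda>x. min \<bar>dil q j y g x\<bar> \<bar>dil q k z h x\<bar> powr q)"
      by (intro min_Lq dil_Lq g h q)
    show "integrable lebesgue (\<lambda>x. 2 powr (real_of_int k * ?N) * R powr q * indicator (cball y r) x)"
      using lmeasurable_compact[of "cball y r"]
      by (intro integrable_mult_right integrable_real_indicator) (auto simp: fmeasurable_def)
    fix x
    show "min \<bar>dil q j y g x\<bar> \<bar>dil q k z h x\<bar> powr q \<le> 2 powr (real_of_int k * ?N) * R powr q * indicator (cball y r) x"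
    proof (cases "x \<in> cball y r")
      case True
      have "min \<bar>dil q j y g x\<bar> \<bar>dil q k z h x\<bar> powr q \<le> \<bar>dil q k z h x\<bar> powr q"
        using q by (intro powr_mono2) auto
      also have "\<dots> \<le> 2 powr (real_of_int k * ?N) * R powr q"
        using q hb(1) by (subst abs_dil_powr[OF q]) (intro mult_left_mono powr_mono2, auto)
      finally show ?thesis using True by simp
    next
      case False
      then have "r < norm (x - y)" by (simp add: dist_norm norm_minus_commute)
      then have "2 powr real_of_int j * r < 2 powr real_of_int j * norm (x - y)" by simp
      then have "R < 2 powr real_of_int j * norm (x - y)" by (simp add: r_def powr_minus field_simps)
      then have "R < norm (2 powr real_of_int j *\<^sub>R (x - y))" by simp
      then have "dil q j y g x = 0" using gb(2) by (simp add: dil_def)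
      then show ?thesis using False by simp
    qed
  qed
  also have "\<dots> = 2 powr (real_of_int k * ?N) * R powr q * measure lebesgue (cball y r)"
    by simp
  also have "measure lebesgue (cball y r) = unit_ball_vol ?N * r ^ CARD('n)"
    using content_cball[of r y] r by simp
  also have "r ^ CARD('n) = 2 powr (- real_of_int j * ?N) * R ^ CARD('n)"
    by (simp add: r_def power_mult_distrib powr_power mult.commute)
  also have "2 powr (real_of_int k * ?N) * R powr q * (unit_ball_vol ?N * (2 powr (- real_of_int j * ?N) * R ^ CARD('n))) =
      R powr q * (unit_ball_vol ?N * R ^ CARD('n)) * (2 powr (real_of_int k * ?N) * 2 powr (- real_of_int j * ?N))"
    by simp
  also have "2 powr (real_of_int k * ?N) * 2 powr (- real_of_int j * ?N) = 2 powr (- real_of_int (j - k) * ?N)"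
    by (simp add: powr_add[symmetric] algebra_simps)
  also have "R powr q * (unit_ball_vol ?N * R ^ CARD('n)) * 2 powr (- real_of_int (j - k) * ?N) \<le>
      R powr q * (unit_ball_vol ?N * R ^ CARD('n)) * 2 powr - real_of_int (j - k)"
  \<comment> \<open>The true decay has the factor N in the exponent; N is at least 1, and the weaker
    bound is enough.\<close>
  proof (intro mult_left_mono powr_mono)
    have "real_of_int (j - k) * 1 \<le> real_of_int (j - k) * ?N"
      using jk by (intro mult_left_mono) (auto simp: Suc_le_eq)
    then show "- real_of_int (j - k) * ?N \<le> - real_of_int (j - k)"
      by (simp only: mult_minus_left mult_1_right neg_le_iff_le)
  qed (use R in auto)
  finally show ?thesis .
qed

text \<open>For truncated functions there are two cases. If the scales are far apart, the volume
  estimate applies; if they are comparable, the centres are far apart at that scale and the supports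
  are disjoint.\<close>

lemma integral_min_dil_tendsto_0:
  fixes g h :: "real ^ 'n \<Rightarrow> real" and j k :: "nat \<Rightarrow> int" and y z :: "nat \<Rightarrow> real ^ 'n"
  assumes q: "q > 0" and g: "g \<in> Lq q" and h: "h \<in> Lq q"
    and orth: "filterlim (\<lambda>n. \<bar>real_of_int (j n) - real_of_int (k n)\<bar> + 2 powr real_of_int (k n) * norm (y n - z n)) at_top sequentially"
  shows "(\<lambda>n. LINT x|lebesgue. min \<bar>dil q (j n) (y n) g x\<bar> \<bar>dil q (k n) (z n) h x\<bar> powr q) \<longlonglongrightarrow> 0"
proof (rule order_tendstoI)
  fix e :: real assume e: "0 < e"
  \<comment> \<open>The core and the two tails contribute at most \<epsilon> each, times 2^q: three
    quarters of e.\<close>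
  define \<epsilon> where "\<epsilon> = e / (4 * 2 powr q)"
  have \<epsilon>: "\<epsilon> > 0" using e by (simp add: \<epsilon>_def)
  obtain Rg g1 g2 where G: "Rg > 0" "g1 \<in> Lq q" "g2 \<in> Lq q" "\<And>x. g x = g1 x + g2 x" "\<And>x. \<bar>g1 x\<bar> \<le> Rg"
    "\<And>x. Rg < norm x \<Longrightarrow> g1 x = 0" "(LINT x|lebesgue. \<bar>g2 x\<bar> powr q) \<le> \<epsilon>"
    using Lq_truncation[OF g q \<epsilon>] by blast
  obtain Rh h1 h2 where Hh: "Rh > 0" "h1 \<in> Lq q" "h2 \<in> Lq q" "\<And>x. h x = h1 x + h2 x" "\<And>x. \<bar>h1 x\<bar> \<le> Rh"
    "\<And>x. Rh < norm x \<Longrightarrow> h1 x = 0" "(LINT x|lebesgue. \<bar>h2 x\<bar> powr q) \<le> \<epsilon>"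
    using Lq_truncation[OF h q \<epsilon>] by blast
  define R where "R = max Rg Rh"
  have R: "R > 0" using G(1) by (simp add: R_def)
  have gb: "\<bar>g1 x\<bar> \<le> R" "R < norm x \<Longrightarrow> g1 x = 0" for x
    using G(5)[of x] G(6)[of x] by (auto simp: R_def)
  have hb: "\<bar>h1 x\<bar> \<le> R" "R < norm x \<Longrightarrow> h1 x = 0" for x
    using Hh(5)[of x] Hh(6)[of x] by (auto simp: R_def)
  define V where "V = R powr q * (unit_ball_vol (real CARD('n)) * R ^ CARD('n))"
  have V: "V \<ge> 0" using R by (simp add: V_def)
  \<comment> \<open>The gap of scales beyond which the volume bound V 2^{-D} is below
    \<epsilon>.\<close>
  define D where "D = max 0 (log 2 ((V + 1) / \<epsilon>))"
  have D: "D \<ge> 0" by (simp add: D_def)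
  have VD: "V * 2 powr - D < \<epsilon>"
  proof -
    have "(V + 1) / \<epsilon> = 2 powr log 2 ((V + 1) / \<epsilon>)" using V \<epsilon> by simp
    also have "\<dots> \<le> 2 powr D" by (intro powr_mono) (auto simp: D_def)
    finally have "V + 1 \<le> \<epsilon> * 2 powr D" using \<epsilon> by (simp add: field_simps)
    then have "V < \<epsilon> * 2 powr D" by simp
    then show ?thesis by (simp add: powr_minus field_simps)
  qed
  \<comment> \<open>If the scales differ by at most D, this threshold leaves more than R (2^D + 1)
    for the distance of the centres in units of 2^{-k}. In these units the supports have radii at
    most R 2^D and R.\<close>
  have "eventually (\<lambda>n. \<bar>real_of_int (j n) - real_of_int (k n)\<bar> + 2 powr real_of_int (k n) * norm (y n - z n) > D + R * (2 powr D + 1)) sequentially"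
    using orth by (auto simp: filterlim_at_top_dense)
  then show "eventually (\<lambda>n. (LINT x|lebesgue. min \<bar>dil q (j n) (y n) g x\<bar> \<bar>dil q (k n) (z n) h x\<bar> powr q) < e) sequentially"
  proof eventually_elim
    fix n
    assume big: "\<bar>real_of_int (j n) - real_of_int (k n)\<bar> + 2 powr real_of_int (k n) * norm (y n - z n) > D + R * (2 powr D + 1)"
    let ?m = "\<lambda>x. min \<bar>dil q (j n) (y n) g1 x\<bar> \<bar>dil q (k n) (z n) h1 x\<bar> powr q"
    have core: "(LINT x|lebesgue. ?m x) < \<epsilon>"
    proof (cases "D < \<bar>real_of_int (j n - k n)\<bar>")
      case True
      have "(LINT x|lebesgue. ?m x) \<le> V * 2 powr - \<bar>real_of_int (j n - k n)\<bar>"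
      proof (cases "k n \<le> j n")
        case True
        then show ?thesis
          using integral_min_dil_truncated_le[OF q G(2) Hh(2) R gb hb True, of "y n" "z n"] by (simp add: V_def)
      next
        case False
        then have "j n \<le> k n" by simp
        from integral_min_dil_truncated_le[OF q Hh(2) G(2) R hb gb this, of "z n" "y n"] False
        show ?thesis by (simp add: V_def min.commute)
      qed
      also have "\<dots> \<le> V * 2 powr - D" using True V by (intro mult_left_mono powr_mono) auto
      finally show ?thesis using VD by simp
    next
      case False
      then have d: "\<bar>real_of_int (j n) - real_of_int (k n)\<bar> \<le> D" by simp
      have far: "2 powr real_of_int (k n) * norm (y n - z n) > R * (2 powr D + 1)" using big d by simp
      have "?m x = 0" for x
      proof (rule ccontr)
        assume "?m x \<noteq> 0"
        then have "dil q (j n) (y n) g1 x \<noteq> 0" "dil q (k n) (z n) h1 x \<noteq> 0" by auto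
        then have "norm (2 powr real_of_int (j n) *\<^sub>R (x - y n)) \<le> R" "norm (2 powr real_of_int (k n) *\<^sub>R (x - z n)) \<le> R"
          using gb(2) hb(2) by (auto simp: dil_def not_less[symmetric])
        then have a: "2 powr real_of_int (j n) * norm (x - y n) \<le> R" and b: "2 powr real_of_int (k n) * norm (x - z n) \<le> R" by auto
        have "2 powr real_of_int (k n) * norm (x - y n) = 2 powr (real_of_int (k n) - real_of_int (j n)) * (2 powr real_of_int (j n) * norm (x - y n))"
          by (simp add: powr_diff)
        also have "\<dots> \<le> 2 powr D * R" using a d R by (intro mult_mono powr_mono) auto
        finally have c: "2 powr real_of_int (k n) * norm (x - y n) \<le> 2 powr D * R" .
        have "norm (y n - z n) \<le> norm (x - y n) + norm (x - z n)"
          using norm_triangle_ineq[of "y n - x" "x - z n"] by (simp add: norm_minus_commute)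
        then have "2 powr real_of_int (k n) * norm (y n - z n) \<le> 2 powr real_of_int (k n) * (norm (x - y n) + norm (x - z n))"
          by (intro mult_left_mono) auto
        then show False using c b far by (simp add: distrib_left mult.commute)
      qed
      then have "(LINT x|lebesgue. ?m x) = 0" by simp
      then show ?thesis using \<epsilon> by simp
    qed
    have "(LINT x|lebesgue. min \<bar>dil q (j n) (y n) g x\<bar> \<bar>dil q (k n) (z n) h x\<bar> powr q) \<le>
        (LINT x|lebesgue. 2 powr q * (?m x + (\<bar>dil q (j n) (y n) g2 x\<bar> powr q + \<bar>dil q (k n) (z n) h2 x\<bar> powr q)))"
    proof (rule integral_mono)
      show "integrable lebesgue (\<lambda>x. min \<bar>dil q (j n) (y n) g x\<bar> \<bar>dil q (k n) (z n) h x\<bar> powr q)"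
        by (intro min_Lq dil_Lq g h q)
      show "integrable lebesgue (\<lambda>x. 2 powr q * (?m x + (\<bar>dil q (j n) (y n) g2 x\<bar> powr q + \<bar>dil q (k n) (z n) h2 x\<bar> powr q)))"
        by (intro integrable_mult_right Bochner_Integration.integrable_add min_Lq Lq_integrable dil_Lq G Hh q)
      have "dil q (j n) (y n) g x = dil q (j n) (y n) g1 x + dil q (j n) (y n) g2 x"
        "dil q (k n) (z n) h x = dil q (k n) (z n) h1 x + dil q (k n) (z n) h2 x" for x
        by (simp_all add: dil_def G(4) Hh(4) distrib_left)
      then show "min \<bar>dil q (j n) (y n) g x\<bar> \<bar>dil q (k n) (z n) h x\<bar> powr q \<le>
        2 powr q * (?m x + (\<bar>dil q (j n) (y n) g2 x\<bar> powr q + \<bar>dil q (k n) (z n) h2 x\<bar> powr q))" for x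
        using min_powr_add_le[OF q] by simp
    qed
    also have "\<dots> = 2 powr q * ((LINT x|lebesgue. ?m x) + ((LINT x|lebesgue. \<bar>g2 x\<bar> powr q) + (LINT x|lebesgue. \<bar>h2 x\<bar> powr q)))"
      using q G(2,3) Hh(2,3) by (simp add: min_Lq Lq_integrable dil_Lq integral_dil_powr)
    also have "\<dots> \<le> 2 powr q * (\<epsilon> + (\<epsilon> + \<epsilon>))"
      using core G(7) Hh(7) by (intro mult_left_mono add_mono) auto
    also have "\<dots> < e" using e by (simp add: \<epsilon>_def)
    finally show "(LINT x|lebesgue. min \<bar>dil q (j n) (y n) g x\<bar> \<bar>dil q (k n) (z n) h x\<bar> powr q) < e" .
  qed
qed (auto intro!: always_eventually elim!: less_le_trans)

subsection \<open>Integral functionals of critical growth\<close>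

text \<open>Isolates what the splitting needs from F. A bound on increments, rather than a
  derivative, can be integrated directly, and the class contains F as well as the power of exponent
  q.\<close>

definition critical_growth :: "real \<Rightarrow> (real \<Rightarrow> real) \<Rightarrow> bool" where
  "critical_growth q F \<longleftrightarrow> F \<in> borel_measurable borel \<and> F 0 = 0 \<and>
    (\<forall>\<epsilon>>0. \<exists>K\<ge>0. \<forall>a b. \<bar>F (a + b) - F a\<bar> \<le> \<epsilon> * \<bar>a\<bar> powr q + K * \<bar>b\<bar> powr q)"

text \<open>The mean value theorem bounds the increment by C (|a| + |b|)^{q-1} |b|. If |b| is at
  most \<delta> |a| this is small relative to |a|^q; otherwise |a| is at most |b| / \<delta> and all
  is absorbed into |b|^q.\<close>

lemma critical_growthI:
  fixes F f :: "real \<Rightarrow> real"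
  assumes q: "1 < q" and der: "\<And>s. (F has_real_derivative f s) (at s)"
    and f: "\<And>s. \<bar>f s\<bar> \<le> C * \<bar>s\<bar> powr (q - 1)" and C: "C > 0" and F0: "F 0 = 0"
  shows "critical_growth q F"
  unfolding critical_growth_def
proof (intro conjI allI impI F0)
  have "continuous_on UNIV F"
    using der by (auto simp: continuous_on_eq_continuous_at intro: DERIV_isCont)
  then show "F \<in> borel_measurable borel" by (rule borel_measurable_continuous_onI)
  fix \<epsilon> :: real assume \<epsilon>: "\<epsilon> > 0"
  have incr: "\<bar>F (a + b) - F a\<bar> \<le> C * (\<bar>a\<bar> + \<bar>b\<bar>) powr (q - 1) * \<bar>b\<bar>" for a b
  proof -
    have "\<exists>\<xi>. \<bar>\<xi>\<bar> \<le> \<bar>a\<bar> + \<bar>b\<bar> \<and> F (a + b) - F a = b * f \<xi>"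
    proof -
      consider "b = 0" | "b > 0" | "b < 0" by linarith
      then show ?thesis
      proof cases
        case 1
        then show ?thesis by (intro exI[of _ a]) auto
      next
        case 2
        then obtain \<xi> where "a < \<xi>" "\<xi> < a + b" "F (a + b) - F a = (a + b - a) * f \<xi>"
          using MVT2[of a "a + b" F f] der by auto
        then show ?thesis by (intro exI[of _ \<xi>]) auto
      next
        case 3
        then obtain \<xi> where "a + b < \<xi>" "\<xi> < a" "F a - F (a + b) = (a - (a + b)) * f \<xi>"
          using MVT2[of "a + b" a F f] der by auto
        then show ?thesis by (intro exI[of _ \<xi>]) auto
      qed
    qed
    then obtain \<xi> where \<xi>: "\<bar>\<xi>\<bar> \<le> \<bar>a\<bar> + \<bar>b\<bar>" "F (a + b) - F a = b * f \<xi>" by blast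
    have "\<bar>f \<xi>\<bar> \<le> C * (\<bar>a\<bar> + \<bar>b\<bar>) powr (q - 1)"
      using \<xi>(1) C q by (intro order_trans[OF f] mult_left_mono powr_mono2) auto
    then show ?thesis unfolding \<xi>(2) abs_mult by (subst mult.commute) (intro mult_right_mono, auto)
  qed
  \<comment> \<open>The bound by 1 gives |a| + |b| at most 2 |a|, whence the factor 2^{q-1}; the
    quotient then brings the increment below \<epsilon> |a|^q.\<close>
  define \<delta> where "\<delta> = min 1 (\<epsilon> / (C * 2 powr (q - 1)))"
  have \<delta>: "0 < \<delta>" "\<delta> \<le> 1" "C * 2 powr (q - 1) * \<delta> \<le> \<epsilon>"
  proof -
    show "0 < \<delta>" "\<delta> \<le> 1" using \<epsilon> C by (auto simp: \<delta>_def)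
    have "\<delta> \<le> \<epsilon> / (C * 2 powr (q - 1))" by (simp add: \<delta>_def)
    then show "C * 2 powr (q - 1) * \<delta> \<le> \<epsilon>" using C by (simp add: field_simps)
  qed
  \<comment> \<open>In the other case |a| + |b| is at most (1 / \<delta> + 1) |b|.\<close>
  define K where "K = C * (1 / \<delta> + 1) powr (q - 1)"
  have K: "K \<ge> 0" using C by (simp add: K_def)
  have pq: "t powr (q - 1) * t = t powr q" if "t \<ge> 0" for t :: real
    using that powr_add[of t "q - 1" 1] by auto
  have "\<bar>F (a + b) - F a\<bar> \<le> \<epsilon> * \<bar>a\<bar> powr q + K * \<bar>b\<bar> powr q" for a b
  proof (cases "\<bar>b\<bar> \<le> \<delta> * \<bar>a\<bar>")
    case True
    then have b: "\<bar>b\<bar> \<le> \<bar>a\<bar>" using \<delta> mult_right_mono[of \<delta> 1 "\<bar>a\<bar>"] by simp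
    have "C * (\<bar>a\<bar> + \<bar>b\<bar>) powr (q - 1) * \<bar>b\<bar> \<le> C * (2 * \<bar>a\<bar>) powr (q - 1) * (\<delta> * \<bar>a\<bar>)"
      using b True C q by (intro mult_mono mult_left_mono powr_mono2) auto
    also have "\<dots> = (C * 2 powr (q - 1) * \<delta>) * (\<bar>a\<bar> powr (q - 1) * \<bar>a\<bar>)"
      by (simp add: powr_mult)
    also have "\<dots> \<le> \<epsilon> * \<bar>a\<bar> powr q"
      unfolding pq[OF abs_ge_zero] using \<delta> by (intro mult_right_mono) auto
    finally show ?thesis using incr[of a b] K by (smt (verit) mult_nonneg_nonneg powr_ge_zero)
  next
    case False
    then have a: "\<bar>a\<bar> \<le> 1 / \<delta> * \<bar>b\<bar>" using \<delta> by (simp add: field_simps)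
    have "C * (\<bar>a\<bar> + \<bar>b\<bar>) powr (q - 1) * \<bar>b\<bar> \<le> C * ((1 / \<delta> + 1) * \<bar>b\<bar>) powr (q - 1) * \<bar>b\<bar>"
      using a C q by (intro mult_right_mono mult_left_mono powr_mono2) (auto simp: distrib_right)
    also have "\<dots> = K * (\<bar>b\<bar> powr (q - 1) * \<bar>b\<bar>)"
      using \<delta> by (simp add: powr_mult K_def)
    also have "\<dots> = K * \<bar>b\<bar> powr q" by (simp add: pq)
    finally show ?thesis using incr[of a b] \<epsilon> by (smt (verit) mult_nonneg_nonneg powr_ge_zero)
  qed
  with K show "\<exists>K\<ge>0. \<forall>a b. \<bar>F (a + b) - F a\<bar> \<le> \<epsilon> * \<bar>a\<bar> powr q + K * \<bar>b\<bar> powr q" by blast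
qed

lemma critical_growth_abs_powr:
  assumes "1 < q"
  shows "critical_growth q (\<lambda>s. \<bar>s\<bar> powr q)"
proof (rule critical_growthI[OF assms has_real_derivative_abs_powr[OF assms]])
  show "\<bar>q * \<bar>s\<bar> powr (q - 1) * sgn s\<bar> \<le> q * \<bar>s\<bar> powr (q - 1)" for s
    using assms by (auto simp: abs_mult abs_sgn_eq)
qed (use assms in auto)

text \<open>The defining inequality at a = 0: the term with \<epsilon> vanishes and
  \<open>F 0 = 0\<close>.\<close>

lemma critical_growth_bound:
  assumes "critical_growth q F"
  obtains K where "K \<ge> 0" "\<And>s. \<bar>F s\<bar> \<le> K * \<bar>s\<bar> powr q"
proof -
  obtain K where K: "K \<ge> 0" "\<forall>a b. \<bar>F (a + b) - F a\<bar> \<le> 1 * \<bar>a\<bar> powr q + K * \<bar>b\<bar> powr q"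
    using assms unfolding critical_growth_def by (meson zero_less_one)
  have F0: "F 0 = 0" using assms by (simp add: critical_growth_def)
  have "\<bar>F s\<bar> \<le> K * \<bar>s\<bar> powr q" for s
    using K(2)[rule_format, of 0 s] F0 by simp
  with K(1) show ?thesis by (rule that)
qed

lemma critical_growth_integrable:
  assumes F: "critical_growth q F" and v: "v \<in> Lq q"
  shows "integrable lebesgue (\<lambda>x. F (v x))"
proof -
  obtain K where K: "K \<ge> 0" "\<And>s. \<bar>F s\<bar> \<le> K * \<bar>s\<bar> powr q" using critical_growth_bound[OF F] by blast
  have [measurable]: "F \<in> borel_measurable borel" using F by (simp add: critical_growth_def)
  note [measurable] = Lq_measurable[OF v]
  show ?thesis
  proof (rule Bochner_Integration.integrable_bound)
    show "integrable lebesgue (\<lambda>x. K * \<bar>v x\<bar> powr q)" using Lq_integrable[OF v] by simp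
    show "AE x in lebesgue. norm (F (v x)) \<le> norm (K * \<bar>v x\<bar> powr q)"
      using K by (intro AE_I2) (simp add: abs_mult)
  qed measurable
qed

text \<open>The argument of smaller modulus is taken as the increment; its powers, and F at that
  argument, are then controlled by the minimum.\<close>

lemma critical_growth_split:
  assumes F: "critical_growth q F" and \<epsilon>: "\<epsilon> > 0"
  obtains K where "K \<ge> 0"
    "\<And>a b. \<bar>F (a + b) - F a - F b\<bar> \<le> \<epsilon> * (\<bar>a\<bar> powr q + \<bar>b\<bar> powr q) + K * min \<bar>a\<bar> \<bar>b\<bar> powr q"
proof -
  obtain K1 where K1: "K1 \<ge> 0" "\<And>s. \<bar>F s\<bar> \<le> K1 * \<bar>s\<bar> powr q" using critical_growth_bound[OF F] by blast
  obtain K where K: "K \<ge> 0" "\<And>a b. \<bar>F (a + b) - F a\<bar> \<le> \<epsilon> * \<bar>a\<bar> powr q + K * \<bar>b\<bar> powr q"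
    using F \<epsilon> unfolding critical_growth_def by meson
  have half: "\<bar>F (a + b) - F a - F b\<bar> \<le> \<epsilon> * (\<bar>a\<bar> powr q + \<bar>b\<bar> powr q) + (K + K1) * min \<bar>a\<bar> \<bar>b\<bar> powr q"
    if "\<bar>b\<bar> \<le> \<bar>a\<bar>" for a b
  proof -
    have "\<bar>F (a + b) - F a - F b\<bar> \<le> \<epsilon> * \<bar>a\<bar> powr q + K * \<bar>b\<bar> powr q + K1 * \<bar>b\<bar> powr q"
      using K(2)[of a b] K1(2)[of b] by linarith
    also have "\<dots> = \<epsilon> * \<bar>a\<bar> powr q + (K + K1) * min \<bar>a\<bar> \<bar>b\<bar> powr q"
      using that by (simp add: distrib_right min_absorb2)
    also have "\<dots> \<le> \<epsilon> * (\<bar>a\<bar> powr q + \<bar>b\<bar> powr q) + (K + K1) * min \<bar>a\<bar> \<bar>b\<bar> powr q"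
      using \<epsilon> by (simp add: distrib_left)
    finally show ?thesis .
  qed
  show ?thesis
  proof (rule that[of "K + K1"])
    fix a b
    show "\<bar>F (a + b) - F a - F b\<bar> \<le> \<epsilon> * (\<bar>a\<bar> powr q + \<bar>b\<bar> powr q) + (K + K1) * min \<bar>a\<bar> \<bar>b\<bar> powr q"
    proof (cases "\<bar>b\<bar> \<le> \<bar>a\<bar>")
      case False
      then have "\<bar>a\<bar> \<le> \<bar>b\<bar>" by simp
      have e: "F (a + b) - F a - F b = F (b + a) - F b - F a" by (simp add: add.commute)
      show ?thesis using half[OF \<open>\<bar>a\<bar> \<le> \<bar>b\<bar>\<close>] unfolding e by (simp add: min.commute add.commute)
    qed (rule half)
  qed (use K K1 in auto)
qed

section \<open>Splitting of integrals over asymptotically orthogonal summands\<close>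

lemma integral_split_tendsto_0:
  fixes a b :: "nat \<Rightarrow> real ^ 'n \<Rightarrow> real"
  assumes F: "critical_growth q F" and q: "q > 0"
    and a: "\<And>n. a n \<in> Lq q" and b: "\<And>n. b n \<in> Lq q"
    and B: "\<And>n. (LINT x|lebesgue. \<bar>a n x\<bar> powr q) \<le> B" "\<And>n. (LINT x|lebesgue. \<bar>b n x\<bar> powr q) \<le> B"
    and m: "(\<lambda>n. LINT x|lebesgue. min \<bar>a n x\<bar> \<bar>b n x\<bar> powr q) \<longlonglongrightarrow> 0"
  shows "(\<lambda>n. (LINT x|lebesgue. F (a n x + b n x)) - (LINT x|lebesgue. F (a n x)) - (LINT x|lebesgue. F (b n x))) \<longlonglongrightarrow> 0"
  unfolding tendsto_iff dist_real_def
proof (intro allI impI)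
  fix e :: real assume e: "0 < e"
  have "0 \<le> (LINT x|lebesgue. \<bar>a 0 x\<bar> powr q)" by simp
  then have B0: "B \<ge> 0" using B(1)[of 0] by linarith
  \<comment> \<open>The two q-th powers have integrals at most B each, so this part stays below e /
    2; the other half is left for the minimum. Adding 1 to B avoids division by 0.\<close>
  define \<epsilon> where "\<epsilon> = e / (4 * (B + 1))"
  have \<epsilon>: "\<epsilon> > 0" "\<epsilon> * (2 * B) \<le> e / 2" using e B0 by (auto simp: \<epsilon>_def field_simps)
  obtain K where K: "K \<ge> 0"
    "\<And>a b. \<bar>F (a + b) - F a - F b\<bar> \<le> \<epsilon> * (\<bar>a\<bar> powr q + \<bar>b\<bar> powr q) + K * min \<bar>a\<bar> \<bar>b\<bar> powr q"
    using critical_growth_split[OF F \<epsilon>(1)] by blast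
  have "eventually (\<lambda>n. (LINT x|lebesgue. min \<bar>a n x\<bar> \<bar>b n x\<bar> powr q) < e / (2 * (K + 1))) sequentially"
    using e K by (intro order_tendstoD(2)[OF m]) auto
  then show "eventually (\<lambda>n. \<bar>(LINT x|lebesgue. F (a n x + b n x)) - (LINT x|lebesgue. F (a n x)) - (LINT x|lebesgue. F (b n x)) - 0\<bar> < e) sequentially"
  proof eventually_elim
    fix n
    define M where "M = (LINT x|lebesgue. min \<bar>a n x\<bar> \<bar>b n x\<bar> powr q)"
    assume M: "(LINT x|lebesgue. min \<bar>a n x\<bar> \<bar>b n x\<bar> powr q) < e / (2 * (K + 1))"
    have ab: "(\<lambda>x. a n x + b n x) \<in> Lq q" using a b q by (intro Lq_add) auto
    note i = critical_growth_integrable[OF F]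
    have "(LINT x|lebesgue. F (a n x + b n x)) - (LINT x|lebesgue. F (a n x)) - (LINT x|lebesgue. F (b n x)) =
        (LINT x|lebesgue. F (a n x + b n x) - F (a n x) - F (b n x))"
      using i[OF ab] i[OF a] i[OF b] by simp
    also have "\<bar>\<dots>\<bar> \<le> (LINT x|lebesgue. \<epsilon> * (\<bar>a n x\<bar> powr q + \<bar>b n x\<bar> powr q) + K * min \<bar>a n x\<bar> \<bar>b n x\<bar> powr q)"
    proof (rule integral_abs_bound[THEN order_trans], rule integral_mono)
      show "integrable lebesgue (\<lambda>x. \<bar>F (a n x + b n x) - F (a n x) - F (b n x)\<bar>)"
        using i[OF ab] i[OF a] i[OF b] by simp
      show "integrable lebesgue (\<lambda>x. \<epsilon> * (\<bar>a n x\<bar> powr q + \<bar>b n x\<bar> powr q) + K * min \<bar>a n x\<bar> \<bar>b n x\<bar> powr q)"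
        using Lq_integrable[OF a] Lq_integrable[OF b] min_Lq[OF a b q] by simp
    qed (rule K(2))
    also have "\<dots> = \<epsilon> * ((LINT x|lebesgue. \<bar>a n x\<bar> powr q) + (LINT x|lebesgue. \<bar>b n x\<bar> powr q)) + K * M"
      using Lq_integrable[OF a] Lq_integrable[OF b] min_Lq[OF a b q] by (simp add: M_def)
    also have "\<dots> \<le> \<epsilon> * (2 * B) + K * M"
      using B[of n] \<epsilon>(1) by (intro add_right_mono mult_left_mono) auto
    also have "\<dots> < e"
    proof -
      have "K * M \<le> K * (e / (2 * (K + 1)))" using K(1) M by (intro mult_left_mono) (auto simp: M_def)
      also have "\<dots> < e / 2" using K(1) e by (simp add: field_simps)
      finally show ?thesis using \<epsilon>(2) by simp
    qed
    finally show "\<bar>(LINT x|lebesgue. F (a n x + b n x)) - (LINT x|lebesgue. F (a n x)) - (LINT x|lebesgue. F (b n x)) - 0\<bar> < e"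
      by simp
  qed
qed

text \<open>The constant worsens with every summand, which is harmless: L is fixed while n varies,
  and only uniformity in n matters.\<close>

lemma integral_sum_powr_bound:
  fixes T :: "nat \<Rightarrow> nat \<Rightarrow> real ^ 'n \<Rightarrow> real"
  assumes q: "q > 0" and T: "\<And>l n. l < L \<Longrightarrow> T l n \<in> Lq q"
    and B: "\<And>l n. l < L \<Longrightarrow> (LINT x|lebesgue. \<bar>T l n x\<bar> powr q) \<le> B l"
  shows "\<exists>C. \<forall>n. (LINT x|lebesgue. \<bar>\<Sum>l<L. T l n x\<bar> powr q) \<le> C"
  using T B
proof (induction L)
  case (Suc L)
  then obtain C where C: "\<And>n. (LINT x|lebesgue. \<bar>\<Sum>l<L. T l n x\<bar> powr q) \<le> C" by force
  have S: "(\<lambda>x. \<Sum>l<L. T l n x) \<in> Lq q" for n using Suc.prems q by (intro Lq_sum) auto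
  have TL: "T L n \<in> Lq q" for n using Suc.prems by simp
  have "(LINT x|lebesgue. \<bar>\<Sum>l<Suc L. T l n x\<bar> powr q) \<le> 2 powr q * (C + B L)" for n
  proof -
    have "(LINT x|lebesgue. \<bar>\<Sum>l<Suc L. T l n x\<bar> powr q) \<le>
        (LINT x|lebesgue. 2 powr q * (\<bar>\<Sum>l<L. T l n x\<bar> powr q + \<bar>T L n x\<bar> powr q))"
    proof (rule integral_mono)
      show "integrable lebesgue (\<lambda>x. \<bar>\<Sum>l<Suc L. T l n x\<bar> powr q)"
        using Suc.prems q by (intro Lq_integrable Lq_sum) auto
      show "integrable lebesgue (\<lambda>x. 2 powr q * (\<bar>\<Sum>l<L. T l n x\<bar> powr q + \<bar>T L n x\<bar> powr q))"
        using Lq_integrable[OF S] Lq_integrable[OF TL] by simp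
    qed (use q in \<open>simp add: abs_add_powr_le\<close>)
    also have "\<dots> = 2 powr q * ((LINT x|lebesgue. \<bar>\<Sum>l<L. T l n x\<bar> powr q) + (LINT x|lebesgue. \<bar>T L n x\<bar> powr q))"
      using Lq_integrable[OF S] Lq_integrable[OF TL] by simp
    also have "\<dots> \<le> 2 powr q * (C + B L)"
      using C[of n] Suc.prems(2)[of L n] by (intro mult_left_mono add_mono) auto
    finally show ?thesis .
  qed
  then show ?case by blast
qed (auto intro: exI[of _ 0])

text \<open>The minimum with a fixed function is subadditive, so pairwise orthogonality carries over
  to a sum of profiles.\<close>

lemma integral_min_sum_tendsto_0:
  fixes T :: "nat \<Rightarrow> nat \<Rightarrow> real ^ 'n \<Rightarrow> real"
  assumes q: "q > 0" and T: "\<And>l n. l < L \<Longrightarrow> T l n \<in> Lq q" and b: "\<And>n. b n \<in> Lq q"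
    and m: "\<And>l. l < L \<Longrightarrow> (\<lambda>n. LINT x|lebesgue. min \<bar>T l n x\<bar> \<bar>b n x\<bar> powr q) \<longlonglongrightarrow> 0"
  shows "(\<lambda>n. LINT x|lebesgue. min \<bar>\<Sum>l<L. T l n x\<bar> \<bar>b n x\<bar> powr q) \<longlonglongrightarrow> 0"
  using T m
proof (induction L)
  case (Suc L)
  have S: "(\<lambda>x. \<Sum>l<L. T l n x) \<in> Lq q" for n using Suc.prems q by (intro Lq_sum) auto
  have S': "(\<lambda>x. \<Sum>l<Suc L. T l n x) \<in> Lq q" for n using Suc.prems q by (intro Lq_sum) auto
  have TL: "T L n \<in> Lq q" for n using Suc.prems by simp
  let ?m = "\<lambda>n. 2 powr q * ((LINT x|lebesgue. min \<bar>\<Sum>l<L. T l n x\<bar> \<bar>b n x\<bar> powr q) + (LINT x|lebesgue. min \<bar>T L n x\<bar> \<bar>b n x\<bar> powr q))"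
  have "?m \<longlonglongrightarrow> 2 powr q * (0 + 0)"
    using Suc by (intro tendsto_intros) auto
  then have lim: "?m \<longlonglongrightarrow> 0" by simp
  show ?case
  proof (rule Lim_null_comparison[OF _ lim], intro always_eventually allI)
    fix n
    have pw: "min \<bar>s + t\<bar> \<bar>c\<bar> powr q \<le> 2 powr q * (min \<bar>s\<bar> \<bar>c\<bar> powr q + min \<bar>t\<bar> \<bar>c\<bar> powr q)" for s t c :: real
    proof -
      have "min \<bar>s + t\<bar> \<bar>c\<bar> powr q \<le> \<bar>min \<bar>s\<bar> \<bar>c\<bar> + min \<bar>t\<bar> \<bar>c\<bar>\<bar> powr q"
        using q by (intro powr_mono2) auto
      also have "\<dots> \<le> 2 powr q * (\<bar>min \<bar>s\<bar> \<bar>c\<bar>\<bar> powr q + \<bar>min \<bar>t\<bar> \<bar>c\<bar>\<bar> powr q)"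
        using q by (intro abs_add_powr_le) auto
      finally show ?thesis by simp
    qed
    have "(LINT x|lebesgue. min \<bar>\<Sum>l<Suc L. T l n x\<bar> \<bar>b n x\<bar> powr q) \<le>
        (LINT x|lebesgue. 2 powr q * (min \<bar>\<Sum>l<L. T l n x\<bar> \<bar>b n x\<bar> powr q + min \<bar>T L n x\<bar> \<bar>b n x\<bar> powr q))"
      using min_Lq[OF S' b q] min_Lq[OF S b q] min_Lq[OF TL b q] pw by (intro integral_mono) auto
    also have "\<dots> = ?m n" using min_Lq[OF S b q] min_Lq[OF TL b q] by simp
    finally show "norm (LINT x|lebesgue. min \<bar>\<Sum>l<Suc L. T l n x\<bar> \<bar>b n x\<bar> powr q) \<le> ?m n" by simp
  qed
qed (use q in simp)

text \<open>The last profile is split off from the sum of the earlier ones, to which it is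
  asymptotically orthogonal; then induction.\<close>

lemma integral_sum_splits:
  fixes T :: "nat \<Rightarrow> nat \<Rightarrow> real ^ 'n \<Rightarrow> real"
  assumes F: "critical_growth q F" and q: "q > 0" and T: "\<And>l n. l < L \<Longrightarrow> T l n \<in> Lq q"
    and B: "\<And>l n. l < L \<Longrightarrow> (LINT x|lebesgue. \<bar>T l n x\<bar> powr q) \<le> B l"
    and m: "\<And>l k. l < k \<Longrightarrow> k < L \<Longrightarrow> (\<lambda>n. LINT x|lebesgue. min \<bar>T l n x\<bar> \<bar>T k n x\<bar> powr q) \<longlonglongrightarrow> 0"
  shows "(\<lambda>n. (LINT x|lebesgue. F (\<Sum>l<L. T l n x)) - (\<Sum>l<L. LINT x|lebesgue. F (T l n x))) \<longlonglongrightarrow> 0"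
  using T B m
proof (induction L)
  case 0
  have "F 0 = 0" using F by (simp add: critical_growth_def)
  then show ?case by simp
next
  case (Suc L)
  obtain C where C: "\<And>n. (LINT x|lebesgue. \<bar>\<Sum>l<L. T l n x\<bar> powr q) \<le> C"
    using integral_sum_powr_bound[OF q, of L T B] Suc.prems by force
  have "(\<lambda>n. (LINT x|lebesgue. F ((\<Sum>l<L. T l n x) + T L n x)) - (LINT x|lebesgue. F (\<Sum>l<L. T l n x)) - (LINT x|lebesgue. F (T L n x))) \<longlonglongrightarrow> 0"
  proof (rule integral_split_tendsto_0[OF F q])
    show "(\<lambda>x. \<Sum>l<L. T l n x) \<in> Lq q" "T L n \<in> Lq q" for n
      using Suc.prems q by (auto intro: Lq_sum)
    show "(LINT x|lebesgue. \<bar>\<Sum>l<L. T l n x\<bar> powr q) \<le> max C (B L)" for n using C[of n] by simp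
    show "(LINT x|lebesgue. \<bar>T L n x\<bar> powr q) \<le> max C (B L)" for n using Suc.prems(2)[of L n] by simp
    show "(\<lambda>n. LINT x|lebesgue. min \<bar>\<Sum>l<L. T l n x\<bar> \<bar>T L n x\<bar> powr q) \<longlonglongrightarrow> 0"
      using Suc.prems q by (intro integral_min_sum_tendsto_0) auto
  qed
  moreover have "(\<lambda>n. (LINT x|lebesgue. F (\<Sum>l<L. T l n x)) - (\<Sum>l<L. LINT x|lebesgue. F (T l n x))) \<longlonglongrightarrow> 0"
    using Suc by simp
  ultimately have "(\<lambda>n. ((LINT x|lebesgue. F ((\<Sum>l<L. T l n x) + T L n x)) - (LINT x|lebesgue. F (\<Sum>l<L. T l n x)) - (LINT x|lebesgue. F (T L n x)))
     + ((LINT x|lebesgue. F (\<Sum>l<L. T l n x)) - (\<Sum>l<L. LINT x|lebesgue. F (T l n x)))) \<longlonglongrightarrow> 0 + 0"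
    by (rule tendsto_add)
  then show ?case by (simp add: algebra_simps)
qed

section \<open>Limits of the integrals along a single profile\<close>

lemma primitive_has_derivative:
  assumes "continuous_on UNIV f"
  shows "(primitive f has_real_derivative f s) (at s)"
proof -
  \<comment> \<open>An interval that has s in its interior and also contains the base point 0, so
    that both signs of s are treated at once.\<close>
  define a b where "a = - \<bar>s\<bar> - 1" and "b = \<bar>s\<bar> + 1"
  have s: "a < s" "s < b" "a \<le> 0" "0 \<le> b" by (auto simp: a_def b_def)
  have "((\<lambda>u. LBINT y=ereal 0..ereal u. f y) has_vector_derivative f s) (at s within {a..b})"
    using s assms by (intro interval_integral_FTC2) (auto intro: continuous_on_subset)
  then show ?thesis
    using s by (simp add: primitive_def[abs_def] at_within_Icc_at has_real_derivative_iff_has_vector_derivative)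
qed

text \<open>The filters \<open>P\<close> and \<open>M\<close> are abstract so that one proof serves
  both regimes: arguments tending to plus or minus infinity, and arguments tending to 0 from the
  right or left.\<close>

lemma homogeneous_limit:
  fixes s :: "nat \<Rightarrow> real"
  assumes s: "\<And>n. s n > 0" and F0: "F 0 = 0"
    and A: "((\<lambda>t. \<bar>t\<bar> powr (- q) * F t) \<longlongrightarrow> A) P" and B: "((\<lambda>t. \<bar>t\<bar> powr (- q) * F t) \<longlongrightarrow> B) M"
    and P: "\<And>t. t > 0 \<Longrightarrow> filterlim (\<lambda>n. s n * t) P sequentially"
    and M: "\<And>t. t < 0 \<Longrightarrow> filterlim (\<lambda>n. s n * t) M sequentially"
  shows "(\<lambda>n. s n powr (- q) * F (s n * t)) \<longlonglongrightarrow> homogeneous q A B t"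
proof -
  have e: "\<bar>t\<bar> powr q * (\<bar>s n * t\<bar> powr (- q) * F (s n * t)) = s n powr (- q) * F (s n * t)" if "t \<noteq> 0" for n
    using that s[of n] by (simp add: abs_mult powr_mult powr_minus)
  consider "t > 0" | "t < 0" | "t = 0" by linarith
  then show ?thesis
  proof cases
    case 1
    have "(\<lambda>n. \<bar>t\<bar> powr q * (\<bar>s n * t\<bar> powr (- q) * F (s n * t))) \<longlonglongrightarrow> \<bar>t\<bar> powr q * A"
      by (intro tendsto_mult tendsto_const filterlim_compose[OF A P] 1)
    then show ?thesis unfolding e[OF 1[THEN less_imp_neq, symmetric]] using 1 by (simp add: homogeneous_def mult.commute)
  next
    case 2
    have "(\<lambda>n. \<bar>t\<bar> powr q * (\<bar>s n * t\<bar> powr (- q) * F (s n * t))) \<longlonglongrightarrow> \<bar>t\<bar> powr q * B"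
      by (intro tendsto_mult tendsto_const filterlim_compose[OF B M] 2)
    then show ?thesis unfolding e[OF 2[THEN less_imp_neq]] using 2 by (simp add: homogeneous_def mult.commute)
  next
    case 3
    then show ?thesis by (simp add: homogeneous_def F0)
  qed
qed

text \<open>Undoing the dilation moves the scale inside F. There s^{-q} cancels the growth of F, so
  \<open>K * \<bar>g x\<bar> powr q\<close> dominates for all n.\<close>

lemma integral_dil_homogeneous_limit:
  fixes g :: "real ^ 'n \<Rightarrow> real" and j :: "nat \<Rightarrow> int"
  assumes F: "critical_growth q F" and q: "q > 0" and g: "g \<in> Lq q"
    and lim: "\<And>t. (\<lambda>n. (2 powr (real_of_int (j n) * real CARD('n) / q)) powr (- q) *
      F (2 powr (real_of_int (j n) * real CARD('n) / q) * t)) \<longlonglongrightarrow> homogeneous q A B t"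
  shows "integrable lebesgue (\<lambda>x. homogeneous q A B (g x))"
    and "(\<lambda>n. LINT x|lebesgue. F (dil q (j n) (y n) g x)) \<longlonglongrightarrow> (LINT x|lebesgue. homogeneous q A B (g x))"
proof -
  obtain K where K: "K \<ge> 0" "\<And>s. \<bar>F s\<bar> \<le> K * \<bar>s\<bar> powr q" using critical_growth_bound[OF F] by blast
  have [measurable]: "F \<in> borel_measurable borel" using F by (simp add: critical_growth_def)
  note [measurable] = Lq_measurable[OF g]
  have [measurable]: "homogeneous q A B \<in> borel_measurable borel"
    unfolding homogeneous_def[abs_def] by measurable
  define s where "s n = 2 powr (real_of_int (j n) * real CARD('n) / q)" for n
  have s: "s n > 0" for n by (simp add: s_def)
  have sq: "s n powr (- q) = 1 / 2 powr (real_of_int (j n) * real CARD('n))" for n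
  proof -
    have "real_of_int (j n) * real CARD('n) / q * - q = - (real_of_int (j n) * real CARD('n))" using q by simp
    then show ?thesis using q by (simp add: s_def powr_powr powr_minus_divide)
  qed
  have int: "integrable lebesgue (\<lambda>x. K * \<bar>g x\<bar> powr q)" using Lq_integrable[OF g] by simp
  have meas: "(\<lambda>x. s n powr (- q) * F (s n * g x)) \<in> borel_measurable lebesgue" for n by measurable
  have meas': "(\<lambda>x. homogeneous q A B (g x)) \<in> borel_measurable lebesgue" by measurable
  have conv: "AE x in lebesgue. (\<lambda>n. s n powr (- q) * F (s n * g x)) \<longlonglongrightarrow> homogeneous q A B (g x)"
    unfolding s_def by (intro AE_I2 lim)
  have bound: "AE x in lebesgue. norm (s n powr (- q) * F (s n * g x)) \<le> K * \<bar>g x\<bar> powr q" for n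
  proof (rule AE_I2)
    fix x
    have "norm (s n powr (- q) * F (s n * g x)) = s n powr (- q) * \<bar>F (s n * g x)\<bar>"
      by (simp add: abs_mult)
    also have "\<dots> \<le> s n powr (- q) * (K * \<bar>s n * g x\<bar> powr q)"
      by (intro mult_left_mono K(2)) simp
    also have "\<dots> = K * \<bar>g x\<bar> powr q" using s[of n] by (simp add: abs_mult powr_mult powr_minus)
    finally show "norm (s n powr (- q) * F (s n * g x)) \<le> K * \<bar>g x\<bar> powr q" .
  qed
  show "integrable lebesgue (\<lambda>x. homogeneous q A B (g x))"
    by (rule integrable_dominated_convergence[OF meas' meas int conv bound])
  have "(\<lambda>n. LINT x|lebesgue. s n powr (- q) * F (s n * g x)) \<longlonglongrightarrow> (LINT x|lebesgue. homogeneous q A B (g x))"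
    by (rule integral_dominated_convergence[OF meas' meas int conv bound])
  moreover have "(LINT x|lebesgue. F (dil q (j n) (y n) g x)) = (LINT x|lebesgue. s n powr (- q) * F (s n * g x))" for n
    using integral_dil[OF Lq_measurable[OF g], of F q "j n" "y n"] sq[of n] by (simp add: s_def)
  ultimately show "(\<lambda>n. LINT x|lebesgue. F (dil q (j n) (y n) g x)) \<longlonglongrightarrow> (LINT x|lebesgue. homogeneous q A B (g x))"
    by simp
qed

lemma filterlim_scale_at_top:
  fixes j :: "nat \<Rightarrow> int"
  assumes j: "filterlim (\<lambda>n. real_of_int (j n)) at_top sequentially" and c: "c > 0"
  shows "filterlim (\<lambda>n. 2 powr (real_of_int (j n) * c)) at_top sequentially"
proof -
  have "filterlim (\<lambda>n. c * ln 2 * real_of_int (j n)) at_top sequentially"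
    using c by (intro filterlim_tendsto_pos_mult_at_top[OF tendsto_const _ j]) auto
  then have "filterlim (\<lambda>n. exp (c * ln 2 * real_of_int (j n))) at_top sequentially"
    by (rule filterlim_compose[OF exp_at_top])
  then show ?thesis by (simp add: powr_def mult_ac)
qed

lemma tendsto_scale_at_bot:
  fixes j :: "nat \<Rightarrow> int"
  assumes j: "filterlim (\<lambda>n. real_of_int (j n)) at_bot sequentially" and c: "c > 0"
  shows "(\<lambda>n. 2 powr (real_of_int (j n) * c)) \<longlonglongrightarrow> 0"
proof -
  have "filterlim (\<lambda>n. real_of_int (- j n)) at_top sequentially"
    using j by (simp add: filterlim_uminus_at_top)
  from filterlim_scale_at_top[OF this c]
  have "(\<lambda>n. inverse (2 powr (real_of_int (- j n) * c))) \<longlonglongrightarrow> 0"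
    by (rule tendsto_inverse_0_at_top)
  then show ?thesis by (simp add: powr_minus)
qed

text \<open>Concentration: the amplitude of the dilation tends to infinity, so only the behaviour of
  F at plus and minus infinity survives.\<close>

lemma
  fixes g :: "real ^ 'n \<Rightarrow> real" and j :: "nat \<Rightarrow> int"
  assumes F: "critical_growth q F" and q: "q > 0" and g: "g \<in> Lq q"
    and j: "filterlim (\<lambda>n. real_of_int (j n)) at_top sequentially"
    and A: "((\<lambda>s. \<bar>s\<bar> powr (- q) * F s) \<longlongrightarrow> A) at_top" and B: "((\<lambda>s. \<bar>s\<bar> powr (- q) * F s) \<longlongrightarrow> B) at_bot"
  shows integrable_concentrating: "integrable lebesgue (\<lambda>x. homogeneous q A B (g x))"
    and integral_dil_concentrating:
      "(\<lambda>n. LINT x|lebesgue. F (dil q (j n) (y n) g x)) \<longlonglongrightarrow> (LINT x|lebesgue. homogeneous q A B (g x))"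
proof -
  have F0: "F 0 = 0" using F by (simp add: critical_growth_def)
  define s where "s n = 2 powr (real_of_int (j n) * real CARD('n) / q)" for n
  have st: "filterlim s at_top sequentially"
    using filterlim_scale_at_top[OF j, of "real CARD('n) / q"] q by (simp add: s_def[abs_def])
  have lim: "(\<lambda>n. s n powr (- q) * F (s n * t)) \<longlonglongrightarrow> homogeneous q A B t" for t
  proof (rule homogeneous_limit[OF _ F0 A B])
    show "filterlim (\<lambda>n. s n * t) at_top sequentially" if "t > 0" for t
      using filterlim_tendsto_pos_mult_at_top[OF tendsto_const that st] by (simp add: mult.commute)
    show "filterlim (\<lambda>n. s n * t) at_bot sequentially" if "t < 0" for t
      using that filterlim_tendsto_pos_mult_at_top[OF tendsto_const _ st, of "- t"]
      by (simp add: filterlim_uminus_at_bot mult.commute)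
  qed (simp add: s_def)
  show "integrable lebesgue (\<lambda>x. homogeneous q A B (g x))"
    by (rule integral_dil_homogeneous_limit(1)[OF F q g lim[unfolded s_def]])
  show "(\<lambda>n. LINT x|lebesgue. F (dil q (j n) (y n) g x)) \<longlonglongrightarrow> (LINT x|lebesgue. homogeneous q A B (g x))"
    by (rule integral_dil_homogeneous_limit(2)[OF F q g lim[unfolded s_def]])
qed

text \<open>Spreading: the amplitude tends to 0, so only the behaviour of F near 0 survives.\<close>

lemma
  fixes g :: "real ^ 'n \<Rightarrow> real" and j :: "nat \<Rightarrow> int"
  assumes F: "critical_growth q F" and q: "q > 0" and g: "g \<in> Lq q"
    and j: "filterlim (\<lambda>n. real_of_int (j n)) at_bot sequentially"
    and A: "((\<lambda>s. \<bar>s\<bar> powr (- q) * F s) \<longlongrightarrow> A) (at_right 0)" and B: "((\<lambda>s. \<bar>s\<bar> powr (- q) * F s) \<longlongrightarrow> B) (at_left 0)"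
  shows integrable_spreading: "integrable lebesgue (\<lambda>x. homogeneous q A B (g x))"
    and integral_dil_spreading:
      "(\<lambda>n. LINT x|lebesgue. F (dil q (j n) (y n) g x)) \<longlonglongrightarrow> (LINT x|lebesgue. homogeneous q A B (g x))"
proof -
  have F0: "F 0 = 0" using F by (simp add: critical_growth_def)
  define s where "s n = 2 powr (real_of_int (j n) * real CARD('n) / q)" for n
  have st: "s \<longlonglongrightarrow> 0"
    using tendsto_scale_at_bot[OF j, of "real CARD('n) / q"] q by (simp add: s_def[abs_def])
  have sp: "s n > 0" for n by (simp add: s_def)
  have lim: "(\<lambda>n. s n powr (- q) * F (s n * t)) \<longlonglongrightarrow> homogeneous q A B t" for t
  proof (rule homogeneous_limit[OF sp F0 A B])
    have m: "(\<lambda>n. s n * t) \<longlonglongrightarrow> 0" for t using tendsto_mult_right[OF st, of t] by simp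
    show "filterlim (\<lambda>n. s n * t) (at_right 0) sequentially" if "t > 0" for t
      using that sp by (intro tendsto_imp_filterlim_at_right m) (auto intro!: always_eventually)
    show "filterlim (\<lambda>n. s n * t) (at_left 0) sequentially" if "t < 0" for t
      using that sp by (intro tendsto_imp_filterlim_at_left m) (auto intro!: always_eventually simp: mult_pos_neg)
  qed
  show "integrable lebesgue (\<lambda>x. homogeneous q A B (g x))"
    by (rule integral_dil_homogeneous_limit(1)[OF F q g lim[unfolded s_def]])
  show "(\<lambda>n. LINT x|lebesgue. F (dil q (j n) (y n) g x)) \<longlonglongrightarrow> (LINT x|lebesgue. homogeneous q A B (g x))"
    by (rule integral_dil_homogeneous_limit(2)[OF F q g lim[unfolded s_def]])
qed

lemma convergent_int_eventually_const:
  fixes X :: "nat \<Rightarrow> int"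
  assumes "convergent (\<lambda>n. real_of_int (X n))"
  shows "\<exists>J. eventually (\<lambda>n. X n = J) sequentially"
proof -
  have "Cauchy (\<lambda>n. real_of_int (X n))" using assms by (rule convergent_Cauchy)
  then obtain M where M: "\<And>m n. m \<ge> M \<Longrightarrow> n \<ge> M \<Longrightarrow> \<bar>real_of_int (X m) - real_of_int (X n)\<bar> < 1"
    unfolding Cauchy_def dist_real_def by (meson zero_less_one)
  have "X n = X M" if "n \<ge> M" for n using M[OF that order_refl] by linarith
  then show ?thesis by (auto simp: eventually_sequentially)
qed

text \<open>Each derivative contributes a factor 2^j, and these factors change the normalisation for
  L^{p^*_m} into exactly the one for L^q.\<close>

lemma is_weak_deriv_bubble:
  fixes w :: "real ^ 'n \<Rightarrow> real"
  assumes v: "is_weak_deriv \<alpha> w v" and p: "0 < p" and \<alpha>: "mi_order \<alpha> < m"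
  shows "is_weak_deriv \<alpha> (bubble m p w y j) (dil (crit TYPE('n) p (m - mi_order \<alpha>)) j y v)"
proof -
  define N k where "N = real CARD('n)" and "k = mi_order \<alpha>"
  define c where "c = 2 powr (real_of_int j * N / crit TYPE('n) p m)"
  have N: "N > 0" by (simp add: N_def)
  \<comment> \<open>N / p^*_s = N / p - s, so lowering s by the order of \<alpha> adds that
    order.\<close>
  have e: "N / crit TYPE('n) p m + k = N / crit TYPE('n) p (m - k)"
  proof -
    have "N / crit TYPE('n) p s = (N - real s * p) / p" for s
      using N p by (simp add: crit_def N_def[symmetric])
    moreover have "(N - real m * p) / p + k = (N - real (m - k) * p) / p"
      using \<alpha> p by (simp add: k_def of_nat_diff field_simps)
    ultimately show ?thesis by simp
  qed
  have "is_weak_deriv \<alpha> (\<lambda>x. c * w (2 powr real_of_int j *\<^sub>R (x - y)))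
      (\<lambda>x. c * ((2 powr real_of_int j) ^ k * v (2 powr real_of_int j *\<^sub>R (x - y))))"
    unfolding k_def by (intro is_weak_deriv_cmult is_weak_deriv_scale v) simp
  moreover have "c * (2 powr real_of_int j) ^ k = 2 powr (real_of_int j * N / crit TYPE('n) p (m - k))"
  proof -
    have "c * (2 powr real_of_int j) ^ k = 2 powr (real_of_int j * (N / crit TYPE('n) p m + k))"
      by (simp add: c_def powr_realpow[symmetric] powr_powr powr_add[symmetric] distrib_left)
    then show ?thesis by (simp add: e)
  qed
  ultimately show ?thesis
    by (simp add: bubble_def[abs_def] dil_def[abs_def] c_def N_def k_def mult.assoc[symmetric])
qed

text \<open>Taking the limit in \<open>n\<close> first, the integral splits into the profiles up to \<open>L\<close> and a remainder
  that is small in \<open>L\<^sup>q\<close>, uniformly in \<open>n\<close>, for large \<open>L\<close>. Applied to \<open>\<bar>s\<bar> powr q\<close> the splitting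
  also bounds the sum of the \<open>q\<close>-th powers of the profile norms.\<close>

lemma integral_decomposition_limit:
  fixes v :: "nat \<Rightarrow> real ^ 'n \<Rightarrow> real" and R :: "nat \<Rightarrow> nat \<Rightarrow> real ^ 'n \<Rightarrow> real" and \<Lambda> :: enat
  defines "I \<equiv> {l. enat l \<le> \<Lambda>}"
  assumes q: "1 < q" and F: "critical_growth q F"
    and v: "\<And>n. v n \<in> Lq q" and G: "\<And>l. l \<in> I \<Longrightarrow> G l \<in> Lq q"
    and R: "\<And>L n. L \<in> I \<Longrightarrow> L \<le> n \<Longrightarrow> R L n \<in> Lq q"
    and dec: "\<And>L n. L \<in> I \<Longrightarrow> L \<le> n \<Longrightarrow> AE x in lebesgue. v n x = (\<Sum>l<Suc L. dil q (j l n) (y l n) (G l) x) + R L n x"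
    and orth: "\<And>l k. l \<in> I \<Longrightarrow> k \<in> I \<Longrightarrow> l \<noteq> k \<Longrightarrow>
      filterlim (\<lambda>n. \<bar>real_of_int (j l n) - real_of_int (j k n)\<bar> + 2 powr real_of_int (j k n) * norm (y l n - y k n)) at_top sequentially"
    and rem: "\<And>\<epsilon>. 0 < \<epsilon> \<Longrightarrow> \<exists>L0\<in>I. \<forall>L\<in>I. L0 \<le> L \<longrightarrow>
      eventually (\<lambda>n. (LINT x|lebesgue. \<bar>R L n x\<bar> powr q) \<le> \<epsilon>) sequentially"
    and lim: "\<And>l. l \<in> I \<Longrightarrow> (\<lambda>n. LINT x|lebesgue. F (dil q (j l n) (y l n) (G l) x)) \<longlonglongrightarrow> c l"
  shows "c summable_on I" and "(\<lambda>n. LINT x|lebesgue. F (v n x)) \<longlonglongrightarrow> infsum c I"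
proof -
  have q0: "q > 0" "q \<ge> 0" using q by auto
  have down: "l \<in> I" if "l \<le> k" "k \<in> I" for l k using that by (auto simp: I_def) (meson enat_ord_simps(1) order_trans)
  define T where "T l n = dil q (j l n) (y l n) (G l)" for l n
  define S where "S L n x = (\<Sum>l<Suc L. T l n x)" for L n x
  have T: "T l n \<in> Lq q" if "l \<in> I" for l n unfolding T_def using G[OF that] q0(1) by (rule dil_Lq)
  have T_int: "(LINT x|lebesgue. \<bar>T l n x\<bar> powr q) = (LINT x|lebesgue. \<bar>G l x\<bar> powr q)" if "l \<in> I" for l n
    unfolding T_def by (rule integral_dil_powr[OF G[OF that] q0(1)])
  have S: "S L n \<in> Lq q" if "L \<in> I" for L n
    unfolding S_def[abs_def] using down[OF _ that] by (intro Lq_sum T q0) (auto simp: less_Suc_eq_le)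
  have dec': "AE x in lebesgue. S L n x = v n x - R L n x" if "L \<in> I" "L \<le> n" for L n
    using dec[OF that] by eventually_elim (simp add: S_def T_def)
  have split: "(\<lambda>n. (LINT x|lebesgue. H (S L n x)) - (\<Sum>l<Suc L. LINT x|lebesgue. H (T l n x))) \<longlonglongrightarrow> 0"
    if H: "critical_growth q H" and L: "L \<in> I" for H L
    unfolding S_def
  proof (rule integral_sum_splits[OF H q0(1)])
    fix l k assume lk: "l < k" "k < Suc L"
    then show "(\<lambda>n. LINT x|lebesgue. min \<bar>T l n x\<bar> \<bar>T k n x\<bar> powr q) \<longlonglongrightarrow> 0"
      unfolding T_def using down[of l L] down[of k L] L by (intro integral_min_dil_tendsto_0 q0 G orth) auto
  next
    show "T l n \<in> Lq q" "(LINT x|lebesgue. \<bar>T l n x\<bar> powr q) \<le> (LINT x|lebesgue. \<bar>G l x\<bar> powr q)" if "l < Suc L" for l n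
      using T[of l n] T_int[of l n] down[of l L] L that by auto
  qed
  \<comment> \<open>Used twice: to bound \<open>v\<close> by a partial sum and its residual, and a
    partial sum by \<open>v\<close> and its residual.\<close>
  have quasi: "(LINT x|lebesgue. \<bar>h x\<bar> powr q) \<le> 2 powr q * ((LINT x|lebesgue. \<bar>f x\<bar> powr q) + (LINT x|lebesgue. \<bar>g x\<bar> powr q))"
    if "AE x in lebesgue. \<bar>h x\<bar> \<le> \<bar>f x\<bar> + \<bar>g x\<bar>" "f \<in> Lq q" "g \<in> Lq q" "h \<in> Lq q" for f g h :: "real ^ 'n \<Rightarrow> real"
  proof -
    have "(LINT x|lebesgue. \<bar>h x\<bar> powr q) \<le> (LINT x|lebesgue. 2 powr q * (\<bar>f x\<bar> powr q + \<bar>g x\<bar> powr q))"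
    proof (rule integral_mono_AE)
      show "AE x in lebesgue. \<bar>h x\<bar> powr q \<le> 2 powr q * (\<bar>f x\<bar> powr q + \<bar>g x\<bar> powr q)"
        using that(1)
      proof eventually_elim
        fix x assume "\<bar>h x\<bar> \<le> \<bar>f x\<bar> + \<bar>g x\<bar>"
        then have "\<bar>h x\<bar> powr q \<le> \<bar>\<bar>f x\<bar> + \<bar>g x\<bar>\<bar> powr q" using q0 by (intro powr_mono2) auto
        also have "\<dots> \<le> 2 powr q * (\<bar>f x\<bar> powr q + \<bar>g x\<bar> powr q)"
          using abs_add_powr_le[OF q0(2), of "\<bar>f x\<bar>" "\<bar>g x\<bar>"] by simp
        finally show "\<bar>h x\<bar> powr q \<le> 2 powr q * (\<bar>f x\<bar> powr q + \<bar>g x\<bar> powr q)" .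
      qed
    qed (use that in \<open>auto simp: Lq_integrable\<close>)
    then show ?thesis using that by (simp add: Lq_integrable)
  qed
  \<comment> \<open>One level whose residual is eventually at most 1 bounds all late
    \<open>v n\<close>; this bound \<open>B\<close> no longer depends on the level.\<close>
  obtain L0 where L0: "L0 \<in> I" "\<And>L. L \<in> I \<Longrightarrow> L0 \<le> L \<Longrightarrow> eventually (\<lambda>n. (LINT x|lebesgue. \<bar>R L n x\<bar> powr q) \<le> 1) sequentially"
    using rem[of 1] by auto
  obtain B0 where B0: "\<And>n. (LINT x|lebesgue. \<bar>S L0 n x\<bar> powr q) \<le> B0"
  proof -
    have "\<exists>C. \<forall>n. (LINT x|lebesgue. \<bar>\<Sum>l<Suc L0. T l n x\<bar> powr q) \<le> C"
      using down[OF _ L0(1)] T T_int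
      by (intro integral_sum_powr_bound[OF q0(1), of _ _ "\<lambda>l. LINT x|lebesgue. \<bar>G l x\<bar> powr q"]) auto
    then show ?thesis using that by (auto simp: S_def)
  qed
  define B where "B = 2 powr q * (B0 + 1)"
  have "0 \<le> (LINT x|lebesgue. \<bar>S L0 0 x\<bar> powr q)" by simp
  then have "B0 \<ge> 0" using B0[of 0] by linarith
  then have Bpos: "B \<ge> 0" by (simp add: B_def)
  have vB: "eventually (\<lambda>n. (LINT x|lebesgue. \<bar>v n x\<bar> powr q) \<le> B) sequentially"
    using L0(2)[OF L0(1) order_refl] eventually_ge_at_top[of L0]
  proof eventually_elim
    fix n assume n: "(LINT x|lebesgue. \<bar>R L0 n x\<bar> powr q) \<le> 1" "L0 \<le> n"
    have "AE x in lebesgue. \<bar>v n x\<bar> \<le> \<bar>S L0 n x\<bar> + \<bar>R L0 n x\<bar>"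
      using dec'[OF L0(1) n(2)] by eventually_elim auto
    from quasi[OF this S[OF L0(1)] R[OF L0(1) n(2)] v]
    have "(LINT x|lebesgue. \<bar>v n x\<bar> powr q) \<le> 2 powr q * ((LINT x|lebesgue. \<bar>S L0 n x\<bar> powr q) + (LINT x|lebesgue. \<bar>R L0 n x\<bar> powr q))" .
    also have "\<dots> \<le> B" unfolding B_def using B0[of n] n(1) by (intro mult_left_mono add_mono) auto
    finally show "(LINT x|lebesgue. \<bar>v n x\<bar> powr q) \<le> B" .
  qed
  define g where "g l = (LINT x|lebesgue. \<bar>G l x\<bar> powr q)" for l
  have g0: "g l \<ge> 0" for l by (simp add: g_def)
  \<comment> \<open>The partial sum is \<open>v n\<close> minus a residual that is eventually at
    most 1, so its q-th power has an integral bounded independently of L. By the splitting, the same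
    bound holds for the sum of the profile integrals.\<close>
  have gB: "(\<Sum>l<Suc L. g l) \<le> 2 powr q * (B + 1)" if L: "L \<in> I" "L0 \<le> L" for L
  proof -
    have "(\<lambda>n. (LINT x|lebesgue. \<bar>S L n x\<bar> powr q) - (\<Sum>l<Suc L. LINT x|lebesgue. \<bar>T l n x\<bar> powr q)) \<longlonglongrightarrow> 0"
      by (rule split[OF critical_growth_abs_powr[OF q] L(1)])
    moreover have "(\<Sum>l<Suc L. LINT x|lebesgue. \<bar>T l n x\<bar> powr q) = (\<Sum>l<Suc L. g l)" for n
      using down[OF _ L(1)] by (intro sum.cong) (auto simp: T_int g_def)
    ultimately have "(\<lambda>n. LINT x|lebesgue. \<bar>S L n x\<bar> powr q) \<longlonglongrightarrow> (\<Sum>l<Suc L. g l)"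
      by (simp only: LIM_zero_iff)
    moreover have "eventually (\<lambda>n. (LINT x|lebesgue. \<bar>S L n x\<bar> powr q) \<le> 2 powr q * (B + 1)) sequentially"
      using vB L0(2)[OF L] eventually_ge_at_top[of L]
    proof eventually_elim
      fix n assume n: "(LINT x|lebesgue. \<bar>v n x\<bar> powr q) \<le> B" "(LINT x|lebesgue. \<bar>R L n x\<bar> powr q) \<le> 1" "L \<le> n"
      have "AE x in lebesgue. \<bar>S L n x\<bar> \<le> \<bar>v n x\<bar> + \<bar>R L n x\<bar>"
        using dec'[OF L(1) n(3)] by eventually_elim auto
      from quasi[OF this v R[OF L(1) n(3)] S[OF L(1)]]
      have "(LINT x|lebesgue. \<bar>S L n x\<bar> powr q) \<le> 2 powr q * ((LINT x|lebesgue. \<bar>v n x\<bar> powr q) + (LINT x|lebesgue. \<bar>R L n x\<bar> powr q))" .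
      also have "\<dots> \<le> 2 powr q * (B + 1)" using n by (intro mult_left_mono add_mono) auto
      finally show "(LINT x|lebesgue. \<bar>S L n x\<bar> powr q) \<le> 2 powr q * (B + 1)" .
    qed
    ultimately show ?thesis by (intro tendsto_upperbound) auto
  qed
  obtain K where K: "K \<ge> 0" "\<And>s. \<bar>F s\<bar> \<le> K * \<bar>s\<bar> powr q" using critical_growth_bound[OF F] by blast
  have cg: "\<bar>c l\<bar> \<le> K * g l" if l: "l \<in> I" for l
  proof (rule tendsto_upperbound[OF tendsto_rabs[OF lim[OF l]]])
    have "\<bar>LINT x|lebesgue. F (T l n x)\<bar> \<le> K * g l" for n
    proof -
      have "\<bar>LINT x|lebesgue. F (T l n x)\<bar> \<le> (LINT x|lebesgue. \<bar>F (T l n x)\<bar>)" by (rule integral_abs_bound)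
      also have "\<dots> \<le> (LINT x|lebesgue. K * \<bar>T l n x\<bar> powr q)"
        using critical_growth_integrable[OF F T[OF l]] Lq_integrable[OF T[OF l]] K by (intro integral_mono) auto
      also have "\<dots> = K * g l" using T_int[OF l] by (simp add: g_def)
      finally show ?thesis .
    qed
    then show "eventually (\<lambda>n. \<bar>LINT x|lebesgue. F (dil q (j l n) (y l n) (G l) x)\<bar> \<le> K * g l) sequentially"
      by (simp add: T_def)
  qed simp
  \<comment> \<open>The level L is the maximum of finitely many elements of \<open>I\<close>, hence
    in \<open>I\<close> also for finite \<Lambda>, and the initial segment up to L contains
    A.\<close>
  have fin: "\<exists>L\<in>I. L0 \<le> L \<and> A \<subseteq> {..<Suc L} \<and> L' \<le> L" if "finite A" "A \<subseteq> I" "L' \<in> I" for A L'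
  proof -
    define L where "L = Max (insert L0 (insert L' A))"
    have "L \<in> insert L0 (insert L' A)" unfolding L_def using that by (intro Max_in) auto
    then have "L \<in> I" using that L0(1) by auto
    moreover have "l \<le> L" if "l \<in> insert L0 (insert L' A)" for l
      unfolding L_def using that \<open>finite A\<close> by (intro Max_ge) auto
    ultimately show ?thesis by (intro bexI[of _ L]) (auto simp: less_Suc_eq_le)
  qed
  \<comment> \<open>Absolute summability makes the sum independent of any order, so it can later be
    divided among three index sets.\<close>
  have "(\<lambda>l. \<bar>c l\<bar>) summable_on I"
  proof (rule nonneg_bounded_partial_sums_imp_summable_on)
    show "eventually (\<lambda>A. (\<Sum>l\<in>A. \<bar>c l\<bar>) \<le> K * (2 powr q * (B + 1))) (finite_subsets_at_top I)"
    proof (rule eventually_finite_subsets_at_top_weakI)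
      fix A assume A: "finite A" "A \<subseteq> I"
      obtain L where L: "L \<in> I" "L0 \<le> L" "A \<subseteq> {..<Suc L}" using fin[OF A L0(1)] by blast
      have "(\<Sum>l\<in>A. \<bar>c l\<bar>) \<le> (\<Sum>l\<in>A. K * g l)" using A cg by (intro sum_mono) auto
      also have "\<dots> \<le> (\<Sum>l<Suc L. K * g l)" using L K g0 by (intro sum_mono2) auto
      also have "\<dots> = K * (\<Sum>l<Suc L. g l)" by (simp only: sum_distrib_left)
      also have "\<dots> \<le> K * (2 powr q * (B + 1))" using gB[OF L(1,2)] K by (intro mult_left_mono) auto
      finally show "(\<Sum>l\<in>A. \<bar>c l\<bar>) \<le> K * (2 powr q * (B + 1))" .
    qed
  qed simp
  then show cs: "c summable_on I"
    using abs_summable_summable[of c I] by simp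
  show "(\<lambda>n. LINT x|lebesgue. F (v n x)) \<longlonglongrightarrow> infsum c I"
    unfolding tendsto_iff dist_real_def
  proof (intro allI impI)
    fix e :: real assume e: "0 < e"
    \<comment> \<open>Order of choices: \<epsilon> from \<open>B\<close>, then \<open>M\<close> from
      \<epsilon>, then \<eta> from \<open>M\<close>, then L, then n. The residual costs \<epsilon> B
      + M \<eta>, at most e / 4; the tail of the series and the limit in n cost less than e / 4
      each.\<close>
    define \<epsilon> where "\<epsilon> = e / (8 * (B + 1))"
    have \<epsilon>: "\<epsilon> > 0" "\<epsilon> * B \<le> e / 8" using e Bpos by (auto simp: \<epsilon>_def field_simps)
    obtain M where M: "M \<ge> 0" "\<And>a b. \<bar>F (a + b) - F a\<bar> \<le> \<epsilon> * \<bar>a\<bar> powr q + M * \<bar>b\<bar> powr q"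
      using F \<epsilon>(1) unfolding critical_growth_def by meson
    define \<eta> where "\<eta> = e / (8 * (M + 1))"
    have \<eta>: "\<eta> > 0" "M * \<eta> \<le> e / 8" using e M(1) by (auto simp: \<eta>_def field_simps)
    obtain L1 where L1: "L1 \<in> I" "\<And>L. L \<in> I \<Longrightarrow> L1 \<le> L \<Longrightarrow> eventually (\<lambda>n. (LINT x|lebesgue. \<bar>R L n x\<bar> powr q) \<le> \<eta>) sequentially"
      using rem[OF \<eta>(1)] by blast
    have "(sum c \<longlongrightarrow> infsum c I) (finite_subsets_at_top I)"
      using has_sum_infsum[OF cs] by (simp add: has_sum_def)
    then have "eventually (\<lambda>A. \<bar>sum c A - infsum c I\<bar> < e / 4) (finite_subsets_at_top I)"
      using e unfolding tendsto_iff dist_real_def by (metis divide_pos_pos zero_less_numeral)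
    then have "\<exists>A. finite A \<and> A \<subseteq> I \<and> (\<forall>A'. finite A' \<and> A \<subseteq> A' \<and> A' \<subseteq> I \<longrightarrow> \<bar>sum c A' - infsum c I\<bar> < e / 4)"
      by (simp only: eventually_finite_subsets_at_top)
    then obtain A where A: "finite A" "A \<subseteq> I"
      "\<And>A'. finite A' \<Longrightarrow> A \<subseteq> A' \<Longrightarrow> A' \<subseteq> I \<Longrightarrow> \<bar>sum c A' - infsum c I\<bar> < e / 4"
      by (elim exE conjE) (rule that, auto)
    obtain L where L: "L \<in> I" "A \<subseteq> {..<Suc L}" "L1 \<le> L" using fin[OF A(1,2) L1(1)] by blast
    have "{..<Suc L} \<subseteq> I" using down[OF _ L(1)] by auto
    then have near: "\<bar>(\<Sum>l<Suc L. c l) - infsum c I\<bar> < e / 4" using A(3)[of "{..<Suc L}"] L(2) by simp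
    have "(\<lambda>n. \<Sum>l<Suc L. LINT x|lebesgue. F (T l n x)) \<longlonglongrightarrow> (\<Sum>l<Suc L. c l)"
      using \<open>{..<Suc L} \<subseteq> I\<close> by (intro tendsto_sum) (auto simp: T_def intro!: lim)
    from tendsto_add[OF split[OF F L(1)] this]
    have "(\<lambda>n. LINT x|lebesgue. F (S L n x)) \<longlonglongrightarrow> (\<Sum>l<Suc L. c l)" by simp
    then have "eventually (\<lambda>n. \<bar>(LINT x|lebesgue. F (S L n x)) - (\<Sum>l<Suc L. c l)\<bar> < e / 4) sequentially"
      using e unfolding tendsto_iff dist_real_def by (metis divide_pos_pos zero_less_numeral)
    with vB L1(2)[OF L(1,3)] eventually_ge_at_top[of L]
    show "eventually (\<lambda>n. \<bar>(LINT x|lebesgue. F (v n x)) - infsum c I\<bar> < e) sequentially"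
    proof eventually_elim
      fix n assume n: "(LINT x|lebesgue. \<bar>v n x\<bar> powr q) \<le> B" "(LINT x|lebesgue. \<bar>R L n x\<bar> powr q) \<le> \<eta>" "L \<le> n"
        and SL: "\<bar>(LINT x|lebesgue. F (S L n x)) - (\<Sum>l<Suc L. c l)\<bar> < e / 4"
      have iS: "integrable lebesgue (\<lambda>x. F (S L n x))" and iv: "integrable lebesgue (\<lambda>x. F (v n x))"
        by (intro critical_growth_integrable[OF F] S[OF L(1)] v)+
      have iR: "integrable lebesgue (\<lambda>x. \<epsilon> * \<bar>v n x\<bar> powr q + M * \<bar>R L n x\<bar> powr q)"
        using Lq_integrable[OF v] Lq_integrable[OF R[OF L(1) n(3)]] by simp
      have "\<bar>(LINT x|lebesgue. F (S L n x)) - (LINT x|lebesgue. F (v n x))\<bar> = \<bar>LINT x|lebesgue. F (S L n x) - F (v n x)\<bar>"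
        using iS iv by simp
      also have "\<dots> \<le> (LINT x|lebesgue. \<bar>F (S L n x) - F (v n x)\<bar>)" by (rule integral_abs_bound)
      also have "\<dots> \<le> (LINT x|lebesgue. \<epsilon> * \<bar>v n x\<bar> powr q + M * \<bar>R L n x\<bar> powr q)"
      proof (rule integral_mono_AE)
        show "AE x in lebesgue. \<bar>F (S L n x) - F (v n x)\<bar> \<le> \<epsilon> * \<bar>v n x\<bar> powr q + M * \<bar>R L n x\<bar> powr q"
          using dec'[OF L(1) n(3)]
        proof eventually_elim
          fix x assume "S L n x = v n x - R L n x"
          then show "\<bar>F (S L n x) - F (v n x)\<bar> \<le> \<epsilon> * \<bar>v n x\<bar> powr q + M * \<bar>R L n x\<bar> powr q"
            \<comment> \<open>The base point is \<open>v n\<close>, whose bound \<open>B\<close> was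
              fixed before L; the increment is minus the residual.\<close>
            using M(2)[of "v n x" "- R L n x"] by simp
        qed
      qed (use iS iv iR in auto)
      also have "\<dots> = \<epsilon> * (LINT x|lebesgue. \<bar>v n x\<bar> powr q) + M * (LINT x|lebesgue. \<bar>R L n x\<bar> powr q)"
        using Lq_integrable[OF v] Lq_integrable[OF R[OF L(1) n(3)]] by simp
      also have "\<dots> \<le> \<epsilon> * B + M * \<eta>" using n \<epsilon> M by (intro add_mono mult_left_mono) auto
      also have "\<dots> \<le> e / 4" using \<epsilon> \<eta> by simp
      finally show "\<bar>(LINT x|lebesgue. F (v n x)) - infsum c I\<bar> < e" using SL near e by linarith
    qed
  qed
qed

text \<open>For finite \<Lambda> the only admissible level past the threshold is \<Lambda> itself,
  so both kinds of limit take the form of a statement about all large admissible L.\<close>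

lemma eventually_toward:
  assumes "eventually P (toward \<Lambda>)"
  shows "\<exists>L0. enat L0 \<le> \<Lambda> \<and> (\<forall>L. enat L \<le> \<Lambda> \<longrightarrow> L0 \<le> L \<longrightarrow> P L)"
proof (cases \<Lambda>)
  case (enat k)
  then have "P k" using assms by (simp add: toward_def eventually_principal)
  then show ?thesis using enat by (intro exI[of _ k]) auto
next
  case infinity
  then show ?thesis using assms by (auto simp: toward_def eventually_sequentially)
qed

text \<open>Integrability and summability are part of the conclusion because a divergent integral or
  sum has the value 0 in HOL, and the limit formula alone would not exclude this. The bubble is
  centred at 0 because its integral is invariant under translations.\<close>

theorem theorem3p2:
  fixes m :: nat and p q C ap am Ap Am :: real
    and u w :: "nat \<Rightarrow> real ^ 'n \<Rightarrow> real"
    and y :: "nat \<Rightarrow> nat \<Rightarrow> real ^ 'n" and j :: "nat \<Rightarrow> nat \<Rightarrow> int" and \<Lambda> :: enat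
    and \<sigma> :: "nat \<Rightarrow> nat"
    and \<alpha> :: "nat ^ 'n" and f F F0 Finf :: "real \<Rightarrow> real"
  assumes "1 \<le> m" and "1 < p" and "p < real CARD('n) / real m"
    and "\<forall>n. u n \<in> Wdot m p"
    and "\<exists>B::real. \<forall>n. W_norm m p UNIV (u n) \<le> ennreal B"
    and "strict_mono \<sigma>"
    and "profile_decomposition m p (\<lambda>n. u (\<sigma> n)) w y j \<Lambda>"
    and "mi_order \<alpha> < m"
    and "q = crit TYPE('n) p (m - mi_order \<alpha>)"
    and "continuous_on UNIV f"
    and "C > 0" and "\<forall>s. \<bar>f s\<bar> \<le> C * \<bar>s\<bar> powr (q - 1)"
    and "F = primitive f"
    and "((\<lambda>s. \<bar>s\<bar> powr (- q) * F s) \<longlongrightarrow> ap) (at_right 0)"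
    and "((\<lambda>s. \<bar>s\<bar> powr (- q) * F s) \<longlongrightarrow> am) (at_left 0)"
    and "((\<lambda>s. \<bar>s\<bar> powr (- q) * F s) \<longlongrightarrow> Ap) at_top"
    and "((\<lambda>s. \<bar>s\<bar> powr (- q) * F s) \<longlongrightarrow> Am) at_bot"
    and "F0 = homogeneous q ap am"
    and "Finf = homogeneous q Ap Am"
  shows "\<exists>\<rho> N1 N2 N3 J. strict_mono (\<rho> :: nat \<Rightarrow> nat) \<and>
    N1 \<union> N2 \<union> N3 = {l. enat l \<le> \<Lambda>} \<and>
    (\<forall>l\<in>N1. (\<lambda>n. real_of_int (j l (\<rho> n))) \<longlonglongrightarrow> real_of_int (J l)) \<and>
    (\<forall>l\<in>N2. filterlim (\<lambda>n. real_of_int (j l (\<rho> n))) at_top sequentially) \<and>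
    (\<forall>l\<in>N3. filterlim (\<lambda>n. real_of_int (j l (\<rho> n))) at_bot sequentially) \<and>
    (\<forall>n. integrable lebesgue (\<lambda>x. F (wderiv \<alpha> (u (\<sigma> (\<rho> n))) x))) \<and>
    (\<forall>l\<in>N1. integrable lebesgue (\<lambda>x. F (wderiv \<alpha> (bubble m p (w l) 0 (J l)) x))) \<and>
    (\<forall>l\<in>N2. integrable lebesgue (\<lambda>x. Finf (wderiv \<alpha> (w l) x))) \<and>
    (\<forall>l\<in>N3. integrable lebesgue (\<lambda>x. F0 (wderiv \<alpha> (w l) x))) \<and>
    (\<lambda>l. LINT x|lebesgue. F (wderiv \<alpha> (bubble m p (w l) 0 (J l)) x)) summable_on N1 \<and>
    (\<lambda>l. LINT x|lebesgue. Finf (wderiv \<alpha> (w l) x)) summable_on N2 \<and>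
    (\<lambda>l. LINT x|lebesgue. F0 (wderiv \<alpha> (w l) x)) summable_on N3 \<and>
    (\<lambda>n. LINT x|lebesgue. F (wderiv \<alpha> (u (\<sigma> (\<rho> n))) x)) \<longlonglongrightarrow>
        (\<Sum>\<^sub>\<infinity>l\<in>N1. LINT x|lebesgue. F (wderiv \<alpha> (bubble m p (w l) 0 (J l)) x))
      + (\<Sum>\<^sub>\<infinity>l\<in>N2. LINT x|lebesgue. Finf (wderiv \<alpha> (w l) x))
      + (\<Sum>\<^sub>\<infinity>l\<in>N3. LINT x|lebesgue. F0 (wderiv \<alpha> (w l) x))"
proof -
  have mN: "real m * p < real CARD('n)" using assms(1,3) by (simp add: field_simps)
  define I where "I = {l. enat l \<le> \<Lambda>}"
  define s where "s = m - mi_order \<alpha>"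
  have "real s * p \<le> real m * p" using assms(2) by (intro mult_right_mono) (auto simp: s_def)
  from le_less_trans[OF this mN] have "p \<le> q"
    unfolding assms(9) s_def using assms(2) by (intro crit_ge) auto
  then have q: "1 < q" using assms(2) by simp
  then have q0: "q > 0" by simp
  define r where "r = residual m p (\<lambda>n. u (\<sigma> n)) w y j"
  note D = assms(7)[unfolded profile_decomposition_def Let_def, folded I_def r_def]
  note D2 = conjunct2[OF D] note D3 = conjunct2[OF D2] note D4 = conjunct2[OF D3]
  note D5 = conjunct2[OF D4] note D6 = conjunct2[OF D5] note D7 = conjunct2[OF D6]
  note D8 = conjunct2[OF D7] note D9 = conjunct2[OF D8] note D10 = conjunct2[OF D9]
  note D11 = conjunct2[OF D10] note D12 = conjunct2[OF D11]
  have wW: "w l \<in> Wdot m p" if "l \<in> I" for l using conjunct1[OF D] that by blast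
  have rW: "r L n \<in> Wdot m p" if "L \<in> I" "L \<le> n" for L n using conjunct1[OF D2] that by blast
  have j0: "j 0 n = 0" for n using conjunct1[OF D3] by blast
  have orth: "filterlim (\<lambda>n. \<bar>real_of_int (j l n) - real_of_int (j k n)\<bar> + 2 powr real_of_int (j k n) * norm (y l n - y k n)) at_top sequentially"
    if "l \<in> I" "k \<in> I" "l \<noteq> k" for l k
    using conjunct1[OF D5] that by blast
  have tri: "filterlim (\<lambda>n. real_of_int (j l n) - real_of_int (j k n)) at_top sequentially \<or>
     filterlim (\<lambda>n. real_of_int (j l n) - real_of_int (j k n)) at_bot sequentially \<or>
     convergent (\<lambda>n. real_of_int (j l n) - real_of_int (j k n))" if "l \<in> I" "k \<in> I" "l \<noteq> k" for l k
    using conjunct1[OF D5] that by blast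
  \<comment> \<open>The last clause of the decomposition, taken at the order of \<alpha>: its
    exponent is then exactly q.\<close>
  have small: "((\<lambda>L. limsup (\<lambda>n. W_norm (mi_order \<alpha>) q UNIV (r L n))) \<longlongrightarrow> 0) (toward \<Lambda>)"
    using conjunct2[OF D12] assms(8) unfolding assms(9) by blast
  have I0: "0 \<in> I" by (simp add: I_def zero_enat_def[symmetric])
  define G where "G l = wderiv \<alpha> (w l)" for l
  define v where "v n = wderiv \<alpha> (u (\<sigma> n))" for n
  define R where "R L n = wderiv \<alpha> (r L n)" for L n
  note W = Wdot_weak_deriv[OF assms(2,1,3) _ assms(8), folded assms(9)]
  have v: "v n \<in> Lq q" for n unfolding v_def using assms(4) by (intro W(2)) auto
  have G: "G l \<in> Lq q" if "l \<in> I" for l unfolding G_def using wW[OF that] by (rule W(2))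
  have R: "R L n \<in> Lq q" if "L \<in> I" "L \<le> n" for L n unfolding R_def using rW[OF that] by (rule W(2))
  have bub: "is_weak_deriv \<alpha> (bubble m p (w l) z i) (dil q i z (G l))" if "l \<in> I" for l z i
    using is_weak_deriv_bubble[OF W(1)[OF wW[OF that]] _ assms(8), of p] assms(2) unfolding G_def assms(9) by simp
  have down: "l \<in> I" if "l \<le> L" "L \<in> I" for l L
    using that by (auto simp: I_def) (meson enat_ord_simps(1) order_trans)
  \<comment> \<open>The difference of the weak derivatives is a weak derivative of the residual;
    uniqueness equates it with the chosen one, but only off a null set depending on L and n.\<close>
  have dec: "AE x in lebesgue. v n x = (\<Sum>l<Suc L. dil q (j l n) (y l n) (G l) x) + R L n x" if L: "L \<in> I" "L \<le> n" for L n
  proof -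
    have "is_weak_deriv \<alpha> (\<lambda>x. u (\<sigma> n) x - (\<Sum>l\<le>L. bubble m p (w l) (y l n) (j l n) x))
        (\<lambda>x. v n x - (\<Sum>l\<le>L. dil q (j l n) (y l n) (G l) x))"
    proof (intro is_weak_deriv_diff is_weak_deriv_sum bub)
      show "is_weak_deriv \<alpha> (u (\<sigma> n)) (v n)" unfolding v_def using assms(4) by (intro W(1)) auto
    qed (use down[OF _ L(1)] in auto)
    then have "is_weak_deriv \<alpha> (r L n) (\<lambda>x. v n x - (\<Sum>l\<le>L. dil q (j l n) (y l n) (G l) x))"
      unfolding r_def residual_def[abs_def] .
    from wderiv_AE_eq[OF this] show ?thesis
      unfolding R_def lessThan_Suc_atMost by eventually_elim simp
  qed
  have rem: "\<exists>L0\<in>I. \<forall>L\<in>I. L0 \<le> L \<longrightarrow> eventually (\<lambda>n. (LINT x|lebesgue. \<bar>R L n x\<bar> powr q) \<le> \<epsilon>) sequentially"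
    if \<epsilon>: "0 < \<epsilon>" for \<epsilon>
  proof -
    have "eventually (\<lambda>L. limsup (\<lambda>n. W_norm (mi_order \<alpha>) q UNIV (r L n)) < ennreal (\<epsilon> powr (1 / q))) (toward \<Lambda>)"
      using \<epsilon> by (intro order_tendstoD(2)[OF small]) simp
    from eventually_toward[OF this] obtain L0 where L0: "L0 \<in> I"
      "\<And>L. L \<in> I \<Longrightarrow> L0 \<le> L \<Longrightarrow> limsup (\<lambda>n. W_norm (mi_order \<alpha>) q UNIV (r L n)) < ennreal (\<epsilon> powr (1 / q))"
      by (auto simp: I_def)
    have "eventually (\<lambda>n. (LINT x|lebesgue. \<bar>R L n x\<bar> powr q) \<le> \<epsilon>) sequentially" if L: "L \<in> I" "L0 \<le> L" for L
      using Limsup_lessD[OF L0(2)[OF L]] eventually_ge_at_top[of L]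
    proof eventually_elim
      fix n assume n: "W_norm (mi_order \<alpha>) q UNIV (r L n) < ennreal (\<epsilon> powr (1 / q))" "L \<le> n"
      have "ennreal (LINT x|lebesgue. \<bar>R L n x\<bar> powr q) = (\<integral>\<^sup>+x. ennreal (\<bar>R L n x\<bar> powr q) \<partial>lebesgue)"
        by (rule nn_integral_Lq[symmetric, OF R[OF L(1) n(2)]])
      also have "\<dots> \<le> epow (W_norm (mi_order \<alpha>) q UNIV (r L n)) q"
        unfolding R_def using q0 by (intro nn_integral_wderiv_le_W_norm) simp
      also have "\<dots> \<le> epow (ennreal (\<epsilon> powr (1 / q))) q"
        using n(1) q0 by (intro epow_mono) auto
      also have "\<dots> = ennreal \<epsilon>" using q0 \<epsilon> by (simp add: epow_ennreal powr_powr)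
      finally show "(LINT x|lebesgue. \<bar>R L n x\<bar> powr q) \<le> \<epsilon>" using \<epsilon> by (simp add: ennreal_le_iff)
    qed
    with L0(1) show ?thesis by blast
  qed
  have F: "critical_growth q F"
    unfolding assms(13)
  proof (rule critical_growthI[OF q primitive_has_derivative[OF assms(10)]])
    show "\<bar>f t\<bar> \<le> C * \<bar>t\<bar> powr (q - 1)" for t using assms(12) by blast
  qed (simp_all add: assms(11) primitive_def)
  \<comment> \<open>Each set excludes the previous ones, which makes the three disjoint, as the
    splitting of the infinite sum requires.\<close>
  define N1 where "N1 = {l \<in> I. convergent (\<lambda>n. real_of_int (j l n))}"
  define N2 where "N2 = {l \<in> I - N1. filterlim (\<lambda>n. real_of_int (j l n)) at_top sequentially}"
  define N3 where "N3 = I - N1 - N2"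
  have N3: "filterlim (\<lambda>n. real_of_int (j l n)) at_bot sequentially" if "l \<in> N3" for l
  proof -
    have l: "l \<in> I" "l \<notin> N1" "l \<notin> N2" using that by (auto simp: N3_def)
    \<comment> \<open>The comparison with index 0 says nothing about 0 itself; its scale is
      constant, which puts it in \<open>N1\<close>.\<close>
    have "0 \<in> N1" using I0 by (simp add: N1_def j0 convergent_const)
    then have "l \<noteq> 0" using l by metis
    then show ?thesis using tri[OF l(1) I0] l by (auto simp: N1_def N2_def j0)
  qed
  \<comment> \<open>A convergent integer sequence is eventually constant, so for profiles in
    \<open>N1\<close> the integral is eventually constant too.\<close>
  define J where "J l = (SOME J. eventually (\<lambda>n. j l n = J) sequentially)" for l
  have J: "eventually (\<lambda>n. j l n = J l) sequentially" if "l \<in> N1" for l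
  proof -
    have "\<exists>J. eventually (\<lambda>n. j l n = J) sequentially"
      using that by (intro convergent_int_eventually_const) (simp add: N1_def)
    then show ?thesis unfolding J_def by (rule someI_ex)
  qed
  define c1 where "c1 l = (LINT x|lebesgue. F (wderiv \<alpha> (bubble m p (w l) 0 (J l)) x))" for l
  define c2 where "c2 l = (LINT x|lebesgue. Finf (wderiv \<alpha> (w l) x))" for l
  define c3 where "c3 l = (LINT x|lebesgue. F0 (wderiv \<alpha> (w l) x))" for l
  define c where "c l = (if l \<in> N1 then c1 l else if l \<in> N2 then c2 l else c3 l)" for l
  have Fm [measurable]: "F \<in> borel_measurable borel" using F by (simp add: critical_growth_def)
  have AE1: "AE x in lebesgue. wderiv \<alpha> (bubble m p (w l) 0 (J l)) x = dil q (J l) 0 (G l) x" if "l \<in> I" for l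
    by (rule wderiv_AE_eq[OF bub[OF that]])
  have Lq1: "wderiv \<alpha> (bubble m p (w l) 0 (J l)) \<in> Lq q" if "l \<in> I" for l
    by (rule Lq_cong_AE[OF dil_Lq[OF G[OF that] q0] AE1[OF that]])
  have lim: "(\<lambda>n. LINT x|lebesgue. F (dil q (j l n) (y l n) (G l) x)) \<longlonglongrightarrow> c l" if l: "l \<in> I" for l
  proof -
    consider "l \<in> N1" | "l \<in> N2" | "l \<in> N3" using l by (auto simp: N3_def)
    then show ?thesis
    proof cases
      case 1
      note [measurable] = Lq_measurable[OF Lq1[OF l]] dil_measurable[OF Lq_measurable[OF G[OF l]]]
      have "c1 l = (LINT x|lebesgue. F (dil q (J l) 0 (G l) x))"
        unfolding c1_def
      proof (rule integral_cong_AE)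
        show "AE x in lebesgue. F (wderiv \<alpha> (bubble m p (w l) 0 (J l)) x) = F (dil q (J l) 0 (G l) x)"
          using AE1[OF l] by eventually_elim simp
      qed measurable
      \<comment> \<open>Changing variables removes the centre, so the moving centres
        \<open>y l n\<close> may replace 0.\<close>
      also have "\<dots> = (LINT x|lebesgue. F (dil q (J l) z (G l) x))" for z
        using integral_dil[OF Lq_measurable[OF G[OF l]] Fm] by simp
      finally have "eventually (\<lambda>n. (LINT x|lebesgue. F (dil q (j l n) (y l n) (G l) x)) = c1 l) sequentially"
        using J[OF 1] by (auto elim!: eventually_mono)
      then show ?thesis using 1 by (simp add: c_def tendsto_eventually)
    next
      case 2
      then have "filterlim (\<lambda>n. real_of_int (j l n)) at_top sequentially" by (simp add: N2_def)
      from integral_dil_concentrating[OF F q0 G[OF l] this assms(16,17)] 2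
      show ?thesis by (simp add: c_def c2_def assms(19) G_def N2_def)
    next
      case 3
      from integral_dil_spreading[OF F q0 G[OF l] N3[OF 3] assms(14,15)] 3
      show ?thesis by (simp add: c_def c3_def assms(18) G_def N3_def)
    qed
  qed
  note main = integral_decomposition_limit[OF q F v, where \<Lambda>=\<Lambda> and G=G and R=R and j=j and y=y and c=c,
    folded I_def, OF G R dec orth rem lim]
  have NI: "N1 \<union> N2 \<union> N3 = I" "N1 \<subseteq> I" "N2 \<subseteq> I" "N3 \<subseteq> I" "N1 \<inter> N2 = {}" "(N1 \<union> N2) \<inter> N3 = {}"
    by (auto simp: N1_def N2_def N3_def)
  have cs: "c summable_on N1" "c summable_on N2" "c summable_on N3"
    using NI by (auto intro: summable_on_subset_banach[OF main(1)])
  have c1: "c l = c1 l" if "l \<in> N1" for l using that by (simp add: c_def)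
  have c2: "c l = c2 l" if "l \<in> N2" for l using that by (simp add: c_def N2_def)
  have c3: "c l = c3 l" if "l \<in> N3" for l using that by (simp add: c_def N3_def)
  have s: "c1 summable_on N1" "c2 summable_on N2" "c3 summable_on N3"
    using cs summable_on_cong[of N1 c c1, OF c1] summable_on_cong[of N2 c c2, OF c2]
      summable_on_cong[of N3 c c3, OF c3] by simp_all
  have "infsum c I = infsum c (N1 \<union> N2) + infsum c N3"
    unfolding NI(1)[symmetric] by (intro infsum_Un_disjoint summable_on_Un_disjoint cs NI)
  also have "infsum c (N1 \<union> N2) = infsum c N1 + infsum c N2"
    by (intro infsum_Un_disjoint cs NI)
  finally have tot: "infsum c I = infsum c1 N1 + infsum c2 N2 + infsum c3 N3"
    using infsum_cong[of N1 c c1, OF c1] infsum_cong[of N2 c c2, OF c2] infsum_cong[of N3 c c3, OF c3] by simp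
  show ?thesis
  proof (rule exI[of _ id], rule exI[of _ N1], rule exI[of _ N2], rule exI[of _ N3], rule exI[of _ J], intro conjI ballI allI)
    show "strict_mono (id :: nat \<Rightarrow> nat)" by (simp add: strict_mono_def)
    show "N1 \<union> N2 \<union> N3 = {l. enat l \<le> \<Lambda>}" using NI(1) by (simp add: I_def)
    show "(\<lambda>n. real_of_int (j l (id n))) \<longlonglongrightarrow> real_of_int (J l)" if "l \<in> N1" for l
      using J[OF that] by (intro tendsto_eventually) (auto elim!: eventually_mono)
    show "filterlim (\<lambda>n. real_of_int (j l (id n))) at_top sequentially" if "l \<in> N2" for l
      using that by (simp add: N2_def)
    show "filterlim (\<lambda>n. real_of_int (j l (id n))) at_bot sequentially" if "l \<in> N3" for l
      using N3[OF that] by simp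
    show "integrable lebesgue (\<lambda>x. F (wderiv \<alpha> (u (\<sigma> (id n))) x))" for n
      using critical_growth_integrable[OF F v[of n]] by (simp add: v_def)
    show "integrable lebesgue (\<lambda>x. F (wderiv \<alpha> (bubble m p (w l) 0 (J l)) x))" if "l \<in> N1" for l
      using that NI by (intro critical_growth_integrable[OF F] Lq1) auto
    show "integrable lebesgue (\<lambda>x. Finf (wderiv \<alpha> (w l) x))" if "l \<in> N2" for l
      using integrable_concentrating[OF F q0 G _ assms(16,17), of l "j l"] that
      by (simp add: N2_def G_def assms(19))
    show "integrable lebesgue (\<lambda>x. F0 (wderiv \<alpha> (w l) x))" if "l \<in> N3" for l
      using integrable_spreading[OF F q0 G N3[OF that] assms(14,15)] that NI
      by (auto simp: G_def assms(18))
    show "(\<lambda>l. LINT x|lebesgue. F (wderiv \<alpha> (bubble m p (w l) 0 (J l)) x)) summable_on N1"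
      "(\<lambda>l. LINT x|lebesgue. Finf (wderiv \<alpha> (w l) x)) summable_on N2"
      "(\<lambda>l. LINT x|lebesgue. F0 (wderiv \<alpha> (w l) x)) summable_on N3"
      using s by (simp_all add: c1_def[abs_def] c2_def[abs_def] c3_def[abs_def])
    show "(\<lambda>n. LINT x|lebesgue. F (wderiv \<alpha> (u (\<sigma> (id n))) x)) \<longlonglongrightarrow>
        (\<Sum>\<^sub>\<infinity>l\<in>N1. LINT x|lebesgue. F (wderiv \<alpha> (bubble m p (w l) 0 (J l)) x))
      + (\<Sum>\<^sub>\<infinity>l\<in>N2. LINT x|lebesgue. Finf (wderiv \<alpha> (w l) x))
      + (\<Sum>\<^sub>\<infinity>l\<in>N3. LINT x|lebesgue. F0 (wderiv \<alpha> (w l) x))"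
      using main(2) unfolding tot by (simp add: v_def c1_def[abs_def] c2_def[abs_def] c3_def[abs_def])
  qed
qed

end
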